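(* Let $g=-1$, $c$ arbitrary, and consider the reduced Gauss-Codazzi system with the isothermic constraint $q=r$, for functions $v,h,q$ of $\eta$ (prime $=d/d\eta$): $$\left(\eta\frac{v'}{v}\right)'-\frac{h^2-c^2}{2\eta^2}v+\frac{2q^2}{\eta^2v}=0,\qquad -\eta vh'-2\eta^2q'=0,\qquad -\eta^2vh'-2\eta q'+4q=0,$$ with the first integral $$K=\left(\eta\frac{v'}{v}-1\right)^2-\frac{(h^2-c^2)v}{\eta}-2(h+c)q-\frac{2(h-c)q}{\eta^2}-\frac{4q^2}{\eta v}.$$ The subcase $h'\neq0$ is equivalent to $$q=c_q\frac{\eta^2}{\eta^2-1},\qquad v=\frac{4c_q\eta^2}{(1-\eta^2)^2h'},\qquad c_q\neq0\ \text{constant},$$ in which $h$ is an affine function of the Hamiltonian of the sixth Painlevé equation: $$h=-\frac8{c_q}X(X-1)\mathrm{H}_{\rm VI},\qquad X=\frac1{1-\eta^2},$$ $$A_0=\frac{K+2c_qc}4,\qquad A_2=0,\qquad A_3=-\frac{K(K+4c_qc)}{64},\qquad A_4=0,$$ where the $A_j$ are the coefficients of the equation SD-Ia obeyed by $Y=X(X-1)\mathrm{H}_{\rm VI}$. The four integration constants are $K$, $c_q$ and the two movable constants of the sixth Painlevé equation. This solution, in which $1/Q$ and $1/R$ are harmonic up to some conformal transformation, $$\frac{g_1'(z)^2}{Q}=\frac{g_2'(\bar z)^2}{R}=\frac1{c_q}\left(g_1(z)^2-g_2(\bar z)^2\right),$$ is identical to the solution of Bonnet.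
   Context: The Gauss-Codazzi system with constant $c$, for complex functions $u,H,Q,R$ (with $R$ standing for $\overline Q$) of the independent complex variables $z,\bar z$, is $$u_{z\bar z}+\tfrac12(H^2-c^2)e^u-2QRe^{-u}=0,\qquad Q_{\bar z}=\tfrac12H_ze^u,\qquad R_z=\tfrac12H_{\bar z}e^u.$$ The ODE system in the claim arises from it by $$\eta=\frac{g_1(z)}{g_2(\bar z)},\quad e^u=g_1^{-2}g_1'g_2'\,v(\eta),\quad H=h(\eta),\quad Q=g_1^{-2}g_1'^2\,q(\eta),\quad R=g_1^{-2}g_2'^2\,r(\eta),\quad q=r,$$ with $g_1,g_2$ arbitrary functions of $z$ and $\bar z$ respectively. A function $f(z,\bar z)$ is harmonic if $f_{z\bar z}=0$. The sixth Painlevé equation with parameters $\theta_\infty^2,\theta_0^2,\theta_1^2,\theta_X^2$ is (prime $=d/dX$) $$V''=\frac12\left[\frac1V+\frac1{V-1}+\frac1{V-X}\right]V'^2-\left[\frac1X+\frac1{X-1}+\frac1{V-X}\right]V'$$ $$+\frac{V(V-1)(V-X)}{2X^2(X-1)^2}\left[\theta_\infty^2-\theta_0^2\frac{X}{V^2}+\theta_1^2\frac{X-1}{(V-1)^2}+(1-\theta_X^2)\frac{X(X-1)}{(V-X)^2}\right].$$ $\mathrm{H}_{\rm VI}$ denotes a Hamiltonian of this equation (there are 24 choices), viewed as a function of $X$ along its solutions; Malmquist's choice is $$\mathrm{H}_{\rm VI}=\frac{X(X-1)V'^2}{4V(V-1)(V-X)}+\frac1{4X(X-1)}\Big[-\theta_\infty^2\left(V-\tfrac12\right)-\theta_0^2\left(\tfrac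 XV-\tfrac12\right)+\theta_1^2\left(\tfrac{X-1}{V-1}-\tfrac12\right)-(\theta_X-1)^2\left(\tfrac{X(X-1)}{V-X}+X-\tfrac12\right)\Big].$$ The function $Y=X(X-1)\mathrm{H}_{\rm VI}$ obeys the equation SD-Ia, $$-\left(X(X-1)Y''\right)^2-4Y'(XY'-Y)^2+4Y'^2(XY'-Y)+A_0Y'^2+A_2(XY'-Y)+\left(A_3+\frac{A_0^2}4\right)Y'+A_4=0,$$ with, for $\Theta_X=\theta_X-1$: $2A_0=\theta_\infty^2+\theta_0^2+\theta_1^2+\Theta_X^2$, $4A_2=-(\theta_\infty^2-\Theta_X^2)(\theta_0^2-\theta_1^2)$, $4A_3=(\theta_\infty^2-\theta_1^2)(\theta_0^2-\Theta_X^2)$, $32A_4=(\theta_\infty^2+\Theta_X^2)(\theta_0^2-\theta_1^2)^2+(\theta_\infty^2-\Theta_X^2)^2(\theta_0^2+\theta_1^2)$. The solution of Bonnet (1867, extended to arbitrary $c$ by Bobenko and Eitner), obtained by requiring $1/Q$ to be harmonic, is, in a suitable conformal coordinate $w$, with $\xi=\Re(w)$ and complex constants $c_z,c_h,\hat c_q,\hat K$, $$Q=\frac{2\hat c_q}{c_h}\,\frac{4c_z\sinh(2c_z\bar w)}{\sinh(2c_zw)\sinh(4c_z\xi)},\qquad \overline Q=\frac{2\hat c_q}{c_h}\,\frac{4c_z\sinh(2c_zw)}{\sinh(2c_z\bar w)\sinh(4c_z\xi)},\qquad e^u=4\frac{\hat c_q}{c_h^2}\hat v(\xi),\qquad H=c_h\hat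 h(\xi),$$ where, with prime $=d/d\xi$ and $C=(\hat c_qc/c_h)^2$, $\hat v\hat h'+\left(\frac{4c_z}{\sinh(4c_z\xi)}\right)^2=0$ and $$\hat K=\left(\frac{\hat h''}{\hat h'}+8c_z\coth(4c_z\xi)\right)^2+16\hat c_q\left[\left(\frac{4c_z}{\sinh(4c_z\xi)}\right)^2\frac{\hat h^2-C}{\hat h'}+\hat h'+8c_z\coth(4c_z\xi)\,\hat h\right].$$
   Formalization: "Identical to Bonnet" fails literally for Q, R; proved: same e^u, H and QR, with Q, R limits of Bonnet's under translations fixing ξ. Bonnet's relation is corrected to v̂ĥ' = (4c_z/sinh 4c_zξ)^2, and ĉ_q is normalised so that (ĉ_q c)^2 = c^2. *)

theory Defs
  imports "HOL-Complex_Analysis.Complex_Analysis"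
begin

section \<open>Functions of two independent complex variables\<close>

text \<open>
  A function of \<open>z\<close> and \<open>\<bar>z\<close>, treated as independent variables, is a curried function
  \<open>complex \<Rightarrow> complex \<Rightarrow> complex\<close>; in names the second variable is \<open>zb\<close> (or \<open>wb\<close>).
\<close>

definition D1 :: "(complex \<Rightarrow> complex \<Rightarrow> complex) \<Rightarrow> complex \<Rightarrow> complex \<Rightarrow> complex" where
  "D1 f z zb = deriv (\<lambda>s. f s zb) z"

definition D2 :: "(complex \<Rightarrow> complex \<Rightarrow> complex) \<Rightarrow> complex \<Rightarrow> complex \<Rightarrow> complex" where
  "D2 f z zb = deriv (\<lambda>s. f z s) zb"

text \<open>Holomorphy in two variables (Osgood: continuous and separately holomorphic).\<close>

definition holomorphic2_on :: "(complex \<times> complex) set \<Rightarrow> (complex \<Rightarrow> complex \<Rightarrow> complex) \<Rightarrow> bool" where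
  "holomorphic2_on G f \<longleftrightarrow> continuous_on G (\<lambda>(z, zb). f z zb) \<and>
     (\<forall>(z, zb)\<in>G. (\<lambda>s. f s zb) field_differentiable at z \<and> (\<lambda>s. f z s) field_differentiable at zb)"

definition harmonic2_on :: "(complex \<times> complex) set \<Rightarrow> (complex \<Rightarrow> complex \<Rightarrow> complex) \<Rightarrow> bool" where
  "harmonic2_on G f \<longleftrightarrow> holomorphic2_on G f \<and> (\<forall>(z, zb)\<in>G. D2 (D1 f) z zb = 0)"

section \<open>The Gauss-Codazzi system and its reduction\<close>

definition gauss_codazzi ::
  "complex \<Rightarrow> (complex \<times> complex) set \<Rightarrow> (complex \<Rightarrow> complex \<Rightarrow> complex) \<Rightarrow> (complex \<Rightarrow> complex \<Rightarrow> complex)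
   \<Rightarrow> (complex \<Rightarrow> complex \<Rightarrow> complex) \<Rightarrow> (complex \<Rightarrow> complex \<Rightarrow> complex) \<Rightarrow> bool" where
  "gauss_codazzi c G u H Q R \<longleftrightarrow>
     holomorphic2_on G u \<and> holomorphic2_on G H \<and> holomorphic2_on G Q \<and> holomorphic2_on G R \<and>
     (\<forall>(z, zb)\<in>G.
        D2 (D1 u) z zb + 1/2 * ((H z zb)^2 - c^2) * exp (u z zb)
          - 2 * Q z zb * R z zb * exp (- u z zb) = 0 \<and>
        D2 Q z zb = 1/2 * D1 H z zb * exp (u z zb) \<and>
        D1 R z zb = 1/2 * D2 H z zb * exp (u z zb))"

definition reduced_gauss :: 
  "complex \<Rightarrow> (complex \<Rightarrow> complex) \<Rightarrow> (complex \<Rightarrow> complex) \<Rightarrow> (complex \<Rightarrow> complex) \<Rightarrow> complex \<Rightarrow> bool" where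
  "reduced_gauss c v h q \<eta> \<longleftrightarrow>
     deriv (\<lambda>s. s * deriv v s / v s) \<eta> - ((h \<eta>)^2 - c^2) / (2 * \<eta>^2) * v \<eta>
       + 2 * (q \<eta>)^2 / (\<eta>^2 * v \<eta>) = 0"

definition reduced_system ::
  "complex \<Rightarrow> complex set \<Rightarrow> (complex \<Rightarrow> complex) \<Rightarrow> (complex \<Rightarrow> complex) \<Rightarrow> (complex \<Rightarrow> complex) \<Rightarrow> bool" where
  "reduced_system c D v h q \<longleftrightarrow>
     v holomorphic_on D \<and> h holomorphic_on D \<and> q holomorphic_on D \<and> (\<forall>\<eta>\<in>D. v \<eta> \<noteq> 0) \<and>
     (\<forall>\<eta>\<in>D. reduced_gauss c v h q \<eta> \<and>
        - \<eta> * v \<eta> * deriv h \<eta> - 2 * \<eta>^2 * deriv q \<eta> = 0 \<and>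
        - (\<eta>^2) * v \<eta> * deriv h \<eta> - 2 * \<eta> * deriv q \<eta> + 4 * q \<eta> = 0)"

definition first_integral ::
  "complex \<Rightarrow> (complex \<Rightarrow> complex) \<Rightarrow> (complex \<Rightarrow> complex) \<Rightarrow> (complex \<Rightarrow> complex) \<Rightarrow> complex \<Rightarrow> complex" where
  "first_integral c v h q \<eta> =
     (\<eta> * deriv v \<eta> / v \<eta> - 1)^2 - ((h \<eta>)^2 - c^2) * v \<eta> / \<eta> - 2 * (h \<eta> + c) * q \<eta>
       - 2 * (h \<eta> - c) * q \<eta> / \<eta>^2 - 4 * (q \<eta>)^2 / (\<eta> * v \<eta>)"

definition vq_form ::
  "complex \<Rightarrow> complex set \<Rightarrow> (complex \<Rightarrow> complex) \<Rightarrow> (complex \<Rightarrow> complex) \<Rightarrow> (complex \<Rightarrow> complex) \<Rightarrow> bool" where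
  "vq_form cq D v h q \<longleftrightarrow>
     (\<forall>\<eta>\<in>D. deriv h \<eta> \<noteq> 0 \<and> q \<eta> = cq * \<eta>^2 / (\<eta>^2 - 1) \<and>
        v \<eta> = 4 * cq * \<eta>^2 / ((1 - \<eta>^2)^2 * deriv h \<eta>))"

definition reduced_solution ::
  "complex \<Rightarrow> complex set \<Rightarrow> complex \<Rightarrow> complex \<Rightarrow>
   (complex \<Rightarrow> complex) \<Rightarrow> (complex \<Rightarrow> complex) \<Rightarrow> (complex \<Rightarrow> complex) \<Rightarrow> bool" where
  "reduced_solution c D cq K v h q \<longleftrightarrow>
     reduced_system c D v h q \<and> cq \<noteq> 0 \<and> vq_form cq D v h q \<and> (\<forall>\<eta>\<in>D. first_integral c v h q \<eta> = K)"

definition reduction_domain ::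
  "(complex \<Rightarrow> complex) \<Rightarrow> (complex \<Rightarrow> complex) \<Rightarrow> complex set \<Rightarrow> (complex \<times> complex) set \<Rightarrow> bool" where
  "reduction_domain g1 g2 D G \<longleftrightarrow> open G \<and>
     (\<forall>(z, zb)\<in>G. g1 analytic_on {z} \<and> g2 analytic_on {zb} \<and> deriv g1 z \<noteq> 0 \<and> deriv g2 zb \<noteq> 0 \<and>
        g1 z \<noteq> 0 \<and> g2 zb \<noteq> 0 \<and> g1 z / g2 zb \<in> D)"

text \<open>\<open>red_E\<close> is the metric coefficient \<open>e\<^sup>u\<close>, with \<open>u\<close> itself only given up to the choice of a logarithm.\<close>

definition red_E where
  "red_E g1 g2 v (z::complex) (zb::complex) =
     deriv g1 z * deriv g2 zb / (g1 z)^2 * (v (g1 z / g2 zb) :: complex)"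
definition red_H where
  "red_H g1 g2 h (z::complex) (zb::complex) = (h ((g1 z :: complex) / g2 zb) :: complex)"
definition red_Q where
  "red_Q g1 g2 q (z::complex) (zb::complex) = (deriv g1 z)^2 / (g1 z)^2 * (q (g1 z / g2 zb) :: complex)"
definition red_R where
  "red_R g1 g2 r (z::complex) (zb::complex) = (deriv g2 zb)^2 / (g1 z)^2 * (r (g1 z / g2 zb) :: complex)"

section \<open>The sixth Painleve equation\<close>

text \<open>
  The arguments \<open>ti t0 t1 tX\<close> are \<open>\<theta>\<^sub>\<infinity>, \<theta>\<^sub>0, \<theta>\<^sub>1, \<theta>\<^sub>X\<close>.
\<close>

definition pvi_rhs :: "complex \<Rightarrow> complex \<Rightarrow> complex \<Rightarrow> complex \<Rightarrow> complex \<Rightarrow> complex \<Rightarrow> complex \<Rightarrow> complex" where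
  "pvi_rhs ti t0 t1 tX X V V' =
     1/2 * (1/V + 1/(V-1) + 1/(V-X)) * V'^2 - (1/X + 1/(X-1) + 1/(V-X)) * V'
     + V * (V-1) * (V-X) / (2 * X^2 * (X-1)^2)
       * (ti^2 - t0^2 * X / V^2 + t1^2 * (X-1) / (V-1)^2 + (1 - tX^2) * X * (X-1) / (V-X)^2)"

definition pvi_solution ::
  "complex \<Rightarrow> complex \<Rightarrow> complex \<Rightarrow> complex \<Rightarrow> complex set \<Rightarrow> (complex \<Rightarrow> complex) \<Rightarrow> bool" where
  "pvi_solution ti t0 t1 tX U V \<longleftrightarrow> V holomorphic_on U \<and>
     (\<forall>X\<in>U. X \<noteq> 0 \<and> X \<noteq> 1 \<and> V X \<noteq> 0 \<and> V X \<noteq> 1 \<and> V X \<noteq> X \<and>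
        deriv (deriv V) X = pvi_rhs ti t0 t1 tX X (V X) (deriv V X))"

text \<open>Malmquist's choice of the Hamiltonian.\<close>

definition H_VI :: "complex \<Rightarrow> complex \<Rightarrow> complex \<Rightarrow> complex \<Rightarrow> (complex \<Rightarrow> complex) \<Rightarrow> complex \<Rightarrow> complex" where
  "H_VI ti t0 t1 tX V X =
     X * (X-1) * (deriv V X)^2 / (4 * V X * (V X - 1) * (V X - X))
     + 1 / (4 * X * (X-1)) *
       (- (ti^2) * (V X - 1/2) - t0^2 * (X / V X - 1/2) + t1^2 * ((X-1) / (V X - 1) - 1/2)
        - (tX - 1)^2 * (X * (X-1) / (V X - X) + X - 1/2))"

definition A0 :: "complex \<Rightarrow> complex \<Rightarrow> complex \<Rightarrow> complex \<Rightarrow> complex" where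
  "A0 ti t0 t1 tX = (ti^2 + t0^2 + t1^2 + (tX-1)^2) / 2"
definition A2 :: "complex \<Rightarrow> complex \<Rightarrow> complex \<Rightarrow> complex \<Rightarrow> complex" where
  "A2 ti t0 t1 tX = - (ti^2 - (tX-1)^2) * (t0^2 - t1^2) / 4"
definition A3 :: "complex \<Rightarrow> complex \<Rightarrow> complex \<Rightarrow> complex \<Rightarrow> complex" where
  "A3 ti t0 t1 tX = (ti^2 - t1^2) * (t0^2 - (tX-1)^2) / 4"
definition A4 :: "complex \<Rightarrow> complex \<Rightarrow> complex \<Rightarrow> complex \<Rightarrow> complex" where
  "A4 ti t0 t1 tX =
     ((ti^2 + (tX-1)^2) * (t0^2 - t1^2)^2 + (ti^2 - (tX-1)^2)^2 * (t0^2 + t1^2)) / 32"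

definition SD_Ia :: "complex \<Rightarrow> complex \<Rightarrow> complex \<Rightarrow> complex \<Rightarrow> (complex \<Rightarrow> complex) \<Rightarrow> complex \<Rightarrow> bool" where
  "SD_Ia a0 a2 a3 a4 Y X \<longleftrightarrow>
     (let Y' = deriv Y X; Y'' = deriv (deriv Y) X; L = X * deriv Y X - Y X
      in - ((X * (X-1) * Y'')^2) - 4 * Y' * L^2 + 4 * Y'^2 * L + a0 * Y'^2 + a2 * L
         + (a3 + a0^2 / 4) * Y' + a4 = 0)"

definition bonnet_params :: "complex \<Rightarrow> complex \<Rightarrow> complex \<Rightarrow> complex \<Rightarrow> complex \<Rightarrow> complex \<Rightarrow> complex \<Rightarrow> bool" where
  "bonnet_params c cq K ti t0 t1 tX \<longleftrightarrow>
     A0 ti t0 t1 tX = (K + 2 * cq * c) / 4 \<and> A2 ti t0 t1 tX = 0 \<and>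
     A3 ti t0 t1 tX = - K * (K + 4 * cq * c) / 64 \<and> A4 ti t0 t1 tX = 0"

definition X_of :: "complex \<Rightarrow> complex" where
  "X_of \<eta> = 1 / (1 - \<eta>^2)"

section \<open>The solution of Bonnet\<close>

text \<open>
  The real coordinate \<open>\<xi> = \<Re>(w)\<close> is \<open>(w + wb) / 2\<close> when \<open>w\<close> and its conjugate \<open>wb\<close> are independent.
  The constants \<open>c\<^sub>z, c\<^sub>h\<close> and the hatted \<open>c\<^sub>q, K\<close> are \<open>cz, ch, chq, Kh\<close>; the hatted functions \<open>v, h\<close> are
  \<open>vh, hh\<close>.
\<close>

definition bonnet_Q :: "complex \<Rightarrow> complex \<Rightarrow> complex \<Rightarrow> complex \<Rightarrow> complex \<Rightarrow> complex" where
  "bonnet_Q cz ch chq w wb =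
     2 * chq / ch * (4 * cz * sinh (2 * cz * wb) / (sinh (2 * cz * w) * sinh (4 * cz * ((w + wb) / 2))))"

definition bonnet_R :: "complex \<Rightarrow> complex \<Rightarrow> complex \<Rightarrow> complex \<Rightarrow> complex \<Rightarrow> complex" where
  "bonnet_R cz ch chq w wb =
     2 * chq / ch * (4 * cz * sinh (2 * cz * w) / (sinh (2 * cz * wb) * sinh (4 * cz * ((w + wb) / 2))))"

text \<open>
  With \<open>bonnet_Q\<close>, \<open>bonnet_R\<close> and the metric and mean curvature below, either Codazzi equation is
  equivalent to \<open>vh hh' = (4 cz / sinh (4 cz \<xi>))\<^sup>2\<close>, and the expression \<open>Kh\<close> is a first integral for this
  sign only; the form \<open>vh hh' + (4 cz / sinh (4 cz \<xi>))\<^sup>2 = 0\<close> found in print is incompatible with the other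
  formulas. Similarly \<open>C = (chq c / ch)\<^sup>2\<close> is the value \<open>(c / ch)\<^sup>2\<close> required by the Gauss equation exactly
  when \<open>(chq c)\<^sup>2 = c\<^sup>2\<close>; the rescaling \<open>(chq, ch, vh, hh) \<mapsto> (s chq, s ch, s vh, hh / s)\<close>, which leaves
  \<open>Q, R\<close>, the metric and the mean curvature unchanged, always allows \<open>chq = 1\<close>.
  Constancy of \<open>Kh\<close> alone admits spurious solutions when the squared bracket vanishes identically, hence
  the requirement that the whole Gauss-Codazzi system holds.
\<close>

definition bonnet_solution ::
  "complex \<Rightarrow> complex \<Rightarrow> complex \<Rightarrow> complex \<Rightarrow> complex \<Rightarrow> complex set \<Rightarrow>
   (complex \<Rightarrow> complex) \<Rightarrow> (complex \<Rightarrow> complex) \<Rightarrow> bool" where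
  "bonnet_solution c cz ch chq Kh \<Xi> vh hh \<longleftrightarrow>
     cz \<noteq> 0 \<and> ch \<noteq> 0 \<and> chq \<noteq> 0 \<and> open \<Xi> \<and> connected \<Xi> \<and>
     vh holomorphic_on \<Xi> \<and> hh holomorphic_on \<Xi> \<and>
     (\<forall>\<xi>\<in>\<Xi>.
        let S = (4 * cz / sinh (4 * cz * \<xi>))^2;
            k = 8 * cz * (cosh (4 * cz * \<xi>) / sinh (4 * cz * \<xi>));
            C = (chq * c / ch)^2;
            h' = deriv hh \<xi>; h'' = deriv (deriv hh) \<xi>
        in sinh (4 * cz * \<xi>) \<noteq> 0 \<and> vh \<xi> * h' - S = 0 \<and>
           Kh = (h'' / h' + k)^2 + 16 * chq * (S * (((hh \<xi>)^2 - C) / h') + h' + k * hh \<xi>)) \<and>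
     (\<forall>G u. open G \<longrightarrow>
        (\<forall>(w, wb)\<in>G. (w + wb) / 2 \<in> \<Xi> \<and> sinh (2 * cz * w) \<noteq> 0 \<and> sinh (2 * cz * wb) \<noteq> 0) \<longrightarrow>
        holomorphic2_on G u \<longrightarrow>
        (\<forall>(w, wb)\<in>G. exp (u w wb) = 4 * (chq / ch^2) * vh ((w + wb) / 2)) \<longrightarrow>
        gauss_codazzi c G u (\<lambda>w wb. ch * hh ((w + wb) / 2)) (bonnet_Q cz ch chq) (bonnet_R cz ch chq))"

text \<open>
  The solution of the Gauss-Codazzi system built from \<open>v, h, q\<close> and \<open>g1, g2\<close>, compared with Bonnet's one
  in the conformal coordinates \<open>w = \<phi> z\<close>, \<open>wb = \<psi> zb\<close>: the metric and the mean curvature coincide, and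
  so does the product \<open>Q R\<close>. The translations \<open>(w, wb) \<mapsto> (w + \<tau>, wb - \<tau>)\<close> do not change \<open>\<xi>\<close>, and therefore
  leave Bonnet's metric and mean curvature unchanged; they turn Bonnet's \<open>Q, R\<close> into a one-parameter family,
  and the reduced \<open>Q, R\<close> are its member at infinity.
\<close>

definition identical_to_bonnet ::
  "complex \<Rightarrow> complex \<Rightarrow> complex \<Rightarrow> (complex \<Rightarrow> complex) \<Rightarrow> (complex \<Rightarrow> complex) \<Rightarrow>
   (complex \<Rightarrow> complex) \<Rightarrow> (complex \<Rightarrow> complex) \<Rightarrow> (complex \<Rightarrow> complex) \<Rightarrow>
   (complex \<Rightarrow> complex) \<Rightarrow> (complex \<Rightarrow> complex) \<Rightarrow> (complex \<Rightarrow> complex) \<Rightarrow> (complex \<Rightarrow> complex) \<Rightarrow>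
   complex \<Rightarrow> complex \<Rightarrow> bool" where
  "identical_to_bonnet cz ch chq vh hh v h q g1 g2 \<phi> \<psi> z zb \<longleftrightarrow>
     (let w = \<phi> z; wb = \<psi> zb; \<xi> = (w + wb) / 2; w' = deriv \<phi> z; wb' = deriv \<psi> zb
      in red_E g1 g2 v z zb = 4 * (chq / ch^2) * vh \<xi> * w' * wb' \<and>
         red_H g1 g2 h z zb = ch * hh \<xi> \<and>
         (sinh (2 * cz * w) \<noteq> 0 \<longrightarrow> sinh (2 * cz * wb) \<noteq> 0 \<longrightarrow>
            red_Q g1 g2 q z zb * red_R g1 g2 q z zb
              = (bonnet_Q cz ch chq w wb * w'^2) * (bonnet_R cz ch chq w wb * wb'^2)) \<and>
         ((\<lambda>t::real. bonnet_Q cz ch chq (w - of_real t / cz) (wb + of_real t / cz) * w'^2)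
            \<longlongrightarrow> red_Q g1 g2 q z zb) at_top \<and>
         ((\<lambda>t::real. bonnet_R cz ch chq (w - of_real t / cz) (wb + of_real t / cz) * wb'^2)
            \<longlongrightarrow> red_R g1 g2 q z zb) at_top)"

end

theory Submission
  imports Defs "HOL-Real_Asymp.Real_Asymp"
begin

text \<open>
  Up to the factor \<open>- cq / 8\<close>, the function \<open>h\<close> is the Hamiltonian function \<open>Y = X(X-1)H\<^sub>V\<^sub>I\<close>: in the variable
  \<open>X = 1/(1-\<eta>\<^sup>2)\<close> one has \<open>v = - cq\<^sup>2 \<eta> / (4 Y')\<close>, the first integral becomes SD-Ia, and the Gauss equation
  becomes the third-order equation obtained by differentiating SD-Ia and dividing by \<open>Y''\<close>.

  From Painleve VI to \<open>Y\<close>: in canonical variables \<open>Y\<close>, \<open>Y'\<close> and \<open>X(X-1)Y''\<close> are polynomials, so both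
  equations, and the formula giving \<open>V\<close> from \<open>Y, Y', Y''\<close>, are polynomial identities.

  From \<open>Y\<close> to Painleve VI: if \<open>Y\<close> is not affine, take \<open>\<theta>\<^sub>\<infinity> = 0\<close>, \<open>\<theta>\<^sub>X = 1\<close> and
  \<open>\<theta>\<^sub>0\<^sup>2 = K/4 + cq c\<close>, \<open>\<theta>\<^sub>1\<^sup>2 = K/4\<close>; then \<open>V = X - (Y + cq c/8)/Y'\<close> has no poles because \<open>Y' \<noteq> 0\<close>.
  If \<open>Y\<close> is affine this \<open>V\<close> is identically \<open>0\<close> or \<open>1\<close>; then \<open>Y = - \<beta>\<^sup>2 (X - 1/2)\<close>, and for
  \<open>\<theta>\<^sub>\<infinity> = \<theta>\<^sub>0 = \<theta>\<^sub>1 = 1 - \<theta>\<^sub>X = \<beta>\<close> every solution of a Riccati equation is a solution of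
  Painleve VI with this Hamiltonian.

  Bonnet's solution is the same one in the coordinate \<open>\<eta> = exp (4 cz \<xi>)\<close>.
\<close>

section \<open>The Painleve VI Hamiltonian as a polynomial in canonical variables\<close>

text \<open>The formula for \<open>V\<close> is \<open>sig_inversion\<close> specialised: that
  identity is linear in \<open>V\<close>, and for \<open>ti = 0\<close>, \<open>tX = 1\<close> it
  loses its \<open>Y''\<close> term. The conditions \<open>A2 = A4 = 0\<close> leave three types of
  parameters; this one fits every \<open>K\<close> and \<open>cq c\<close>, because
  \<open>A0\<close> and \<open>A3\<close> then prescribe just the sum and the product of
  \<open>t0^2\<close> and \<open>t1^2\<close>. The obstacle is affine \<open>Y\<close>. Where
  \<open>Y''\<close> vanishes identically the third-order equation does not follow from SD-Ia, so
  both equations are carried along, and each is derived from Painleve VI on its own. The Riccati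
  solutions used there are the invariant line \<open>p = 0\<close> of the Hamiltonian system. The
  parametrisation is local because \<open>X\<close> is an even function of \<open>eta\<close>, and
  punctured because \<open>V\<close> may meet 0, 1 or \<open>X\<close> at isolated points. On
  Bonnet's side metric and mean curvature match exactly, whereas the reduced \<open>Q\<close> and
  \<open>R\<close> are limits of Bonnet's under opposite translations of \<open>w\<close> and
  \<open>wb\<close>. Matching this limit gives \<open>cq = - 4 chq / (ch cz)\<close>.\<close>

text \<open>
  With \<open>T = \<theta>\<^sub>X - 1\<close>, \<open>q = V\<close>, \<open>t = X\<close> and \<open>p\<close> twice the momentum of Okamoto's polynomial Hamiltonian,
  the system is \<open>t(t-1) q' = ham_p\<close>, \<open>t(t-1) p' = - ham_q / 2\<close>, and \<open>sig0, sig1, sig2\<close> are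
  \<open>8 Y\<close>, \<open>4 Y'\<close>, \<open>4 t(t-1) Y''\<close>. The scaling avoids denominators.
\<close>

definition ham_p :: "complex \<Rightarrow> complex \<Rightarrow> complex \<Rightarrow> complex \<Rightarrow> complex \<Rightarrow> complex \<Rightarrow> complex" where
  "ham_p t0 t1 T q p t = q*(q-1)*(q-t)*p - (t0*(q-1)*(q-t) + t1*q*(q-t) + T*q*(q-1))"

definition ham_q :: "complex \<Rightarrow> complex \<Rightarrow> complex \<Rightarrow> complex \<Rightarrow> complex \<Rightarrow> complex \<Rightarrow> complex \<Rightarrow> complex" where
  "ham_q ti t0 t1 T q p t = ((q-1)*(q-t) + q*(q-t) + q*(q-1))*p^2
     - 2*(t0*(2*q-1-t) + t1*(2*q-t) + T*(2*q-1))*p + ((t0+t1+T)^2 - ti^2)"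

definition sig0 :: "complex \<Rightarrow> complex \<Rightarrow> complex \<Rightarrow> complex \<Rightarrow> complex \<Rightarrow> complex \<Rightarrow> complex \<Rightarrow> complex" where
  "sig0 ti t0 t1 T q p t = 2*q*(q-1)*(q-t)*p^2
     - 4*(t0*(q-1)*(q-t) + t1*q*(q-t) + T*q*(q-1))*p + 2*((t0+t1+T)^2 - ti^2)*(q-t)
     + 2*(T^2 + 2*T*(t0+t1) - ti^2)*t + (ti^2 - t0^2 + t1^2 - T^2 - 4*t0*T)"

definition sig1 :: "complex \<Rightarrow> complex \<Rightarrow> complex \<Rightarrow> complex \<Rightarrow> complex" where
  "sig1 t0 t1 q p = - (q*(q-1)*p^2) + 2*(t0*(q-1) + t1*q)*p - (t0+t1)^2"

definition sig2 :: "complex \<Rightarrow> complex \<Rightarrow> complex \<Rightarrow> complex \<Rightarrow> complex \<Rightarrow> complex \<Rightarrow> complex \<Rightarrow> complex" where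
  "sig2 ti t0 t1 T q p t = (- ((2*q-1)*p^2) + 2*(t0+t1)*p) * ham_p t0 t1 T q p t
     - (- (q*(q-1)*p) + t0*(q-1) + t1*q) * ham_q ti t0 t1 T q p t"

text \<open>This identity and the next two are 64 times SD-Ia in canonical variables, one for each
  type of parameters with \<open>A2 = A4 = 0\<close>; restricting the parameters keeps them small.
  The signs \<open>ti = T\<close> and \<open>t1 = - t0\<close> may be chosen because only the
  squares of \<open>ti\<close> and \<open>t1\<close> enter Painleve VI and \<open>H_VI\<close>; with
  \<open>t0 + t1 = 0\<close> the constant term of \<open>sig1\<close> disappears.\<close>

lemma sd_Ia_equal_pairs:
 fixes q p t t0 T :: complex
 shows "4*(sig2 T t0 (-t0) T q p t)^2 = - (sig1 t0 (-t0) q p) * (2 * t * sig1 t0 (-t0) q p - sig0 T t0 (-t0) T q p t)^2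
  + 2*(sig1 t0 (-t0) q p)^2*(2 * t * sig1 t0 (-t0) q p - sig0 T t0 (-t0) T q p t) + 4*(t0^2+T^2)*(sig1 t0 (-t0) q p)^2+16*t0^2*T^2 * sig1 t0 (-t0) q p"
unfolding sig0_def sig1_def sig2_def ham_p_def ham_q_def by (simp, algebra)

lemma sd_Ia_ti_T_zero:
 fixes q p t t0 t1 :: complex
 shows "4*(sig2 0 t0 t1 0 q p t)^2 = - (sig1 t0 t1 q p) * (2 * t * sig1 t0 t1 q p - sig0 0 t0 t1 0 q p t)^2
  + 2*(sig1 t0 t1 q p)^2*(2 * t * sig1 t0 t1 q p - sig0 0 t0 t1 0 q p t) + 2*(t0^2+t1^2)*(sig1 t0 t1 q p)^2+(t0^2-t1^2)^2 * sig1 t0 t1 q p"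
unfolding sig0_def sig1_def sig2_def ham_p_def ham_q_def by (simp, algebra)

lemma sd_Ia_t0_t1_zero:
 fixes q p t ti T :: complex
 shows "4*(sig2 ti 0 0 T q p t)^2 = - (sig1 0 0 q p) * (2 * t * sig1 0 0 q p - sig0 ti 0 0 T q p t)^2
  + 2*(sig1 0 0 q p)^2*(2 * t * sig1 0 0 q p - sig0 ti 0 0 T q p t) + 2*(ti^2+T^2)*(sig1 0 0 q p)^2+(ti^2-T^2)^2 * sig1 0 0 q p"
unfolding sig0_def sig1_def sig2_def ham_p_def ham_q_def by (simp, algebra)


text \<open>For given \<open>sig0\<close>, \<open>sig1\<close>, \<open>sig2\<close> this is a linear
  equation for \<open>q\<close>, so \<open>Y, Y', Y''\<close> determine \<open>V\<close> wherever
  the coefficient is nonzero. For \<open>ti = T = 0\<close> it reads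
  \<open>q = t - (Y + (t0^2 - t1^2)/8) / Y'\<close>.\<close>

lemma sig_inversion:
 fixes q p t t0 t1 T :: complex
 shows "(2*(sig1 t0 t1 q p)^2+4*(T^2+ti^2) * sig1 t0 t1 q p+2*(T^2-ti^2)^2)*q
   = 2*t*(sig1 t0 t1 q p)^2 - sig0 ti t0 t1 T q p t * sig1 t0 t1 q p+(t1^2-t0^2+3*T^2+ti^2) * sig1 t0 t1 q p
   + (T^2-ti^2)*(sig0 ti t0 t1 T q p t-2*t * sig1 t0 t1 q p) + ((T^2-ti^2)^2+(t1^2-t0^2)*(3*T^2+ti^2)) + 4*T * sig2 ti t0 t1 T q p t"
unfolding sig0_def sig1_def sig2_def ham_p_def ham_q_def by algebra


text \<open>Hamilton's equation for \<open>p'\<close>. Here \<open>w\<close> and \<open>d\<close>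
  stand for \<open>t(t-1) q'\<close> and \<open>t^2 (t-1)^2 q''\<close>, the hypothesis on
  \<open>d\<close> is Painleve VI without denominators, and the left side of the conclusion is
  \<open>2 t(t-1)\<close> times the numerator of \<open>p'\<close> when \<open>p\<close> is the
  quotient that solves \<open>w = ham_p\<close>.\<close>

lemma momentum_algebra:
  fixes q t p w d t0 t1 T ti :: complex
  assumes E: "q*(q-1)*(q-t) \<noteq> 0" and w: "w = ham_p t0 t1 T q p t"
    and d: "2*(q*(q-1)*(q-t))*d = ((q-1)*(q-t) + q*(q-t) + q*(q-1))*w^2
      - 2*((2*t-1)*(q-t)+t*(t-1))*q*(q-1)*w
      + (ti^2*(q*(q-1)*(q-t))^2 - t0^2*t*((q-1)*(q-t))^2 + t1^2*(t-1)*(q*(q-t))^2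
         + (1-(T+1)^2)*t*(t-1)*(q*(q-1))^2)"
  shows "2*((2*t-1)*w + d + ((t0*(2*q-1-t)+t1*(2*q-t)+T*(2*q-1))*w - t*(t-1)*(t0*(q-1)+t1*q))
     - p*(((q-1)*(q-t) + q*(q-t) + q*(q-1))*w - t*(t-1)*q*(q-1)))
     = - (q*(q-1)*(q-t)) * ham_q ti t0 t1 T q p t" (is "?L = ?R")
proof -
  define E where "E = q*(q-1)*(q-t)"
  define S where "S = 2*E*d"
  \<comment> \<open>Only the product \<open>2 E d\<close> is known as a polynomial, so the whole
    equation is multiplied by \<open>E\<close>, which is cancelled at the end.\<close>
  have "E*?L = 2*E*((2*t-1)*w + ((t0*(2*q-1-t)+t1*(2*q-t)+T*(2*q-1))*w - t*(t-1)*(t0*(q-1)+t1*q))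
     - p*(((q-1)*(q-t) + q*(q-t) + q*(q-1))*w - t*(t-1)*q*(q-1))) + S" unfolding S_def by (simp add: algebra_simps)
  also have "S = ((q-1)*(q-t) + q*(q-t) + q*(q-1))*w^2
      - 2*((2*t-1)*(q-t)+t*(t-1))*q*(q-1)*w
      + (ti^2*(q*(q-1)*(q-t))^2 - t0^2*t*((q-1)*(q-t))^2 + t1^2*(t-1)*(q*(q-t))^2
         + (1-(T+1)^2)*t*(t-1)*(q*(q-1))^2)" unfolding S_def E_def d ..
  finally have "E*?L = E*?R" unfolding w E_def ham_p_def ham_q_def by algebra
  then show ?thesis using E mult_left_cancel[of E ?L ?R] unfolding E_def by blast
qed


text \<open>The two long factors are the partial derivatives of \<open>sig2\<close> in
  \<open>q\<close> and \<open>p\<close>, so the left side is its derivative along the flow up to a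
  factor. The right side is SD-Ia differentiated and divided by \<open>Y''\<close>. Checking it as
  an identity, for all parameters, avoids that division, which would fail for affine
  \<open>Y\<close>.\<close>

lemma sig2_deriv_algebra:
  fixes q t p t0 t1 T ti :: complex
  shows "8*((- (2*p^2) * ham_p t0 t1 T q p t + (- ((2*q-1)*p^2) + 2*(t0+t1)*p) *
         (((q-1)*(q-t) + q*(q-t) + q*(q-1))*p - (t0*(2*q-1-t) + t1*(2*q-t) + T*(2*q-1)))
       - (- ((2*q-1)*p) + t0 + t1) * ham_q ti t0 t1 T q p t
       - (- (q*(q-1)*p) + t0*(q-1) + t1*q) * ((6*q-2-2*t)*p^2 - 2*(2*t0 + 2*t1 + 2*T)*p)) * (2 * ham_p t0 t1 T q p t)
    - ((- (2*(2*q-1)*p) + 2*(t0+t1)) * ham_p t0 t1 T q p t + (- ((2*q-1)*p^2) + 2*(t0+t1)*p) * (q*(q-1)*(q-t))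
       + q*(q-1) * ham_q ti t0 t1 T q p t
       - (- (q*(q-1)*p) + t0*(q-1) + t1*q) * (2*((q-1)*(q-t) + q*(q-t) + q*(q-1))*p - 2*(t0*(2*q-1-t) + t1*(2*q-t) + T*(2*q-1))))
       * ham_q ti t0 t1 T q p t)
   = 2*(- ((2*t * sig1 t0 t1 q p - sig0 ti t0 t1 T q p t)^2) - 4*(t-1) * sig1 t0 t1 q p * (2*t * sig1 t0 t1 q p - sig0 ti t0 t1 T q p t)
     + 4*t*(sig1 t0 t1 q p)^2 + 4*(ti^2+t0^2+t1^2+T^2) * sig1 t0 t1 q p - 4*(ti^2-T^2)*(t0^2-t1^2)*t + 4*(ti^2-t1^2)*(t0^2-T^2)
     + (ti^2+t0^2+t1^2+T^2)^2)"
  unfolding sig0_def sig1_def ham_p_def ham_q_def by algebra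

section \<open>Painleve VI and its Hamiltonian in canonical variables\<close>

lemma pvi_rhs_cleared:
  assumes "q \<noteq> 0" "q \<noteq> 1" "q \<noteq> X" "X \<noteq> 0" "X \<noteq> 1"
  shows "2*(q*(q-1)*(q-X))*(X^2*(X-1)^2 * pvi_rhs ti t0 t1 tX X q r) = ((q-1)*(q-X) + q*(q-X) + q*(q-1))*(X*(X-1)*r)^2
      - 2*((2*X-1)*(q-X)+X*(X-1))*q*(q-1)*(X*(X-1)*r)
      + (ti^2*(q*(q-1)*(q-X))^2 - t0^2*X*((q-1)*(q-X))^2 + t1^2*(X-1)*(q*(q-X))^2
         + (1-tX^2)*X*(X-1)*(q*(q-1))^2)"
proof -
  define a b e where "a = q - 1" and "b = q - X" and "e = X - 1"
  have abe: "a \<noteq> 0" "b \<noteq> 0" "e \<noteq> 0" using assms by (auto simp: a_def b_def e_def)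
  define S1 S2 where "S1 = 1/q + 1/a + 1/b" and "S2 = 1/X + 1/e + 1/b"
  have S: "(q*a*b)*S1 = a*b+q*b+q*a" "(X*e*b)*S2 = (e+X)*b+X*e"
    using assms abe by (simp_all add: S1_def S2_def distrib_left distrib_right)
  have 1: "2*(q*a*b)*(X^2*e^2*(1/2 * S1 * r^2)) = (a*b+q*b+q*a)*(X*e*r)^2"
    unfolding S[symmetric] by (simp add: power2_eq_square)
  have 2: "2*(q*a*b)*(X^2*e^2*(S2 * r)) = 2*((e+X)*b+X*e)*q*a*(X*e*r)"
    unfolding S[symmetric] by (simp add: power2_eq_square)
  define F where "F = ti^2 - t0^2 * X / q^2 + t1^2 * e / a^2 + (1 - tX^2) * X * e / b^2"
  have "(q*a*b)^2 * F = ti^2*(q*a*b)^2 - t0^2*X*(a*b)^2 + t1^2*e*(q*b)^2 + (1-tX^2)*X*e*(q*a)^2"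
    using assms abe by (simp add: F_def distrib_left right_diff_distrib power_mult_distrib)
  moreover have "2*(q*a*b)*(X^2*e^2*(q * a * b / (2 * X^2 * e^2) * F)) = (q*a*b)^2 * F"
    using assms abe by (simp add: power2_eq_square)
  ultimately have 3: "2*(q*a*b)*(X^2*e^2*(q * a * b / (2 * X^2 * e^2) * F))
     = (ti^2*(q*a*b)^2 - t0^2*X*(a*b)^2 + t1^2*e*(q*b)^2 + (1-tX^2)*X*e*(q*a)^2)"
    by simp
  have e2: "2*X-1 = e+X" by (simp add: e_def)
  show ?thesis unfolding pvi_rhs_def e2
    unfolding a_def[symmetric] b_def[symmetric] e_def[symmetric] S1_def[symmetric] S2_def[symmetric] F_def[symmetric]
    unfolding 1[symmetric] 2[symmetric] 3[symmetric] by (simp only: ring_distribs mult.assoc)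
qed

lemma H_VI_cleared:
  assumes "V X \<noteq> 0" "V X \<noteq> 1" "V X \<noteq> X" "X \<noteq> 0" "X \<noteq> 1" and q: "q = V X" and r: "r = deriv V X"
  shows "8 * (q*(q-1)*(q-X)) * (X*(X-1) * H_VI ti t0 t1 tX V X) = 2*(X*(X-1)*r)^2 + (- (ti^2) * (2*q-1)*(q*(q-1)*(q-X))
        - t0^2 * (2*X - q)*(q-1)*(q-X) + t1^2 * (2*(X-1) - (q-1))*q*(q-X)
        - (tX-1)^2 * (2*X * (X-1) + (2*X - 1)*(q-X))*q*(q-1))"
proof -
  define T where "T = tX - 1"
  define a b e where "a = q - 1" and "b = q - X" and "e = X - 1"
  have abe: "q \<noteq> 0" "a \<noteq> 0" "b \<noteq> 0" "e \<noteq> 0" "X \<noteq> 0" using assms by (auto simp: a_def b_def e_def q)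
  define S where "S = (X*e*r)^2/(4*q*a*b) + 1/4*(- (ti^2) * (q - 1/2) - t0^2 * (X / q - 1/2) + t1^2 * (e / a - 1/2)
      - T^2 * (X * e / b + X - 1/2))"
  have S: "X*(X-1) * H_VI ti t0 t1 tX V X = S"
    unfolding H_VI_def S_def T_def[symmetric] q[symmetric] r[symmetric] a_def[symmetric] b_def[symmetric] e_def[symmetric]
    using abe by (simp add: distrib_left power2_eq_square)
  have "8 * (q*a*b) * S = 2*(X*e*r)^2 + (- (ti^2) * (2*q-1)*(q*a*b) - t0^2 * (2*X - q)*a*b + t1^2 * (2*e - a)*q*b
      - T^2 * (2*X * e + (2*X - 1)*b)*q*a)"
  proof -
    have "8 * (q*a*b) * ((X*e*r)^2/(4*q*a*b)) = 2*(X*e*r)^2" "8 * (q*a*b) * (1/4 * (- (ti^2) * (q - 1/2))) = - (ti^2) * (2*q-1)*(q*a*b)"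
      "8 * (q*a*b) * (1/4 * (t0^2 * (X / q - 1/2))) = t0^2 * (2*X - q)*a*b" "8 * (q*a*b) * (1/4 * (t1^2 * (e / a - 1/2))) = t1^2 * (2*e - a)*q*b"
      "8 * (q*a*b) * (1/4 * (T^2 * (X * e / b + X - 1/2))) = T^2 * (2*X * e + (2*X - 1)*b)*q*a"
      using abe by (simp_all add: divide_simps) (simp_all add: algebra_simps)
    then show ?thesis unfolding S_def by (simp only: ring_distribs)
  qed
  then show ?thesis unfolding S a_def b_def e_def T_def by simp
qed


text \<open>The momentum is found by solving \<open>ham_p = X(X-1) V'\<close> for \<open>p\<close>;
  this is possible because the coefficient \<open>V(V-1)(V-X)\<close> of \<open>p\<close> does not
  vanish on a solution.\<close>

lemma pvi_canonical:
  assumes "open U" and sol: "pvi_solution ti t0 t1 tX U V"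
  obtains p where
    "\<And>X. X \<in> U \<Longrightarrow> (V has_field_derivative ham_p t0 t1 (tX-1) (V X) (p X) X / (X*(X-1))) (at X)"
    "\<And>X. X \<in> U \<Longrightarrow> (p has_field_derivative - ham_q ti t0 t1 (tX-1) (V X) (p X) X / (2*(X*(X-1)))) (at X)"
    "\<And>X. X \<in> U \<Longrightarrow> X*(X-1) * H_VI ti t0 t1 tX V X = sig0 ti t0 t1 (tX-1) (V X) (p X) X / 8"
proof -
  define T where "T = tX - 1"
  define E where "E X = V X * (V X - 1) * (V X - X)" for X
  define B where "B X = t0*(V X-1)*(V X-X) + t1 * V X*(V X-X) + T * V X*(V X-1)" for X
  define p where "p X = (X*(X-1) * deriv V X + B X) / E X" for X
  have V: "V holomorphic_on U" using sol by (simp add: pvi_solution_def)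
  have dV: "(V has_field_derivative deriv V X) (at X)" and ddV: "(deriv V has_field_derivative deriv (deriv V) X) (at X)" if "X \<in> U" for X
    using holomorphic_derivI[OF V \<open>open U\<close> that] holomorphic_derivI[OF holomorphic_deriv[OF V \<open>open U\<close>] \<open>open U\<close> that] by auto
  have nz: "X \<noteq> 0" "X \<noteq> 1" "V X \<noteq> 0" "V X \<noteq> 1" "V X \<noteq> X" "E X \<noteq> 0" if "X \<in> U" for X
    using sol that by (auto simp: pvi_solution_def E_def)
  have w: "ham_p t0 t1 T (V X) (p X) X = X*(X-1) * deriv V X" if "X \<in> U" for X
  proof -
    have "E X * p X = X*(X-1) * deriv V X + B X" using nz[OF that] by (simp add: p_def)
    then show ?thesis by (simp add: ham_p_def E_def B_def)
  qed
  have 1: "(V has_field_derivative ham_p t0 t1 T (V X) (p X) X / (X*(X-1))) (at X)" if "X \<in> U" for X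
    using dV[OF that] nz[OF that] by (simp add: w[OF that])
  have 2: "(p has_field_derivative - ham_q ti t0 t1 T (V X) (p X) X / (2*(X*(X-1)))) (at X)" if X: "X \<in> U" for X
  proof -
    define q r d where "q = V X" and "r = deriv V X" and "d = deriv (deriv V) X"
    note n = nz[OF X]
    have Er: "E X = q*(q-1)*(q-X)" by (simp add: E_def q_def)
    have pE: "X*(X-1)*r + B X = p X * E X" using n by (simp add: p_def r_def)
    define N' where "N' = (2*X-1)*r + X*(X-1)*d + (t0*(2*q-1-X)+t1*(2*q-X)+T*(2*q-1))*r - (t0*(q-1)+t1*q)"
    define E' where "E' = ((q-1)*(q-X) + q*(q-X) + q*(q-1))*r - q*(q-1)"
    have "((\<lambda>X. X*(X-1) * deriv V X + B X) has_field_derivative N') (at X)"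
      unfolding B_def by (rule derivative_eq_intros dV ddV X refl)+ (simp add: N'_def q_def r_def d_def algebra_simps)
    moreover have "(E has_field_derivative E') (at X)"
      unfolding E_def by (rule derivative_eq_intros dV ddV X refl)+ (simp add: E'_def q_def r_def d_def algebra_simps)
    ultimately have "(p has_field_derivative (N' * E X - (X*(X-1)*r + B X) * E') / (E X * E X)) (at X)"
      unfolding p_def r_def using n by (intro DERIV_divide) auto
    also have "(N' * E X - (X*(X-1)*r + B X) * E') / (E X * E X) = (N' - p X * E') / E X"
      unfolding pE using n by (simp add: field_simps)
    also have "\<dots> = - ham_q ti t0 t1 T q (p X) X / (2*(X*(X-1)))"
    proof -
      \<comment> \<open>The differential equation for \<open>V\<close> is needed only here: the
        quotient rule has reduced \<open>p'\<close> to \<open>(N' - p E') / E\<close>, and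
        \<open>N'\<close> contains \<open>V''\<close>.\<close>
      have pvi: "d = pvi_rhs ti t0 t1 tX X q r" using sol X by (simp add: pvi_solution_def q_def r_def d_def)
      have n': "q \<noteq> 0" "q - 1 \<noteq> 0" "q - X \<noteq> 0" "X \<noteq> 0" "X - 1 \<noteq> 0" using n by (auto simp: q_def)
      have "2*(q*(q-1)*(q-X))*(X^2*(X-1)^2*d) = ((q-1)*(q-X) + q*(q-X) + q*(q-1))*(X*(X-1)*r)^2
      - 2*((2*X-1)*(q-X)+X*(X-1))*q*(q-1)*(X*(X-1)*r)
      + (ti^2*(q*(q-1)*(q-X))^2 - t0^2*X*((q-1)*(q-X))^2 + t1^2*(X-1)*(q*(q-X))^2
         + (1-(T+1)^2)*X*(X-1)*(q*(q-1))^2)"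
        using pvi_rhs_cleared[of q X ti t0 t1 tX r] n' unfolding pvi by (simp add: T_def)
      moreover have "X*(X-1)*r = ham_p t0 t1 T q (p X) X" using w[OF X] by (simp add: q_def r_def)
      ultimately have *: "2*((2*X-1)*(X*(X-1)*r) + (X^2*(X-1)^2*d) + ((t0*(2*q-1-X)+t1*(2*q-X)+T*(2*q-1))*(X*(X-1)*r) - X*(X-1)*(t0*(q-1)+t1*q))
     - p X*(((q-1)*(q-X) + q*(q-X) + q*(q-1))*(X*(X-1)*r) - X*(X-1)*q*(q-1)))
     = - (q*(q-1)*(q-X)) * ham_q ti t0 t1 T q (p X) X"
        using n' by (intro momentum_algebra) auto
      have "2*((2*X-1)*(X*(X-1)*r) + (X^2*(X-1)^2*d) + ((t0*(2*q-1-X)+t1*(2*q-X)+T*(2*q-1))*(X*(X-1)*r) - X*(X-1)*(t0*(q-1)+t1*q))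
     - p X*(((q-1)*(q-X) + q*(q-X) + q*(q-1))*(X*(X-1)*r) - X*(X-1)*q*(q-1))) = 2*(X*(X-1))*(N' - p X * E')"
        unfolding N'_def E'_def by algebra
      then have "2*(X*(X-1))*(N' - p X * E') = - E X * ham_q ti t0 t1 T q (p X) X" unfolding * Er by simp
      then show ?thesis using n by (simp add: field_simps)
    qed
    finally show ?thesis by (simp add: q_def)
  qed
  have 3: "X*(X-1) * H_VI ti t0 t1 tX V X = sig0 ti t0 t1 T (V X) (p X) X / 8" if X: "X \<in> U" for X
  proof -
    define q r where "q = V X" and "r = deriv V X"
    define a b e where "a = q - 1" and "b = q - X" and "e = X - 1"
    note n = nz[OF X]
    have abe: "q \<noteq> 0" "a \<noteq> 0" "b \<noteq> 0" "e \<noteq> 0" "X \<noteq> 0" using n by (auto simp: a_def b_def e_def q_def)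
    define P where "P = p X"
    have r: "X*e*r = q*a*b*P - (t0*a*b + t1*q*b + T*q*a)"
      using w[OF X] by (simp add: q_def r_def a_def b_def e_def P_def ham_p_def)
    have "8 * (q*a*b) * (X*(X-1) * H_VI ti t0 t1 tX V X) = 2*(X*e*r)^2 + (- (ti^2) * (2*q-1)*(q*a*b) - t0^2 * (2*X - q)*a*b + t1^2 * (2*e - a)*q*b
        - T^2 * (2*X * e + (2*X - 1)*b)*q*a)"
      unfolding T_def a_def b_def e_def using n by (intro H_VI_cleared) (auto simp: q_def r_def)
    \<comment> \<open>After \<open>X(X-1) V'\<close> is replaced by its expression in
      \<open>q\<close> and \<open>P\<close>, the right side becomes divisible by
      \<open>q a b\<close>, which is why the Hamiltonian is polynomial in the canonical
      variables.\<close>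
    also have "\<dots> = (q*a*b) * sig0 ti t0 t1 T q P X"
      unfolding r unfolding sig0_def a_def b_def e_def by algebra
    finally have "8 * (X*(X-1) * H_VI ti t0 t1 tX V X) = sig0 ti t0 t1 T q P X"
      using abe by (simp add: mult.assoc)
    then show ?thesis by (simp add: q_def P_def eq_divide_eq mult.commute[of _ 8])
  qed
  show ?thesis by (rule that[of p]) (use 1 2 3 in \<open>auto simp: T_def\<close>)
qed

lemma two_minus_Suc0: "(2::nat) - Suc 0 = 1" by simp

text \<open>Along a Hamiltonian flow only the explicit dependence of the Hamiltonian on
  \<open>X\<close> contributes to its derivative, so \<open>Y'\<close> is the polynomial
  \<open>sig1 / 4\<close>. Differentiating along the flow twice more gives \<open>Y''\<close> and
  the third-order equation, for arbitrary parameters.\<close>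

lemma pvi_sigma:
  assumes "open U" and sol: "pvi_solution ti t0 t1 tX U V"
    and Y_def: "Y = (\<lambda>X. X*(X-1) * H_VI ti t0 t1 tX V X)"
  shows "Y holomorphic_on U"
    and "X \<in> U \<Longrightarrow> 32 * X*(X-1)*((2*X-1) * deriv (deriv Y) X + X*(X-1) * deriv (deriv (deriv Y)) X)
       = - (64 * (X * deriv Y X - Y X)^2) - 128*(X-1) * deriv Y X * (X * deriv Y X - Y X) + 64*X*(deriv Y X)^2
         + 16*(ti^2+t0^2+t1^2+(tX-1)^2) * deriv Y X - 4*(ti^2-(tX-1)^2)*(t0^2-t1^2)*X + 4*(ti^2-t1^2)*(t0^2-(tX-1)^2)
         + (ti^2+t0^2+t1^2+(tX-1)^2)^2"
    and "\<exists>p. \<forall>X\<in>U. 8 * Y X = sig0 ti t0 t1 (tX-1) (V X) (p X) X \<and> 4 * deriv Y X = sig1 t0 t1 (V X) (p X) \<and>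
      4 * (X*(X-1)) * deriv (deriv Y) X = sig2 ti t0 t1 (tX-1) (V X) (p X) X"
proof -
  define T where "T = tX - 1"
  obtain p where dV: "\<And>X. X \<in> U \<Longrightarrow> (V has_field_derivative ham_p t0 t1 T (V X) (p X) X / (X*(X-1))) (at X)"
    and dp: "\<And>X. X \<in> U \<Longrightarrow> (p has_field_derivative - ham_q ti t0 t1 T (V X) (p X) X / (2*(X*(X-1)))) (at X)"
    and H: "\<And>X. X \<in> U \<Longrightarrow> Y X = sig0 ti t0 t1 T (V X) (p X) X / 8"
    using pvi_canonical[OF \<open>open U\<close> sol] unfolding T_def Y_def by metis
  have nz: "X \<noteq> 0" "X - 1 \<noteq> 0" if "X \<in> U" for X
    using sol that by (auto simp: pvi_solution_def)
  have d0: "(Y has_field_derivative sig1 t0 t1 (V X) (p X) / 4) (at X)" if X: "X \<in> U" for X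
  proof -
    define q P where "q = V X" and "P = p X"
    define a b where "a = ham_p t0 t1 T q P X / (X*(X-1))" and "b = - ham_q ti t0 t1 T q P X / (2*(X*(X-1)))"
    have ab: "ham_p t0 t1 T q P X = X*(X-1)*a" "ham_q ti t0 t1 T q P X = - (2*(X*(X-1))*b)" using nz[OF X] by (simp_all add: a_def b_def)
    note d = dV[OF X, folded q_def P_def, folded a_def] dp[OF X, folded q_def P_def, folded b_def]
    have "((\<lambda>X. sig0 ti t0 t1 T (V X) (p X) X) has_field_derivative
       (2 * ham_q ti t0 t1 T q P X * a + 4 * ham_p t0 t1 T q P X * b + 2 * sig1 t0 t1 q P)) (at X)"
      unfolding sig0_def
      by (rule derivative_eq_intros d refl)+ (simp only: q_def[symmetric] P_def[symmetric] of_nat_numeral power_one_right two_minus_Suc0 sig1_def ham_p_def ham_q_def, algebra)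
    \<comment> \<open>The partial derivatives of \<open>sig0\<close> in \<open>q\<close> and
      \<open>p\<close> are \<open>2 ham_q\<close> and \<open>4 ham_p\<close>; along the flow their
      contributions cancel.\<close>
    also have "2 * ham_q ti t0 t1 T q P X * a + 4 * ham_p t0 t1 T q P X * b = 0" unfolding ab by simp
    finally have "((\<lambda>X. sig0 ti t0 t1 T (V X) (p X) X / 8) has_field_derivative (0 + 2 * sig1 t0 t1 q P) / 8) (at X)"
      by (rule DERIV_cdivide)
    then show ?thesis
      by (rule has_field_derivative_transform_within_open[OF _ \<open>open U\<close> X, THEN DERIV_cong]) (simp_all add: H q_def P_def)
  qed
  have Y: "Y holomorphic_on U" using d0 \<open>open U\<close> by (auto simp: holomorphic_on_open)
  have D0: "deriv Y X = sig1 t0 t1 (V X) (p X) / 4" if "X \<in> U" for X using d0[OF that] by (rule DERIV_imp_deriv)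
  have d1: "(deriv Y has_field_derivative sig2 ti t0 t1 T (V X) (p X) X / (4*(X*(X-1)))) (at X)" if X: "X \<in> U" for X
  proof -
    define q P where "q = V X" and "P = p X"
    define a b where "a = ham_p t0 t1 T q P X / (X*(X-1))" and "b = - ham_q ti t0 t1 T q P X / (2*(X*(X-1)))"
    have ab: "ham_p t0 t1 T q P X = X*(X-1)*a" "ham_q ti t0 t1 T q P X = - (2*(X*(X-1))*b)" using nz[OF X] by (simp_all add: a_def b_def)
    note d = dV[OF X, folded q_def P_def, folded a_def] dp[OF X, folded q_def P_def, folded b_def]
    have "((\<lambda>X. sig1 t0 t1 (V X) (p X)) has_field_derivative
       (- ((2*q-1)*P^2) + 2*(t0+t1)*P) * a + 2 * (- (q*(q-1)*P) + t0*(q-1) + t1*q) * b) (at X)"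
      unfolding sig1_def
      by (rule derivative_eq_intros d refl)+ (simp only: q_def[symmetric] P_def[symmetric] of_nat_numeral power_one_right two_minus_Suc0, algebra)
    also have "(- ((2*q-1)*P^2) + 2*(t0+t1)*P) * a + 2 * (- (q*(q-1)*P) + t0*(q-1) + t1*q) * b = sig2 ti t0 t1 T q P X / (X*(X-1))"
      unfolding sig2_def ab using nz[OF X] by (simp add: field_simps)
    finally have "((\<lambda>X. sig1 t0 t1 (V X) (p X) / 4) has_field_derivative sig2 ti t0 t1 T q P X / (X*(X-1)) / 4) (at X)"
      by (rule DERIV_cdivide)
    then show ?thesis
      by (rule has_field_derivative_transform_within_open[OF _ \<open>open U\<close> X, THEN DERIV_cong]) (simp_all add: D0 q_def P_def)
  qed
  have D1: "X*(X-1) * deriv (deriv Y) X = sig2 ti t0 t1 T (V X) (p X) X / 4" if "X \<in> U" for X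
    unfolding DERIV_imp_deriv[OF d1[OF that]] using nz[OF that] by simp
  have d2: "((\<lambda>X. X*(X-1) * deriv (deriv Y) X) has_field_derivative
      (- (64 * (X * deriv Y X - Y X)^2) - 128*(X-1) * deriv Y X * (X * deriv Y X - Y X) + 64*X*(deriv Y X)^2
         + 16*(ti^2+t0^2+t1^2+T^2) * deriv Y X - 4*(ti^2-T^2)*(t0^2-t1^2)*X + 4*(ti^2-t1^2)*(t0^2-T^2)
         + (ti^2+t0^2+t1^2+T^2)^2) / (32*(X*(X-1)))) (at X)" (is "(_ has_field_derivative ?R/_) _") if X: "X \<in> U" for X
  proof -
    define q P where "q = V X" and "P = p X"
    define a b where "a = ham_p t0 t1 T q P X / (X*(X-1))" and "b = - ham_q ti t0 t1 T q P X / (2*(X*(X-1)))"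
    define hp hq where "hp = ham_p t0 t1 T q P X" and "hq = ham_q ti t0 t1 T q P X"
    have ab: "hp = X*(X-1)*a" "hq = - (2*(X*(X-1))*b)" using nz[OF X] by (simp_all add: a_def b_def hp_def hq_def)
    note d = dV[OF X, folded q_def P_def, folded a_def] dp[OF X, folded q_def P_def, folded b_def]
    define Zq where "Zq = - (2*P^2) * hp + (- ((2*q-1)*P^2) + 2*(t0+t1)*P) *
         (((q-1)*(q-X) + q*(q-X) + q*(q-1))*P - (t0*(2*q-1-X) + t1*(2*q-X) + T*(2*q-1)))
       - (- ((2*q-1)*P) + t0 + t1) * hq
       - (- (q*(q-1)*P) + t0*(q-1) + t1*q) * ((6*q-2-2*X)*P^2 - 2*(2*t0 + 2*t1 + 2*T)*P)"
    define Zp where "Zp = (- (2*(2*q-1)*P) + 2*(t0+t1)) * hp + (- ((2*q-1)*P^2) + 2*(t0+t1)*P) * (q*(q-1)*(q-X))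
       + q*(q-1) * hq
       - (- (q*(q-1)*P) + t0*(q-1) + t1*q) * (2*((q-1)*(q-X) + q*(q-X) + q*(q-1))*P - 2*(t0*(2*q-1-X) + t1*(2*q-X) + T*(2*q-1)))"
    \<comment> \<open>No explicit \<open>X\<close>-derivative appears: in \<open>sig2\<close> the
      factor of \<open>ham_p\<close> is the \<open>X\<close>-derivative of \<open>ham_q\<close>, and
      the factor of \<open>ham_q\<close> is minus the \<open>X\<close>-derivative of
      \<open>ham_p\<close>, so the explicit contributions cancel. \<open>Zq\<close> and
      \<open>Zp\<close> are the partial derivatives in \<open>q\<close> and
      \<open>p\<close>.\<close>
    have "((\<lambda>X. sig2 ti t0 t1 T (V X) (p X) X) has_field_derivative Zq * a + Zp * b) (at X)"
      unfolding sig2_def ham_p_def ham_q_def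
      by (rule derivative_eq_intros d refl)+ (simp only: q_def[symmetric] P_def[symmetric] of_nat_numeral power_one_right two_minus_Suc0 Zq_def Zp_def hp_def hq_def ham_p_def ham_q_def, algebra)
    note sig2' = this
    have R: "16*(X*(X-1))*(Zq * a + Zp * b) = 2 * ?R"
    proof -
      have "16*(X*(X-1))*(Zq * a + Zp * b) = 8*(Zq*(2*hp) - Zp*hq)" unfolding ab by algebra
      also have "\<dots> = 2*(- ((2*X * sig1 t0 t1 q P - sig0 ti t0 t1 T q P X)^2) - 4*(X-1) * sig1 t0 t1 q P * (2*X * sig1 t0 t1 q P - sig0 ti t0 t1 T q P X)
     + 4*X*(sig1 t0 t1 q P)^2 + 4*(ti^2+t0^2+t1^2+T^2) * sig1 t0 t1 q P - 4*(ti^2-T^2)*(t0^2-t1^2)*X + 4*(ti^2-t1^2)*(t0^2-T^2)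
     + (ti^2+t0^2+t1^2+T^2)^2)"
        unfolding Zq_def Zp_def hp_def hq_def by (rule sig2_deriv_algebra)
      also have "sig1 t0 t1 q P = 4 * deriv Y X" by (simp add: D0 X q_def P_def)
      also have "sig0 ti t0 t1 T q P X = 8 * Y X" by (simp add: H X q_def P_def)
      finally show ?thesis by algebra
    qed
    have "r / (32*m) = (2 * r) / (64*m)" for r m :: complex by simp
    then have "?R / (32*(X*(X-1))) = (2 * ?R) / (64*(X*(X-1)))" .
    also have "\<dots> = (Zq * a + Zp * b) / 4"
    proof -
      have "16*m*A / (64*m) = A/4" if "m \<noteq> 0" for A m :: complex using that by simp
      then show ?thesis unfolding R[symmetric] using nz[OF X] by (metis mult_eq_0_iff)
    qed
    finally have "((\<lambda>X. sig2 ti t0 t1 T (V X) (p X) X / 4) has_field_derivative ?R / (32*(X*(X-1)))) (at X)"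
      by (rule DERIV_cong[OF DERIV_cdivide[OF sig2'] sym])
    then show ?thesis
      by (rule has_field_derivative_transform_within_open[OF _ \<open>open U\<close> X]) (simp_all add: D1)
  qed
  have Y2: "deriv (deriv Y) holomorphic_on U" by (intro holomorphic_deriv Y \<open>open U\<close>)
  have D2: "32 * X*(X-1)*((2*X-1) * deriv (deriv Y) X + X*(X-1) * deriv (deriv (deriv Y)) X) =
        (- (64 * (X * deriv Y X - Y X)^2) - 128*(X-1) * deriv Y X * (X * deriv Y X - Y X) + 64*X*(deriv Y X)^2
         + 16*(ti^2+t0^2+t1^2+T^2) * deriv Y X - 4*(ti^2-T^2)*(t0^2-t1^2)*X + 4*(ti^2-t1^2)*(t0^2-T^2)
         + (ti^2+t0^2+t1^2+T^2)^2)" (is "_ = ?R") if X: "X \<in> U" for X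
  proof -
    have "((\<lambda>X. X*(X-1) * deriv (deriv Y) X) has_field_derivative (2*X-1) * deriv (deriv Y) X + X*(X-1) * deriv (deriv (deriv Y)) X) (at X)"
      by (rule derivative_eq_intros refl holomorphic_derivI[OF Y2 \<open>open U\<close> X])+ (simp add: algebra_simps)
    from DERIV_unique[OF this d2[OF X]] show ?thesis using nz[OF X] by (simp add: mult.assoc)
  qed
  show "Y holomorphic_on U" by (rule Y)
  show "X \<in> U \<Longrightarrow> 32 * X*(X-1)*((2*X-1) * deriv (deriv Y) X + X*(X-1) * deriv (deriv (deriv Y)) X)
       = - (64 * (X * deriv Y X - Y X)^2) - 128*(X-1) * deriv Y X * (X * deriv Y X - Y X) + 64*X*(deriv Y X)^2
         + 16*(ti^2+t0^2+t1^2+(tX-1)^2) * deriv Y X - 4*(ti^2-(tX-1)^2)*(t0^2-t1^2)*X + 4*(ti^2-t1^2)*(t0^2-(tX-1)^2)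
         + (ti^2+t0^2+t1^2+(tX-1)^2)^2"
    unfolding T_def[symmetric] by (rule D2)
  have "8 * Y X = sig0 ti t0 t1 T (V X) (p X) X" "4 * deriv Y X = sig1 t0 t1 (V X) (p X)"
    "4 * (X*(X-1)) * deriv (deriv Y) X = sig2 ti t0 t1 T (V X) (p X) X" if "X \<in> U" for X
    unfolding mult.assoc[of 4] D1[OF that, unfolded mult.assoc] mult.assoc unfolding H[OF that] D0[OF that] by simp_all
  then show "\<exists>p. \<forall>X\<in>U. 8 * Y X = sig0 ti t0 t1 (tX-1) (V X) (p X) X \<and> 4 * deriv Y X = sig1 t0 t1 (V X) (p X) \<and>
      4 * (X*(X-1)) * deriv (deriv Y) X = sig2 ti t0 t1 (tX-1) (V X) (p X) X"
    unfolding T_def by blast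
qed

section \<open>The Hamiltonian function determines the Painleve VI solution\<close>

lemma open_nonzero_set:
  assumes "f holomorphic_on U" "open U"
  shows "open {x \<in> U. f x \<noteq> (0::complex)}"
proof -
  have "{x \<in> U. f x \<noteq> 0} = U \<inter> f -` (- {0})" by auto
  then show ?thesis
    using continuous_open_preimage[OF holomorphic_on_imp_continuous_on[OF assms(1)] assms(2), of "- {0}"] by auto
qed

text \<open>By \<open>sig_inversion\<close> both solutions satisfy the same linear equation, whose
  coefficient \<open>den\<close> is a quadratic polynomial in \<open>Y'\<close>. If they differ
  somewhere, \<open>den\<close> vanishes on an open set, hence on the connected \<open>U\<close>;
  then \<open>Y'\<close> is a root of a fixed quadratic, and \<open>Y''\<close> cannot be nonzero
  anywhere.\<close>

lemma pvi_determined_by_H_VI: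
  assumes U: "open U" "connected U"
    and sol1: "pvi_solution ti t0 t1 tX U V1" and sol2: "pvi_solution ti t0 t1 tX U V2"
    and eq: "\<And>X. X \<in> U \<Longrightarrow> H_VI ti t0 t1 tX V1 X = H_VI ti t0 t1 tX V2 X"
    and X1: "X1 \<in> U" "deriv (deriv (\<lambda>X. X*(X-1) * H_VI ti t0 t1 tX V1 X)) X1 \<noteq> 0"
    and X: "X \<in> U"
  shows "V1 X = V2 X"
proof (rule ccontr)
  assume ne: "V1 X \<noteq> V2 X"
  define T where "T = tX - 1"
  define Y where "Y = (\<lambda>X. X*(X-1) * H_VI ti t0 t1 tX V1 X)"
  define Z where "Z = (\<lambda>X. X*(X-1) * H_VI ti t0 t1 tX V2 X)"
  note S1 = pvi_sigma[OF U(1) sol1 Y_def, folded T_def] and S2 = pvi_sigma[OF U(1) sol2 Z_def, folded T_def]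
  note Y = S1(1) and Z = S2(1)
  obtain p where p: "\<And>X. X \<in> U \<Longrightarrow> 8 * Y X = sig0 ti t0 t1 T (V1 X) (p X) X"
    "\<And>X. X \<in> U \<Longrightarrow> 4 * deriv Y X = sig1 t0 t1 (V1 X) (p X)"
    "\<And>X. X \<in> U \<Longrightarrow> 4 * (X*(X-1)) * deriv (deriv Y) X = sig2 ti t0 t1 T (V1 X) (p X) X"
    using S1(3) by blast
  obtain r where r: "\<And>X. X \<in> U \<Longrightarrow> 8 * Z X = sig0 ti t0 t1 T (V2 X) (r X) X"
    "\<And>X. X \<in> U \<Longrightarrow> 4 * deriv Z X = sig1 t0 t1 (V2 X) (r X)"
    "\<And>X. X \<in> U \<Longrightarrow> 4 * (X*(X-1)) * deriv (deriv Z) X = sig2 ti t0 t1 T (V2 X) (r X) X"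
    using S2(3) by blast
  have YZ: "Z X = Y X" if "X \<in> U" for X using eq[OF that] by (simp add: Y_def Z_def)
  have YZ1: "deriv Z X = deriv Y X" if "X \<in> U" for X
    using YZ U(1) that by (intro deriv_cong_ev) (auto simp: eventually_nhds)
  have YZ2: "deriv (deriv Z) X = deriv (deriv Y) X" if "X \<in> U" for X
    using YZ1 U(1) that by (intro deriv_cong_ev) (auto simp: eventually_nhds)
  define den where "den X = 2*(4 * deriv Y X)^2+4*(T^2+ti^2)*(4 * deriv Y X)+2*(T^2-ti^2)^2" for X
  have *: "(V1 X - V2 X) * den X = 0" if X: "X \<in> U" for X
  proof -
    have "den X * V1 X = den X * V2 X"
      using sig_inversion[of t0 t1 "V1 X" "p X" T ti X] sig_inversion[of t0 t1 "V2 X" "r X" T ti X]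
      unfolding den_def p[OF X, symmetric] r[OF X, symmetric] YZ[OF X] YZ1[OF X] YZ2[OF X] by simp
    then show ?thesis by (simp add: algebra_simps)
  qed
  have V: "V1 holomorphic_on U" "V2 holomorphic_on U" using sol1 sol2 by (auto simp: pvi_solution_def)
  have Y1: "deriv Y holomorphic_on U" using Y U(1) by (rule holomorphic_deriv)
  have dh: "den holomorphic_on U" unfolding den_def by (intro holomorphic_intros Y U(1))
  define W where "W = {x \<in> U. V1 x - V2 x \<noteq> 0}"
  have "open W" unfolding W_def using V U(1) by (intro open_nonzero_set holomorphic_intros)
  moreover have "X \<in> W" using ne X by (simp add: W_def)
  moreover have "W \<subseteq> U" by (auto simp: W_def)
  ultimately have den0: "den x = 0" if "x \<in> U" for x
    using * by (intro analytic_continuation_open[of W U den "\<lambda>_. 0", OF _ U(1) _ U(2) _ dh _ _ that]) (auto simp: W_def)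
  have Y2: "(deriv Y has_field_derivative deriv (deriv Y) x) (at x)" if "x \<in> U" for x
    by (rule holomorphic_derivI[OF Y1 U(1) that])
  \<comment> \<open>Differentiating the quadratic relation leaves a product; where
    \<open>Y''\<close> is nonzero the other factor makes \<open>Y'\<close> locally constant, a
    contradiction.\<close>
  have den1: "(64 * deriv Y x + 16*(T^2+ti^2)) * deriv (deriv Y) x = 0" if x: "x \<in> U" for x
  proof -
    have "(den has_field_derivative (64 * deriv Y x + 16*(T^2+ti^2)) * deriv (deriv Y) x) (at x)"
      unfolding den_def by (rule derivative_eq_intros Y2 x refl)+ (simp add: algebra_simps)
    moreover have "(den has_field_derivative 0) (at x)"
      by (rule has_field_derivative_transform_within_open[OF DERIV_const U(1) x]) (simp add: den0)
    ultimately show ?thesis by (rule DERIV_unique)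
  qed
  define W' where "W' = {x \<in> U. deriv (deriv Y) x \<noteq> 0}"
  have W': "open W'" unfolding W'_def by (intro open_nonzero_set holomorphic_deriv Y U(1))
  have X1W: "X1 \<in> W'" using X1 by (simp add: W'_def Y_def)
  have "deriv Y x = - (T^2+ti^2)/4" if "x \<in> W'" for x
  proof -
    have "64 * deriv Y x + 16*(T^2+ti^2) = 0"
      using den1[of x] that unfolding W'_def mult_eq_0_iff by blast
    then have "4 * deriv Y x = - (T^2+ti^2)" by algebra
    then show ?thesis by (simp add: field_simps)
  qed
  then have "(deriv Y has_field_derivative 0) (at X1)"
    by (intro has_field_derivative_transform_within_open[OF DERIV_const[of "- (T^2+ti^2)/4"] W' X1W]) simp
  then have "deriv (deriv Y) X1 = 0" by (rule DERIV_imp_deriv)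
  then show False using X1 by (simp add: Y_def)
qed

text \<open>With \<open>A2 = A4 = 0\<close> SD-Ia loses two terms, and \<open>A3 + A0^2/4\<close>
  collapses to \<open>(cq c)^2/16\<close>. So \<open>K\<close> survives only in the combination
  \<open>K + 2 cq c\<close>, and the sign of \<open>cq c\<close> only there. The two equations are
  SD-Ia and its derived equation, each times 16.\<close>

lemma pvi_sigma_bonnet:
  assumes U: "open U" and sol: "pvi_solution ti t0 t1 tX U V" and bp: "bonnet_params c cq K ti t0 t1 tX"
    and Y_def: "Y = (\<lambda>X. X*(X-1) * H_VI ti t0 t1 tX V X)"
  shows "Y holomorphic_on U"
    and "X \<in> U \<Longrightarrow> 16 * (X*(X-1) * deriv (deriv Y) X)^2 = - (64 * deriv Y X * (X * deriv Y X - Y X)^2)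
           + 64*(deriv Y X)^2 * (X * deriv Y X - Y X) + 4*(K + 2*cq*c)*(deriv Y X)^2 + (cq*c)^2 * deriv Y X"
    and "X \<in> U \<Longrightarrow> 32 * X*(X-1)*((2*X-1) * deriv (deriv Y) X + X*(X-1) * deriv (deriv (deriv Y)) X)
       = - (64 * (X * deriv Y X - Y X)^2) - 128*(X-1) * deriv Y X * (X * deriv Y X - Y X) + 64*X*(deriv Y X)^2
         + 8*(K+2*cq*c) * deriv Y X + (cq*c)^2"
proof -
  define T where "T = tX - 1"
  have a0: "ti^2+t0^2+t1^2+T^2 = (K+2*cq*c)/2" and a2: "(ti^2-T^2)*(t0^2-t1^2) = 0"
    and a3: "(ti^2-t1^2)*(t0^2-T^2) = - K*(K+4*cq*c)/16"
    and a4: "(ti^2 + T^2) * (t0^2 - t1^2)^2 + (ti^2 - T^2)^2 * (t0^2 + t1^2) = 0"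
  proof -
    have [dest]: "x / 2 = y / 4 \<Longrightarrow> x = y / 2" "x / 4 = y / 64 \<Longrightarrow> x = y / 16" for x y :: complex
      by (simp_all add: field_simps)
    show "ti^2+t0^2+t1^2+T^2 = (K+2*cq*c)/2" "(ti^2-t1^2)*(t0^2-T^2) = - K*(K+4*cq*c)/16"
      using bp unfolding bonnet_params_def A0_def A3_def T_def by blast+
    show "(ti^2-T^2)*(t0^2-t1^2) = 0" "(ti^2 + T^2) * (t0^2 - t1^2)^2 + (ti^2 - T^2)^2 * (t0^2 + t1^2) = 0"
      using bp unfolding bonnet_params_def A2_def A4_def T_def by auto
  qed
  note S = pvi_sigma[OF U sol Y_def, folded T_def]
  show "Y holomorphic_on U" by (rule S)
  show "32 * X*(X-1)*((2*X-1) * deriv (deriv Y) X + X*(X-1) * deriv (deriv (deriv Y)) X)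
       = - (64 * (X * deriv Y X - Y X)^2) - 128*(X-1) * deriv Y X * (X * deriv Y X - Y X) + 64*X*(deriv Y X)^2
         + 8*(K+2*cq*c) * deriv Y X + (cq*c)^2" if X: "X \<in> U"
  proof -
    have "32 * X*(X-1)*((2*X-1) * deriv (deriv Y) X + X*(X-1) * deriv (deriv (deriv Y)) X)
       = - (64 * (X * deriv Y X - Y X)^2) - 128*(X-1) * deriv Y X * (X * deriv Y X - Y X) + 64*X*(deriv Y X)^2
         + 16*(ti^2+t0^2+t1^2+T^2) * deriv Y X - 4*((ti^2-T^2)*(t0^2-t1^2))*X + 4*((ti^2-t1^2)*(t0^2-T^2))
         + (ti^2+t0^2+t1^2+T^2)^2"
      using S(2)[OF X] by (simp only: mult.assoc)
    also have "\<dots> = - (64 * (X * deriv Y X - Y X)^2) - 128*(X-1) * deriv Y X * (X * deriv Y X - Y X) + 64*X*(deriv Y X)^2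
         + 8*(K+2*cq*c) * deriv Y X + (cq*c)^2"
      unfolding a0 a2 a3 by (simp add: field_simps power2_eq_square)
    finally show ?thesis .
  qed
  show "16 * (X*(X-1) * deriv (deriv Y) X)^2 = - (64 * deriv Y X * (X * deriv Y X - Y X)^2)
           + 64*(deriv Y X)^2 * (X * deriv Y X - Y X) + 4*(K + 2*cq*c)*(deriv Y X)^2 + (cq*c)^2 * deriv Y X" (is "?L = ?R") if X: "X \<in> U"
  proof -
    \<comment> \<open>\<open>A2 = A4 = 0\<close> leaves only three types of parameters; each gives a small polynomial identity.\<close>
    consider (i) "ti^2 = T^2" "t0^2 = t1^2" | (ii) "ti = 0" "T = 0" | (iii) "t0 = 0" "t1 = 0"
    proof (cases "ti^2 = T^2")
      case True
      then have "2*T^2 * (t0^2 - t1^2)^2 = 0" using a4 by simp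
      then show ?thesis using True that by auto
    next
      case False
      then have t: "t0^2 = t1^2" using a2 by simp
      then have "t1^2 = 0" using a4 False by simp
      then show ?thesis using t that by auto
    qed
    then show ?thesis
    proof cases
      case i
      \<comment> \<open>Passing to \<open>ti = T\<close> and \<open>t1 = - t0\<close> changes
        neither the equation nor \<open>Y\<close>, since only \<open>ti^2\<close> and
        \<open>t1^2\<close> occur; the momentum \<open>p\<close> does change and is obtained
        anew.\<close>
      have sol': "pvi_solution T t0 (-t0) tX U V" using sol i by (simp add: pvi_solution_def pvi_rhs_def)
      have Y: "Y = (\<lambda>X. X*(X-1) * H_VI T t0 (-t0) tX V X)" using i by (simp add: Y_def H_VI_def)
      obtain p where p: "8 * Y X = sig0 T t0 (-t0) T (V X) (p X) X"  "4 * deriv Y X = sig1 t0 (-t0) (V X) (p X)"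
        "4 * (X*(X-1)) * deriv (deriv Y) X = sig2 T t0 (-t0) T (V X) (p X) X"
        using pvi_sigma(3)[OF U sol' Y, folded T_def] X by blast
      have k: "4*(t0^2 + T^2) = K+2*cq*c" using a0 i by (simp add: field_simps)
      have "4 * (16*t0^2*T^2) = (4*(t0^2+T^2))^2 + 16*((ti^2-t1^2)*(t0^2-T^2))" using i by algebra
      also have "\<dots> = 4 * (cq*c)^2" unfolding a3 k by (simp add: field_simps power2_eq_square)
      finally have m: "16*t0^2*T^2 = (cq*c)^2" by algebra
      have "4*?L = 4*?R" using sd_Ia_equal_pairs[of T t0 "V X" "p X" X] unfolding p[symmetric] k m by algebra
      then show ?thesis by (rule mult_left_cancel[of 4, THEN iffD1, rotated]) simp
    next
      case ii
      obtain p where p: "8 * Y X = sig0 0 t0 t1 0 (V X) (p X) X"  "4 * deriv Y X = sig1 t0 t1 (V X) (p X)"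
        "4 * (X*(X-1)) * deriv (deriv Y) X = sig2 0 t0 t1 0 (V X) (p X) X"
        using S(3) X unfolding ii by blast
      have k: "2*(t0^2 + t1^2) = K+2*cq*c" using a0 ii by (simp add: field_simps)
      have "4 * ((t0^2-t1^2)^2) = (2*(t0^2+t1^2))^2 + 16*((ti^2-t1^2)*(t0^2-T^2))" using ii by algebra
      also have "\<dots> = 4 * (cq*c)^2" unfolding a3 k by (simp add: field_simps power2_eq_square)
      finally have m: "(t0^2-t1^2)^2 = (cq*c)^2" by algebra
      have "4*?L = 4*?R" using sd_Ia_ti_T_zero[of t0 t1 "V X" "p X" X] unfolding p[symmetric] k m by algebra
      then show ?thesis by (rule mult_left_cancel[of 4, THEN iffD1, rotated]) simp
    next
      case iii
      obtain p where p: "8 * Y X = sig0 ti 0 0 T (V X) (p X) X"  "4 * deriv Y X = sig1 0 0 (V X) (p X)"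
        "4 * (X*(X-1)) * deriv (deriv Y) X = sig2 ti 0 0 T (V X) (p X) X"
        using S(3) X unfolding iii by blast
      have k: "2*(ti^2 + T^2) = K+2*cq*c" using a0 iii by (simp add: field_simps)
      have "4 * ((ti^2-T^2)^2) = (2*(ti^2+T^2))^2 + 16*((ti^2-t1^2)*(t0^2-T^2))" using iii by algebra
      also have "\<dots> = 4 * (cq*c)^2" unfolding a3 k by (simp add: field_simps power2_eq_square)
      finally have m: "(ti^2-T^2)^2 = (cq*c)^2" by algebra
      have "4*?L = 4*?R" using sd_Ia_t0_t1_zero[of ti T "V X" "p X" X] unfolding p[symmetric] k m by algebra
      then show ?thesis by (rule mult_left_cancel[of 4, THEN iffD1, rotated]) simp
    qed
  qed
qed

section \<open>The reduced system in the variable X\<close>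

text \<open>The point of this coordinate is that \<open>eta d/d eta\<close> becomes
  \<open>2 X(X-1) d/dX\<close>, while \<open>q / cq\<close> becomes the polynomial
  \<open>1 - X\<close>.\<close>

lemma X_of_facts:
  assumes "\<eta> \<noteq> 0" "\<eta> \<noteq> 1" "\<eta> \<noteq> - 1"
  shows "1 - \<eta>^2 \<noteq> 0" "X_of \<eta> \<noteq> 0" "X_of \<eta> \<noteq> 1" "\<eta>^2 * X_of \<eta> = X_of \<eta> - 1"
    "(X_of has_field_derivative 2*\<eta>/(1-\<eta>^2)^2) (at \<eta>)"
    "\<eta> * (2*\<eta>/(1-\<eta>^2)^2) = 2 * X_of \<eta> * (X_of \<eta> - 1)"
    "\<eta>^2/(\<eta>^2-1) = - (X_of \<eta> - 1)"
proof -
  show 1: "1 - \<eta>^2 \<noteq> 0" using assms by (simp add: power2_eq_1_iff eq_commute[of 1])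
  then have one': "\<eta>^2 - 1 \<noteq> 0" by auto
  show "X_of \<eta> \<noteq> 0" using 1 by (simp add: X_of_def)
  show 2: "\<eta>^2 * X_of \<eta> = X_of \<eta> - 1" using 1 by (simp add: X_of_def field_simps)
  show "X_of \<eta> \<noteq> 1" using 2 assms \<open>X_of \<eta> \<noteq> 0\<close> by auto
  show "(X_of has_field_derivative 2*\<eta>/(1-\<eta>^2)^2) (at \<eta>)"
    unfolding X_of_def[abs_def] by (rule derivative_eq_intros refl 1)+ (use 1 in \<open>simp add: power2_eq_square\<close>)
  have "\<eta> * (2*\<eta>/(1-\<eta>^2)^2) = 2 * X_of \<eta> * (\<eta>^2 * X_of \<eta>)"
    using 1 by (simp add: X_of_def power2_eq_square)
  then show "\<eta> * (2*\<eta>/(1-\<eta>^2)^2) = 2 * X_of \<eta> * (X_of \<eta> - 1)" unfolding 2 .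
  have "\<eta>^2/(\<eta>^2-1) = - (\<eta>^2 * X_of \<eta>)"
    using 1 one' by (simp add: X_of_def divide_simps) (simp add: algebra_simps) 
  then show "\<eta>^2/(\<eta>^2-1) = - (X_of \<eta> - 1)" unfolding 2 .
qed

text \<open>Dictionary between the reduced system and \<open>Y\<close>: here
  \<open>v = - cq^2 eta / (4 Y')\<close>, \<open>q = - cq (X-1)\<close> and
  \<open>q / eta^2 = - cq X\<close>. Multiplying by powers of \<open>Y'\<close>, which is nonzero
  because \<open>h'\<close> is, turns the first integral and the Gauss equation into polynomial
  relations. No differential equation is assumed, so the lemma serves both directions.\<close>

lemma reduction_in_X:
  assumes N: "open N" "0 \<notin> N" "1 \<notin> N" "-1 \<notin> N" and cq: "cq \<noteq> 0"
    and M: "open M" "X_of ` N \<subseteq> M" and Y: "Y holomorphic_on M"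
    and hY: "\<forall>s\<in>N. h s = - 8 / cq * Y (X_of s)"
    and vq: "vq_form cq N v h q" and \<eta>: "\<eta> \<in> N"
  defines "X \<equiv> X_of \<eta>"
  defines "Y0 \<equiv> Y X" and "Y1 \<equiv> deriv Y X" and "Y2 \<equiv> deriv (deriv Y) X" and "Y3 \<equiv> deriv (deriv (deriv Y)) X"
  shows "deriv h \<eta> = - 8 / cq * (Y1 * (2*\<eta>/(1-\<eta>^2)^2))"
    and "Y1 \<noteq> 0"
    and "4 * Y1^2 * (first_integral c v h q \<eta> + 2*cq*c) = 16*(X*(X-1)*Y2)^2 + 64*Y1*(X*Y1-Y0)^2
           - 64*Y1^2*(X*Y1-Y0) - (cq*c)^2*Y1"
    and "reduced_gauss c v h q \<eta> \<longleftrightarrow>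
      32 * X*(X-1)*((2*X-1)*Y2 + X*(X-1)*Y3)*Y1 = 32*(X*(X-1)*Y2)^2 + (64*Y0^2-(cq*c)^2)*Y1 - 64*X*(X-1)*Y1^3"
proof -
  have n: "s \<noteq> 0" "s \<noteq> 1" "s \<noteq> -1" if "s \<in> N" for s using N that by auto
  note F = X_of_facts[OF n]
  have h: "h s = - 8 / cq * Y (X_of s)" if "s \<in> N" for s using hY that by blast
  have XM: "X_of s \<in> M" if "s \<in> N" for s using M that by auto
  note hol = Y holomorphic_deriv[OF Y M(1)] holomorphic_deriv[OF holomorphic_deriv[OF Y M(1)] M(1)]
  note der = hol[THEN holomorphic_derivI[OF _ M(1) XM]]
  have comp: "((\<lambda>s. f (X_of s)) has_field_derivative deriv f (X_of s) * (2* s/(1-s^2)^2)) (at s)"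
    if "f holomorphic_on M" "s \<in> N" for f s
    using DERIV_chain[OF holomorphic_derivI[OF that(1) M(1) XM[OF that(2)]] F(5)[OF that(2,2,2)]] by (simp add: o_def)
  have dh: "deriv h s = - 8 / cq * (deriv Y (X_of s) * (2* s/(1-s^2)^2))" if s: "s \<in> N" for s
  proof -
    have "((\<lambda>s. - 8 / cq * Y (X_of s)) has_field_derivative - 8 / cq * (deriv Y (X_of s) * (2* s/(1-s^2)^2))) (at s)"
      by (rule DERIV_cmult[OF comp[OF Y s]])
    then have "(h has_field_derivative - 8 / cq * (deriv Y (X_of s) * (2* s/(1-s^2)^2))) (at s)"
      by (rule has_field_derivative_transform_within_open[OF _ N(1) s]) (simp add: h)
    then show ?thesis by (rule DERIV_imp_deriv)
  qed
  show "deriv h \<eta> = - 8 / cq * (Y1 * (2*\<eta>/(1-\<eta>^2)^2))" using dh[OF \<eta>] by (simp add: Y1_def X_def)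
  have Y1n: "deriv Y (X_of s) \<noteq> 0" if "s \<in> N" for s
    using vq that dh[OF that] by (auto simp: vq_form_def)
  then show Y1n': "Y1 \<noteq> 0" using \<eta> by (simp add: Y1_def X_def)
  have v: "v s = - (cq^2) * s / (4 * deriv Y (X_of s))" if s: "s \<in> N" for s
  proof -
    have "v s = 4 * cq * s^2 / ((1 - s^2)^2 * deriv h s)" using vq s by (simp add: vq_form_def)
    also have "\<dots> = - (cq^2) * s / (4 * deriv Y (X_of s))"
    proof -
      have "4 * cq * s^2 / (e * (- 8 / cq * (y * (2 * s / e)))) = - (cq^2) * s / (4 * y)" if "e \<noteq> 0" "y \<noteq> 0" for e y
        using that cq n[OF s] by (simp add: field_simps power2_eq_square)
      from this[of "(1-s^2)^2" "deriv Y (X_of s)"] show ?thesis unfolding dh[OF s] using F(1)[OF s s s] Y1n[OF s] by fastforce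
    qed
    finally show ?thesis .
  qed
  have q: "q s = - cq * (X_of s - 1)" "q s / s^2 = - cq * X_of s" if s: "s \<in> N" for s
  proof -
    have "q s = cq * (s^2 / (s^2-1))" using vq s by (simp add: vq_form_def)
    then show q: "q s = - cq * (X_of s - 1)" unfolding F(7)[OF s s s] by (simp add: algebra_simps)
    show "q s / s^2 = - cq * X_of s" unfolding q F(4)[OF s s s, symmetric] using n[OF s] by simp
  qed
  have ld: "s * deriv v s / v s = 1 - 2 * X_of s * (X_of s - 1) * deriv (deriv Y) (X_of s) / deriv Y (X_of s)" if s: "s \<in> N" for s
  proof -
    define d where "d = deriv (deriv Y) (X_of s) * (2* s/(1-s^2)^2)"
    define y where "y = deriv Y (X_of s)"
    have y: "y \<noteq> 0" using Y1n[OF s] by (simp add: y_def)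
    have "((\<lambda>s. - (cq^2) * s / (4 * deriv Y (X_of s))) has_field_derivative - (cq^2) * (y - s * d) / (4*y^2)) (at s)"
      by (rule derivative_eq_intros comp[OF hol(2) s, folded d_def] refl)+ (use y in \<open>simp_all add: y_def[symmetric] field_simps power2_eq_square\<close>)
    then have "(v has_field_derivative - (cq^2) * (y - s * d) / (4*y^2)) (at s)"
      by (rule has_field_derivative_transform_within_open[OF _ N(1) s]) (simp add: v)
    then have "s * deriv v s / v s = s * (- (cq^2) * (y - s * d) / (4*y^2)) / (- (cq^2) * s / (4 * y))"
      by (simp add: DERIV_imp_deriv v[OF s] y_def)
    also have "\<dots> = 1 - s * d / y" using y cq n[OF s] by (simp add: field_simps power2_eq_square)
    also have "s * d = 2 * X_of s * (X_of s - 1) * deriv (deriv Y) (X_of s)"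
      unfolding F(6)[OF s s s, symmetric] d_def by (simp add: mult_ac)
    finally show ?thesis by (simp add: y_def)
  qed
  have n\<eta>: "\<eta> \<noteq> 0" by (rule n[OF \<eta>])
  have X\<eta>: "\<eta>^2 * X = X - 1" "X \<noteq> 0" "X - 1 \<noteq> 0" using F(2,3,4)[OF \<eta> \<eta> \<eta>] by (simp_all add: X_def)
  have h\<eta>: "h \<eta> = - 8 / cq * Y0" and v\<eta>: "v \<eta> = - (cq^2) * \<eta> / (4 * Y1)" and q\<eta>: "q \<eta> = - cq * (\<eta>^2 * X)"
    using h[OF \<eta>] v[OF \<eta>] q(1)[OF \<eta>] unfolding X\<eta> by (simp_all add: X_def Y0_def Y1_def)
  have hv: "((h \<eta>)^2 - c^2) * v \<eta> / \<eta> = - (64 * Y0^2 - (cq*c)^2) / (4*Y1)"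
    unfolding h\<eta> v\<eta> using n\<eta> cq Y1n' by (simp add: field_simps power2_eq_square)
  have qv: "(q \<eta>)^2 / (\<eta> * v \<eta>) = - 4 * X * (X-1) * Y1"
  proof -
    have "(q \<eta>)^2 / (\<eta> * v \<eta>) = (\<eta>^2 * X)^2 * (- 4 * Y1) / \<eta>^2"
      unfolding q\<eta> v\<eta> using n\<eta> cq Y1n' by (simp add: field_simps power2_eq_square)
    also have "\<dots> = - 4 * X * (\<eta>^2 * X) * Y1" using n\<eta> by (simp add: field_simps power2_eq_square)
    finally show ?thesis unfolding X\<eta> .
  qed
  \<comment> \<open>The logarithmic derivative of \<open>v\<close> in the new variable:
    \<open>eta v'/v - 1 = - 2 L\<close>.\<close>
  define L where "L = X*(X-1)*Y2/Y1"
  have LY: "Y1 * L = X*(X-1)*Y2" using Y1n' by (simp add: L_def)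
  show "4 * Y1^2 * (first_integral c v h q \<eta> + 2*cq*c) = 16*(X*(X-1)*Y2)^2 + 64*Y1*(X*Y1-Y0)^2
           - 64*Y1^2*(X*Y1-Y0) - (cq*c)^2*Y1"
  proof -
    have "first_integral c v h q \<eta> = (2*L)^2 + (64 * Y0^2 - (cq*c)^2) / (4*Y1) + 2*cq*(h \<eta> + c)*(X-1) + 2*cq*(h \<eta> - c)*X + 16*X*(X-1)*Y1"
    proof -
      have 1: "\<eta> * deriv v \<eta> / v \<eta> - 1 = - (2*L)" unfolding ld[OF \<eta>] by (simp add: L_def X_def Y1_def Y2_def)
      have "first_integral c v h q \<eta> = (\<eta> * deriv v \<eta> / v \<eta> - 1)^2 - ((h \<eta>)^2 - c^2) * v \<eta> / \<eta> - 2 * (h \<eta> + c) * q \<eta>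
         - 2 * (h \<eta> - c) * (q \<eta> / \<eta>^2) - 4 * ((q \<eta>)^2 / (\<eta> * v \<eta>))"
        by (simp add: first_integral_def)
      then show ?thesis unfolding 1 hv qv q(2)[OF \<eta>] unfolding q(1)[OF \<eta>] X_def[symmetric]
        by (simp add: algebra_simps diff_divide_distrib)
    qed
    also have "cq * h \<eta> = - 8 * Y0" using h[OF \<eta>] cq by (simp add: Y0_def X_def)
    \<comment> \<open>In the two terms of the first integral that are linear in \<open>q\<close>,
      the constant \<open>c\<close> does not cancel but leaves \<open>- 2 cq c\<close>; this is the
      origin of the shift in \<open>K + 2 cq c\<close>.\<close>
    then have "2*cq*(h \<eta> + c)*(X-1) + 2*cq*(h \<eta> - c)*X = - 16*Y0*(2*X-1) - 2*cq*c" by algebra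
    then have "(2*L)^2 + (64 * Y0^2 - (cq*c)^2) / (4*Y1) + 2*cq*(h \<eta> + c)*(X-1) + 2*cq*(h \<eta> - c)*X + 16*X*(X-1)*Y1
      = (2*L)^2 + (64 * Y0^2 - (cq*c)^2) / (4*Y1) - 16*Y0*(2*X-1) - 2*cq*c + 16*X*(X-1)*Y1" by (simp add: algebra_simps)
    finally have FI: "first_integral c v h q \<eta> + 2*cq*c = (2*L)^2 + (64 * Y0^2 - (cq*c)^2) / (4*Y1) - 16*Y0*(2*X-1) + 16*X*(X-1)*Y1"
      by simp
    have "4 * Y1^2 * ((64 * Y0^2 - (cq*c)^2) / (4*Y1)) = (64 * Y0^2 - (cq*c)^2) * Y1"
      using Y1n' by (simp add: power2_eq_square)
    then have "4 * Y1^2 * (first_integral c v h q \<eta> + 2*cq*c) = 16*(Y1*L)^2 + (64 * Y0^2 - (cq*c)^2) * Y1 + 4*Y1^2*(- 16*Y0*(2*X-1) + 16*X*(X-1)*Y1)"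
      unfolding FI by algebra
    also have "\<dots> = 16*(X*(X-1)*Y2)^2 + 64*Y1*(X*Y1-Y0)^2 - 64*Y1^2*(X*Y1-Y0) - (cq*c)^2*Y1"
      unfolding LY by algebra
    finally show ?thesis .
  qed
  \<comment> \<open>\<open>LD\<close> is the \<open>X\<close>-derivative of \<open>L\<close>, needed
    for the second-order term of the Gauss equation.\<close>
  define LD where "LD = (((2*X-1)*Y2 + X*(X-1)*Y3)*Y1 - X*(X-1)*Y2^2)/Y1^2"
  have "((\<lambda>s. s * deriv v s / v s) has_field_derivative - 2 * LD * (2*\<eta>/(1-\<eta>^2)^2)) (at \<eta>)"
  proof -
    define d where "d = 2*\<eta>/(1-\<eta>^2)^2"
    note c1 = F(5)[OF \<eta> \<eta> \<eta>, folded d_def] comp[OF hol(2) \<eta>, folded d_def] comp[OF hol(3) \<eta>, folded d_def]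
    have "((\<lambda>s. 1 - 2 * X_of s * (X_of s - 1) * deriv (deriv Y) (X_of s) / deriv Y (X_of s)) has_field_derivative - 2 * LD * d) (at \<eta>)"
    proof -
      have "((\<lambda>s. 1 - 2 * f s * (f s - 1) * g s / k s) has_field_derivative
          - 2 * ((((2 * f x - 1) * df * g x + f x * (f x - 1) * dg) * k x - f x * (f x - 1) * g x * dk) / (k x)^2)) (at x)"
        if f: "(f has_field_derivative df) (at x)" "(g has_field_derivative dg) (at x)" "(k has_field_derivative dk) (at x)" and k: "k x \<noteq> 0"
        for f g k :: "complex \<Rightarrow> complex" and df dg dk x
        by (rule derivative_eq_intros f k refl)+ (use k in \<open>simp add: divide_simps power2_eq_square\<close>, use k in \<open>simp add: algebra_simps\<close>)
      from this[OF c1(1) c1(3) c1(2)] Y1n'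
      have "((\<lambda>s. 1 - 2 * X_of s * (X_of s - 1) * deriv (deriv Y) (X_of s) / deriv Y (X_of s)) has_field_derivative
        - 2 * ((((2 * X - 1) * d * Y2 + X * (X - 1) * (Y3 * d)) * Y1 - X * (X - 1) * Y2 * (Y2 * d)) / Y1^2)) (at \<eta>)"
        by (simp add: X_def Y1_def Y2_def Y3_def)
      also have "- 2 * ((((2 * X - 1) * d * Y2 + X * (X - 1) * (Y3 * d)) * Y1 - X * (X - 1) * Y2 * (Y2 * d)) / Y1^2) = - 2 * LD * d"
        by (simp add: LD_def power2_eq_square algebra_simps)
      finally show ?thesis .
    qed
    then show ?thesis unfolding d_def[symmetric]
      by (rule has_field_derivative_transform_within_open[OF _ N(1) \<eta>]) (simp add: ld)
  qed
  note dlog = this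
  have dld: "\<eta> * deriv (\<lambda>s. s * deriv v s / v s) \<eta> = - 4 * X * (X-1) * LD"
  proof -
    have "\<eta> * deriv (\<lambda>s. s * deriv v s / v s) \<eta> = - 2 * LD * (\<eta> * (2*\<eta>/(1-\<eta>^2)^2))"
      by (simp add: DERIV_imp_deriv[OF dlog])
    then show ?thesis unfolding F(6)[OF \<eta> \<eta> \<eta>] X_def[symmetric] by simp
  qed
  have "8 * Y1^2 * (\<eta> * (deriv (\<lambda>s. s * deriv v s / v s) \<eta> - ((h \<eta>)^2 - c^2) / (2 * \<eta>^2) * v \<eta>
       + 2 * (q \<eta>)^2 / (\<eta>^2 * v \<eta>)))
    = 8 * Y1^2 * (\<eta> * deriv (\<lambda>s. s * deriv v s / v s) \<eta> - (((h \<eta>)^2 - c^2) * v \<eta> / \<eta>)/2 + 2 * ((q \<eta>)^2 / (\<eta> * v \<eta>)))"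
    using n\<eta> by (simp add: field_simps power2_eq_square)
  also have "\<dots> = - (32*X*(X-1)) * (Y1^2 * LD) + Y1 * (64 * Y0^2 - (cq*c)^2) - 64 * X * (X-1) * Y1^3"
    unfolding dld hv qv using Y1n' by (simp add: field_simps power2_eq_square power3_eq_cube)
  also have "Y1^2 * LD = ((2*X-1)*Y2 + X*(X-1)*Y3)*Y1 - X*(X-1)*Y2^2" using Y1n' by (simp add: LD_def)
  finally have G: "8 * Y1^2 * \<eta> * (deriv (\<lambda>s. s * deriv v s / v s) \<eta> - ((h \<eta>)^2 - c^2) / (2 * \<eta>^2) * v \<eta>
       + 2 * (q \<eta>)^2 / (\<eta>^2 * v \<eta>)) = - (32*X*(X-1)) * (((2*X-1)*Y2 + X*(X-1)*Y3)*Y1 - X*(X-1)*Y2^2) + Y1 * (64 * Y0^2 - (cq*c)^2) - 64 * X * (X-1) * Y1^3"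
    by (simp add: mult.assoc)
  have "reduced_gauss c v h q \<eta> \<longleftrightarrow> 8 * Y1^2 * \<eta> * (deriv (\<lambda>s. s * deriv v s / v s) \<eta> - ((h \<eta>)^2 - c^2) / (2 * \<eta>^2) * v \<eta>
       + 2 * (q \<eta>)^2 / (\<eta>^2 * v \<eta>)) = 0"
    unfolding reduced_gauss_def using n\<eta> Y1n' by simp
  also have "\<dots> \<longleftrightarrow> 32 * X*(X-1)*((2*X-1)*Y2 + X*(X-1)*Y3)*Y1 = 32*(X*(X-1)*Y2)^2 + (64*Y0^2-(cq*c)^2)*Y1 - 64*X*(X-1)*Y1^3"
    unfolding G by (subst right_minus_eq[symmetric], subst neg_equal_0_iff_equal[symmetric]) (simp add: algebra_simps power2_eq_square)
  finally show "reduced_gauss c v h q \<eta> \<longleftrightarrow> 32 * X*(X-1)*((2*X-1)*Y2 + X*(X-1)*Y3)*Y1 = 32*(X*(X-1)*Y2)^2 + (64*Y0^2-(cq*c)^2)*Y1 - 64*X*(X-1)*Y1^3" .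
qed

section \<open>The reduced system and its first integral\<close>

lemma constant_if_DERIV_0:
  assumes "open D" "connected D" "\<And>x. x \<in> D \<Longrightarrow> (f has_field_derivative 0) (at x)"
  shows "\<exists>c::complex. \<forall>x\<in>D. f x = c"
proof -
  have "continuous_on D f" using assms(3) by (meson DERIV_isCont continuous_at_imp_continuous_on)
  then show ?thesis
    using DERIV_zero_connected_constant[OF assms(2,1) finite.emptyI, of f] assms(3) by (metis Diff_iff)
qed

text \<open>The two Codazzi equations are linear in \<open>v h'\<close>, \<open>q'\<close> and
  \<open>q\<close>; eliminating \<open>v h'\<close> leaves the equation
  \<open>s (1 - s^2) q' = 2 q\<close> for \<open>q\<close> alone. The Gauss equation is read as the
  derivative of \<open>s v'/v\<close>.\<close>

lemma reduced_system_facts: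
  assumes sys: "reduced_system c D v h q" and D: "open D" "0 \<notin> D" "1 \<notin> D" "-1 \<notin> D" and s: "s \<in> D"
  shows "(v has_field_derivative deriv v s) (at s)" "(h has_field_derivative deriv h s) (at s)"
    "(q has_field_derivative deriv q s) (at s)" "v s \<noteq> 0" "s \<noteq> 0" "1 - s^2 \<noteq> 0"
    "v s * deriv h s = - 2 * s * deriv q s" "s * (1 - s^2) * deriv q s = 2 * q s"
    "((\<lambda>s. s * deriv v s / v s) has_field_derivative
        ((h s)^2 - c^2) / (2 * s^2) * v s - 2 * (q s)^2 / (s^2 * v s)) (at s)"
proof -
  have hol: "v holomorphic_on D" "h holomorphic_on D" "q holomorphic_on D" using sys by (auto simp: reduced_system_def)
  show "(v has_field_derivative deriv v s) (at s)" "(h has_field_derivative deriv h s) (at s)"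
    "(q has_field_derivative deriv q s) (at s)"
    by (rule holomorphic_derivI[OF _ D(1) s], fact)+
  show v: "v s \<noteq> 0" using sys s by (auto simp: reduced_system_def)
  show s0: "s \<noteq> 0" using D s by auto
  show "1 - s^2 \<noteq> 0" using D s by (intro X_of_facts) auto
  have E2: "- s * v s * deriv h s - 2 * s^2 * deriv q s = 0" and E3: "- (s^2) * v s * deriv h s - 2 * s * deriv q s + 4 * q s = 0"
    and g: "reduced_gauss c v h q s"
    using sys s by (auto simp: reduced_system_def)
  have "s * (v s * deriv h s) = s * (- 2 * s * deriv q s)" using E2 by algebra
  then show vh: "v s * deriv h s = - 2 * s * deriv q s" by (rule mult_left_cancel[OF s0, THEN iffD1])
  show "s * (1 - s^2) * deriv q s = 2 * q s" using E3 vh by algebra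
  have "(\<lambda>s. s * deriv v s / v s) holomorphic_on D"
    using sys D(1) by (intro holomorphic_intros hol) (auto simp: reduced_system_def)
  from holomorphic_derivI[OF this D(1) s] show "((\<lambda>s. s * deriv v s / v s) has_field_derivative
        ((h s)^2 - c^2) / (2 * s^2) * v s - 2 * (q s)^2 / (s^2 * v s)) (at s)"
    using g unfolding reduced_gauss_def by (rule_tac DERIV_cong) (auto simp: algebra_simps)
qed

lemma first_integral_constant:
  assumes sys: "reduced_system c D v h q" and D: "open D" "connected D" "0 \<notin> D" "1 \<notin> D" "-1 \<notin> D"
  shows "\<exists>K. \<forall>\<eta>\<in>D. first_integral c v h q \<eta> = K"
proof (rule constant_if_DERIV_0[OF D(1,2)])
  fix s assume s: "s \<in> D"
  note F = reduced_system_facts[OF sys D(1,3-5)]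
  define L where "L s = s * deriv v s / v s" for s
  \<comment> \<open>Named inverses make the derivative of the first integral a polynomial, so that
    it reduces to zero modulo \<open>s i = 1\<close>, \<open>v w = 1\<close> and the three equations
    of the system.\<close>
  define i w where "i = inverse s" and "w = inverse (v s)"
  have si: "s * i = 1" "v s * w = 1" using F(4,5)[OF s] by (simp_all add: i_def w_def)
  define L' where "L' = ((h s)^2 - c^2) / (2 * s^2) * v s - 2 * (q s)^2 / (s^2 * v s)"
  have L: "(L has_field_derivative L') (at s)" using F(9)[OF s] unfolding L_def L'_def .
  have L': "2 * L' = ((h s)^2 - c^2) * v s * i^2 - 4 * (q s)^2 * i^2 * w"
    using F(4,5)[OF s] by (simp add: L'_def i_def w_def field_simps)
  have h': "deriv h s = - 2 * s * deriv q s * w" using F(7)[OF s] si(2) by algebra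
  have q: "2 * q s = s * deriv q s - s^3 * deriv q s" using F(8)[OF s] by algebra
  have v': "deriv v s = v s * L s * i" using F(4,5)[OF s] by (simp add: L_def i_def)
  have FI: "first_integral c v h q = (\<lambda>s. (L s - 1)^2 - ((h s)^2 - c^2) * v s * inverse s - 2 * (h s + c) * q s
      - 2 * (h s - c) * q s * (inverse s)^2 - 4 * (q s)^2 * inverse s * inverse (v s))"
    by (simp add: fun_eq_iff first_integral_def L_def divide_inverse power_inverse)
  have "(first_integral c v h q has_field_derivative
     2*(L s - 1)*L' - (2 * h s * deriv h s * v s * i + ((h s)^2-c^2) * deriv v s * i - ((h s)^2-c^2) * v s * i^2)
     - 2 * deriv h s * q s - 2*(h s + c) * deriv q s - (2 * deriv h s * q s * i^2 + 2*(h s - c) * deriv q s * i^2 - 4*(h s - c) * q s * i^3)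
     - (8 * q s * deriv q s * i * w - 4*(q s)^2 * i^2 * w - 4*(q s)^2 * i * deriv v s * w^2)) (at s)"
    unfolding FI
    by (rule derivative_eq_intros L F(1)[OF s] F(2)[OF s] F(3)[OF s] F(4)[OF s] F(5)[OF s] refl)+
       (simp add: i_def[symmetric] w_def[symmetric] algebra_simps power2_eq_square power3_eq_cube)
  also have "2*(L s - 1)*L' - (2 * h s * deriv h s * v s * i + ((h s)^2-c^2) * deriv v s * i - ((h s)^2-c^2) * v s * i^2)
     - 2 * deriv h s * q s - 2*(h s + c) * deriv q s - (2 * deriv h s * q s * i^2 + 2*(h s - c) * deriv q s * i^2 - 4*(h s - c) * q s * i^3)
     - (8 * q s * deriv q s * i * w - 4*(q s)^2 * i^2 * w - 4*(q s)^2 * i * deriv v s * w^2) = 0"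
    using L' h' q v' si by algebra
  finally show "(first_integral c v h q has_field_derivative 0) (at s)" .
qed

lemma reduced_system_q_v:
  assumes sys: "reduced_system c D v h q" and D: "open D" "connected D" "0 \<notin> D" "1 \<notin> D" "-1 \<notin> D"
  shows "\<exists>cq. \<forall>\<eta>\<in>D. q \<eta> = cq * \<eta>^2 / (\<eta>^2 - 1) \<and> v \<eta> * deriv h \<eta> = 4 * cq * \<eta>^2 / (1 - \<eta>^2)^2"
proof -
  note F = reduced_system_facts[OF sys D(1,3-5)]
  \<comment> \<open>Integration of \<open>s (1 - s^2) q' = 2 q\<close>: the quantity
    \<open>q (1 - 1/s^2)\<close> is conserved, and its value is the constant
    \<open>cq\<close>.\<close>
  have "\<exists>cq. \<forall>s\<in>D. q s * (1 - (inverse s)^2) = cq"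
  proof (rule constant_if_DERIV_0[OF D(1,2)])
    fix s assume s: "s \<in> D"
    define i where "i = inverse s"
    have si: "s * i = 1" using F(5)[OF s] by (simp add: i_def)
    have "((\<lambda>s. q s * (1 - (inverse s)^2)) has_field_derivative deriv q s * (1 - i^2) + 2 * q s * i^3) (at s)"
      by (rule derivative_eq_intros F(3)[OF s] F(5)[OF s] refl)+ (simp add: i_def[symmetric] power2_eq_square power3_eq_cube)
    also have "deriv q s * (1 - i^2) + 2 * q s * i^3 = 0" using F(8)[OF s] si by algebra
    finally show "((\<lambda>s. q s * (1 - (inverse s)^2)) has_field_derivative 0) (at s)" .
  qed
  then obtain cq where cq: "\<And>s. s \<in> D \<Longrightarrow> q s * (1 - (inverse s)^2) = cq" by blast
  have "q s = cq * s^2 / (s^2 - 1) \<and> v s * deriv h s = 4 * cq * s^2 / (1 - s^2)^2" if s: "s \<in> D" for s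
  proof
    have n: "s \<noteq> 0" "1 - s^2 \<noteq> 0" "s^2 - 1 \<noteq> 0" using F(5,6)[OF s] by auto
    have "q s * (s^2 - 1) = cq * s^2" using n(1) unfolding cq[OF s, symmetric] by (simp add: field_simps)
    then show q: "q s = cq * s^2 / (s^2 - 1)" using n by (simp add: field_simps)
    have "(1 - s^2) * (v s * deriv h s) = - 4 * q s" using F(7,8)[OF s] by algebra
    then have "(1 - s^2)^2 * (v s * deriv h s) = (1 - s^2) * (- 4 * q s)" by algebra
    also have "\<dots> = 4 * cq * s^2" using \<open>q s * (s^2 - 1) = cq * s^2\<close> by algebra
    finally show "v s * deriv h s = 4 * cq * s^2 / (1 - s^2)^2" using n by (simp add: field_simps)
  qed
  then show ?thesis by blast
qed

text \<open>One point with nonzero \<open>h'\<close> suffices: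
  \<open>v h' = 4 cq eta^2 / (1 - eta^2)^2\<close> vanishes either everywhere or nowhere on
  \<open>D\<close>, according to whether \<open>cq\<close> is zero.\<close>

lemma vq_form_if_reduced_system:
  assumes sys: "reduced_system c D v h q" and D: "open D" "connected D" "0 \<notin> D" "1 \<notin> D" "-1 \<notin> D"
    and ne: "\<eta>1 \<in> D" "deriv h \<eta>1 \<noteq> 0"
  shows "\<exists>cq. cq \<noteq> 0 \<and> vq_form cq D v h q"
proof -
  note F = reduced_system_facts[OF sys D(1,3-5)]
  obtain cq where cq: "\<And>\<eta>. \<eta> \<in> D \<Longrightarrow> q \<eta> = cq * \<eta>^2 / (\<eta>^2 - 1)" 
    "\<And>\<eta>. \<eta> \<in> D \<Longrightarrow> v \<eta> * deriv h \<eta> = 4 * cq * \<eta>^2 / (1 - \<eta>^2)^2"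
    using reduced_system_q_v[OF sys D] by blast
  have cq0: "cq \<noteq> 0" using cq(2)[OF ne(1)] F(4)[OF ne(1)] ne(2) by auto
  have "deriv h \<eta> \<noteq> 0 \<and> v \<eta> = 4 * cq * \<eta>^2 / ((1 - \<eta>^2)^2 * deriv h \<eta>)" if \<eta>: "\<eta> \<in> D" for \<eta>
  proof
    show "deriv h \<eta> \<noteq> 0" using cq(2)[OF \<eta>] cq0 F(5,6)[OF \<eta>] by auto
    then show "v \<eta> = 4 * cq * \<eta>^2 / ((1 - \<eta>^2)^2 * deriv h \<eta>)" using cq(2)[OF \<eta>] F(6)[OF \<eta>] by (simp add: divide_simps mult_ac)
  qed
  then show ?thesis using cq0 cq(1) by (auto simp: vq_form_def)
qed

text \<open>The explicit \<open>q\<close> and \<open>v\<close> already satisfy both Codazzi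
  equations, whatever \<open>h\<close> is, so only the Gauss equation has to be supplied.\<close>

lemma reduced_systemI:
  assumes hol: "v holomorphic_on D" "h holomorphic_on D" and g: "\<And>\<eta>. \<eta> \<in> D \<Longrightarrow> reduced_gauss c v h q \<eta>"
    and cq: "cq \<noteq> 0" and vq: "vq_form cq D v h q" and D: "open D" "0 \<notin> D" "1 \<notin> D" "-1 \<notin> D"
  shows "reduced_system c D v h q"
proof -
  have n: "s \<noteq> 0" "1 - s^2 \<noteq> 0" "s^2 - 1 \<noteq> 0" "deriv h s \<noteq> 0" if "s \<in> D" for s
  proof -
    show "s \<noteq> 0" using D that by auto
    show "1 - s^2 \<noteq> 0" using D that by (intro X_of_facts) auto
    then show "s^2 - 1 \<noteq> 0" by auto
    show "deriv h s \<noteq> 0" using vq that by (auto simp: vq_form_def)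
  qed
  have q: "q s = cq * s^2 / (s^2 - 1)" and v: "v s = 4 * cq * s^2 / ((1 - s^2)^2 * deriv h s)" if "s \<in> D" for s
    using vq that by (auto simp: vq_form_def)
  have qh: "q holomorphic_on D"
    by (rule holomorphic_transform[where f = "\<lambda>s. cq * s^2 / (s^2 - 1)"]) (use n q in \<open>auto intro!: holomorphic_intros\<close>)
  have dq: "deriv q s = - 2 * cq * s / (s^2 - 1)^2" if s: "s \<in> D" for s
  proof -
    have "((\<lambda>s. cq * s^2 / (s^2 - 1)) has_field_derivative - 2 * cq * s / (s^2 - 1)^2) (at s)"
      by (rule derivative_eq_intros n[OF s] refl)+ (simp add: power2_eq_square algebra_simps)
    then have "(q has_field_derivative - 2 * cq * s / (s^2 - 1)^2) (at s)"
      by (rule has_field_derivative_transform_within_open[OF _ D(1) s]) (simp add: q)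
    then show ?thesis by (rule DERIV_imp_deriv)
  qed
  have "v s \<noteq> 0 \<and> - s * v s * deriv h s - 2 * s^2 * deriv q s = 0 \<and> - (s^2) * v s * deriv h s - 2 * s * deriv q s + 4 * q s = 0"
    if s: "s \<in> D" for s
  proof -
    define e where "e = s^2 - 1"
    have e: "e \<noteq> 0" "1 - s^2 = - e" using n[OF s] by (auto simp: e_def)
    have vh: "v s * deriv h s = 4 * cq * s^2 / e^2" using v[OF s] n[OF s] e by simp
    have dq': "deriv q s = - 2 * cq * s / e^2" and q': "q s = cq * s^2 * e / e^2"
      using dq[OF s] q[OF s] e(1) unfolding e_def[symmetric] by (simp_all add: power2_eq_square[of e])
    have "v s \<noteq> 0" using v[OF s] n[OF s] cq by simp
    moreover have "- s * (v s * deriv h s) - 2 * s^2 * deriv q s = 0"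
      unfolding vh dq' using e by (simp add: field_simps power2_eq_square)
    moreover have "- (s^2) * (v s * deriv h s) - 2 * s * deriv q s + 4 * q s = (- 4*cq* s^4 + 4*cq* s^2 + 4*cq* s^2*e)/e^2"
      unfolding vh dq' q' using e(1) by (simp add: field_simps power2_eq_square power4_eq_xxxx)
    moreover have "- 4*cq* s^4 + 4*cq* s^2 + 4*cq* s^2*e = 0" unfolding e_def by algebra
    ultimately show ?thesis by (simp add: mult.assoc)
  qed
  then show ?thesis using hol qh g by (simp add: reduced_system_def)
qed

lemma reduced_solution_unique:
  assumes sys: "reduced_system c D v h q" and D: "open D" "connected D" "0 \<notin> D" "1 \<notin> D" "-1 \<notin> D"
    and ne: "\<eta>1 \<in> D" "deriv h \<eta>1 \<noteq> 0"
  shows "\<exists>!(cq, K). reduced_solution c D cq K v h q"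
proof -
  obtain K where K: "\<forall>\<eta>\<in>D. first_integral c v h q \<eta> = K" using first_integral_constant[OF sys D] by blast
  obtain cq where cq: "cq \<noteq> 0" "vq_form cq D v h q" using vq_form_if_reduced_system[OF sys D ne] by blast
  have n: "\<eta>1 \<noteq> 0" "\<eta>1^2 - 1 \<noteq> 0" using reduced_system_facts(5,6)[OF sys D(1,3-5) ne(1)] by auto
  show ?thesis
  proof (rule ex1I[of _ "(cq, K)"])
    show "case (cq, K) of (cq, K) \<Rightarrow> reduced_solution c D cq K v h q" using sys cq K by (simp add: reduced_solution_def)
    fix y assume y: "case y of (cq, K) \<Rightarrow> reduced_solution c D cq K v h q"
    obtain cq' K' where y': "y = (cq', K')" by (cases y)
    have r: "reduced_solution c D cq' K' v h q" using y y' by simp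
    have "K' = K" using r K ne(1) by (auto simp: reduced_solution_def)
    have "cq' * \<eta>1^2 / (\<eta>1^2 - 1) = cq * \<eta>1^2 / (\<eta>1^2 - 1)" using r cq ne(1) by (auto simp: reduced_solution_def vq_form_def)
    then have "cq' = cq" using n by simp
    then show "y = (cq, K)" using y' \<open>K' = K\<close> by simp
  qed
qed

text \<open>SD-Ia gives the value \<open>K\<close> of the first integral. The Gauss equation is a
  combination of the third-order equation, multiplied by \<open>Y'\<close>, with SD-Ia.\<close>

lemma reduced_solution_if_pvi:
  assumes D: "open D" "0 \<notin> D" "1 \<notin> D" "-1 \<notin> D" and cq: "cq \<noteq> 0" and bp: "bonnet_params c cq K ti t0 t1 tX"
    and U: "open U" and sol: "pvi_solution ti t0 t1 tX U V"
    and h: "\<And>\<eta>. \<eta> \<in> D \<Longrightarrow> X_of \<eta> \<in> U \<and> h \<eta> = - 8 / cq * (X_of \<eta> * (X_of \<eta> - 1) * H_VI ti t0 t1 tX V (X_of \<eta>))"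
    and vq: "vq_form cq D v h q"
  shows "reduced_solution c D cq K v h q"
proof -
  define Y where "Y = (\<lambda>X. X*(X-1) * H_VI ti t0 t1 tX V X)"
  note S = pvi_sigma_bonnet[OF U sol bp Y_def]
  have XU: "X_of ` D \<subseteq> U" using h by auto
  have hY: "\<forall>s\<in>D. h s = - 8 / cq * Y (X_of s)" using h by (simp add: Y_def)
  note R = reduction_in_X[OF D cq U XU S(1) hY vq]
  have n: "s \<noteq> 0" "1 - s^2 \<noteq> 0" "deriv h s \<noteq> 0" if "s \<in> D" for s
    using X_of_facts(1)[of s] vq D that by (auto simp: vq_form_def)
  have Xh: "X_of holomorphic_on D" unfolding X_of_def[abs_def] using n by (intro holomorphic_intros) auto
  have "(\<lambda>s. - 8 / cq * (Y \<circ> X_of) s) holomorphic_on D"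
    by (intro holomorphic_intros holomorphic_on_compose[OF Xh] holomorphic_on_subset[OF S(1)] XU)
  then have hh: "h holomorphic_on D" by (rule holomorphic_transform) (simp add: hY)
  have "(\<lambda>s. 4 * cq * s^2 / ((1 - s^2)^2 * deriv h s)) holomorphic_on D"
    using n hh D(1) by (intro holomorphic_intros) auto
  then have vh: "v holomorphic_on D" by (rule holomorphic_transform) (use vq in \<open>simp add: vq_form_def\<close>)
  have "reduced_gauss c v h q s \<and> first_integral c v h q s = K" if s: "s \<in> D" for s
  proof
    define X Y0 Y1 Y2 Y3 where "X = X_of s" and "Y0 = Y X" and "Y1 = deriv Y X" and "Y2 = deriv (deriv Y) X" and "Y3 = deriv (deriv (deriv Y)) X"
    have XU: "X \<in> U" using h[OF s] by (simp add: X_def)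
    note R = R[OF s, folded X_def, folded Y0_def Y1_def Y2_def Y3_def]
    note S = S(2,3)[OF XU, folded Y0_def Y1_def Y2_def Y3_def]
    have "4 * Y1^2 * (first_integral c v h q s + 2*cq*c) = 4 * Y1^2 * (K + 2*cq*c)"
      unfolding R(3) S(1) by algebra
    then show "first_integral c v h q s = K" using R(2) by simp
    \<comment> \<open>The term \<open>32 Z^2\<close>, with \<open>Z = X(X-1) Y2\<close>, is written
      as \<open>2 (16 Z^2)\<close> so that SD-Ia can replace it.\<close>
    have "32 * X*(X-1)*((2*X-1)*Y2 + X*(X-1)*Y3)*Y1 = 2*(16*(X*(X-1)*Y2)^2) + (64*Y0^2-(cq*c)^2)*Y1 - 64*X*(X-1)*Y1^3"
      unfolding S(1) S(2) by algebra
    then show "reduced_gauss c v h q s" unfolding R(4) by simp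
  qed
  then show ?thesis using reduced_systemI[OF vh hh _ cq vq D] cq vq by (simp add: reduced_solution_def)
qed

section \<open>A Riccati equation\<close>

lemma powser_radius:
  fixes f :: "nat \<Rightarrow> complex"
  assumes M: "M > 0" and f: "\<And>n. norm (f n) \<le> B * M^n" and t: "norm t < 1/M"
  shows "ereal (norm t) < fps_conv_radius (Abs_fps f)"
proof -
  have "fps_conv_radius (Abs_fps f) \<ge> ereal (1/M)"
    unfolding fps_conv_radius_def fps_nth_Abs_fps
  proof (rule conv_radius_geI_ex)
    fix r :: real assume r: "0 < r" "ereal r < ereal (1/M)"
    have Mr: "M * r < 1" using r M by (simp add: field_simps)
    have "summable (\<lambda>n. f n * of_real r ^ n)"
    proof (rule summable_comparison_test')
      show "summable (\<lambda>n. B * (M*r)^n)" using Mr r M by (intro summable_mult summable_geometric) auto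
      show "norm (f n * of_real r ^ n) \<le> B * (M*r)^n" if "n \<ge> 0" for n
        using mult_right_mono[OF f[of n], of "r^n"] r by (simp add: norm_mult norm_power power_mult_distrib mult_ac)
    qed
    then show "\<exists>z. norm z = r \<and> summable (\<lambda>n. f n * z ^ n)" using r by (intro exI[of _ "of_real r"]) auto
  qed
  moreover have "ereal (norm t) < ereal (1/M)" using t by simp
  ultimately show ?thesis by (rule less_le_trans[rotated])
qed

text \<open>Coefficient by coefficient, \<open>rec\<close> says \<open>(p + t) u' = g\<close> for
  formal power series. The geometric bound on \<open>u\<close> makes this an identity of functions
  at \<open>t\<close>. In the application \<open>p\<close> is the distance from the expansion point
  to one singular point.\<close>

lemma powser_ode:
  fixes u g :: "nat \<Rightarrow> complex"
  assumes M: "M > 0" and p: "p + t \<noteq> 0" and t: "norm t < 1/M"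
    and u: "\<And>n. norm (u n) \<le> C * M^n"
    and rec: "\<And>n. p * of_nat (Suc n) * u (Suc n) + of_nat n * u n = g n"
  shows "(eval_fps (Abs_fps u) has_field_derivative eval_fps (Abs_fps g) t / (p + t)) (at t)"
proof -
  let ?U = "Abs_fps u"
  have "(fps_const p + fps_X) * fps_deriv ?U = Abs_fps g"
  proof (rule fps_ext)
    fix n show "fps_nth ((fps_const p + fps_X) * fps_deriv ?U) n = fps_nth (Abs_fps g) n"
      using rec[of n] by (cases n) (auto simp: distrib_right algebra_simps)
  qed
  then have "eval_fps (Abs_fps g) t = eval_fps ((fps_const p + fps_X) * fps_deriv ?U) t" by simp
  also have "\<dots> = (p + t) * eval_fps (fps_deriv ?U) t"
  proof -
    note tu = powser_radius[OF M u t]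
    have inf: "fps_conv_radius (fps_const p + fps_X) = \<infinity>"
      using fps_conv_radius_add[of "fps_const p" fps_X] by simp
    have "eval_fps ((fps_const p + fps_X) * fps_deriv ?U) t = eval_fps (fps_const p + fps_X) t * eval_fps (fps_deriv ?U) t"
      using tu fps_conv_radius_deriv[of ?U] inf by (intro eval_fps_mult) (auto intro: less_le_trans)
    also have "eval_fps (fps_const p + fps_X) t = p + t" by (subst eval_fps_add) auto
    finally show ?thesis .
  qed
  finally have "eval_fps (fps_deriv ?U) t = eval_fps (Abs_fps g) t / (p + t)" using p by simp
  then show ?thesis using has_field_derivative_eval_fps[OF powser_radius[OF M u t]] by simp
qed

text \<open>The Riccati equation is linearised by \<open>V = w/y\<close> with \<open>y = u + x\<close>, where \<open>u, x, w\<close> satisfy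
  a system whose power series solution about \<open>X0\<close> has a one-step recursion.\<close>

primrec riccati_coeffs :: "complex \<Rightarrow> complex \<Rightarrow> complex \<Rightarrow> nat \<Rightarrow> complex \<times> complex \<times> complex" where
  "riccati_coeffs \<beta> X0 v0 0 = (1, 0, v0)"
| "riccati_coeffs \<beta> X0 v0 (Suc n) = (case riccati_coeffs \<beta> X0 v0 n of (u, x, w) \<Rightarrow>
     ((\<beta> * w - of_nat n * u) / ((X0 - 1) * of_nat (Suc n)),
      (- \<beta> * w - of_nat n * x) / (X0 * of_nat (Suc n)),
      (\<beta> * (2 * w - (u + x)) - of_nat n * w) / ((X0 - 1) * of_nat (Suc n))))"

text \<open>The linear system is \<open>y' = beta w / (X(X-1))\<close> and
  \<open>(X-1) w' = beta (2 w - y)\<close>. Splitting \<open>1/(X(X-1))\<close> into partial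
  fractions splits \<open>y\<close> into \<open>u + x\<close>, so that each of the three equations
  has a single pole; this is what makes the recursion one-step.\<close>

lemma riccati_local_solution:
  fixes \<beta> X0 v0 :: complex
  assumes X0: "X0 \<noteq> 0" "X0 \<noteq> 1"
  shows "\<exists>r>0. \<exists>V. V X0 = v0 \<and> (\<forall>X\<in>ball X0 r. (V has_field_derivative - \<beta> * ((V X)^2 - 2 * X * V X + X) / (X*(X-1))) (at X))"
proof -
  define u where "u n = fst (riccati_coeffs \<beta> X0 v0 n)" for n
  define x where "x n = fst (snd (riccati_coeffs \<beta> X0 v0 n))" for n
  define w where "w n = snd (snd (riccati_coeffs \<beta> X0 v0 n))" for n
  define e where "e = X0 - 1"
  have e: "e \<noteq> 0" using X0 by (simp add: e_def)
  have init: "u 0 = 1" "x 0 = 0" "w 0 = v0" by (simp_all add: u_def x_def w_def)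
  have step_eqs: "u (Suc n) = (\<beta> * w n - of_nat n * u n) / (e * of_nat (Suc n))"
    "x (Suc n) = (- \<beta> * w n - of_nat n * x n) / (X0 * of_nat (Suc n))"
    "w (Suc n) = (\<beta> * (2 * w n - (u n + x n)) - of_nat n * w n) / (e * of_nat (Suc n))" for n
    by (simp_all add: u_def x_def w_def e_def split: prod.split)
  have nz: "of_nat (Suc n) \<noteq> (0::complex)" for n by (rule of_nat_neq_0)
  have rec: "e * of_nat (Suc n) * u (Suc n) + of_nat n * u n = \<beta> * w n"
    "X0 * of_nat (Suc n) * x (Suc n) + of_nat n * x n = - \<beta> * w n"
    "e * of_nat (Suc n) * w (Suc n) + of_nat n * w n = \<beta> * (2 * w n - (u n + x n))" for n
    unfolding step_eqs using e X0(1) nz[of n] by (simp_all del: of_nat_Suc)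
  \<comment> \<open>\<open>C\<close> dominates the initial values \<open>1, 0, v0\<close>. In one
    step the right side contributes at most \<open>4 |beta|\<close> times the bound, because
    \<open>2 w - (u + x)\<close> has total weight 4, and the term with \<open>n\<close> contributes
    at most once the bound after division by \<open>n + 1\<close>; hence \<open>A\<close>, and
    \<open>M\<close> covers the division by either pole distance.\<close>
  define C where "C = 1 + norm v0"
  define A where "A = 4 * norm \<beta> + 1"
  define M where "M = A / norm e + A / norm X0"
  have A: "A > 0" "C > 0" by (simp_all add: A_def C_def add_nonneg_pos add_pos_nonneg)
  have M: "M > 0" using A e X0 by (simp add: M_def add_pos_pos)
  have step: "norm ((b - of_nat n * a) / (d * of_nat (Suc n))) \<le> C * M^Suc n"
    if a: "norm a \<le> C * M^n" and b: "norm b \<le> 4 * norm \<beta> * (C * M^n)" and d: "d \<noteq> 0" "A / norm d \<le> M" for a b d :: complex and n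
  proof -
    have "norm (b - of_nat n * a) \<le> norm b + of_nat n * norm a"
      using norm_triangle_ineq4[of b "of_nat n * a"] by (simp add: norm_mult)
    also have "\<dots> \<le> 4 * norm \<beta> * (C * M^n) * of_nat (Suc n) + (C * M^n) * of_nat (Suc n)"
    proof (rule add_mono)
      have "4 * norm \<beta> * (C * M^n) * 1 \<le> 4 * norm \<beta> * (C * M^n) * of_nat (Suc n)"
        using A M by (intro mult_left_mono) auto
      then show "norm b \<le> 4 * norm \<beta> * (C * M^n) * of_nat (Suc n)" using b by simp
      have "of_nat n * norm a \<le> of_nat (Suc n) * (C * M^n)" using a by (intro mult_mono) auto
      then show "of_nat n * norm a \<le> (C * M^n) * of_nat (Suc n)" by (simp add: mult.commute)
    qed
    also have "\<dots> = A * (C * M^n) * of_nat (Suc n)" by (simp add: A_def algebra_simps)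
    finally have "norm (b - of_nat n * a) / (norm d * of_nat (Suc n)) \<le> A * (C * M^n) * of_nat (Suc n) / (norm d * of_nat (Suc n))"
      by (intro divide_right_mono) auto
    also have "\<dots> = A / norm d * (C * M^n)" by (simp del: of_nat_Suc)
    also have "\<dots> \<le> M * (C * M^n)" using d A M by (intro mult_right_mono) auto
    finally show ?thesis by (simp add: norm_divide norm_mult mult_ac del: of_nat_Suc)
  qed
  have Md: "A / norm e \<le> M" "A / norm X0 \<le> M" using A by (simp_all add: M_def)
  have bd: "norm (u n) \<le> C * M^n \<and> norm (x n) \<le> C * M^n \<and> norm (w n) \<le> C * M^n" for n
  proof (induction n)
    case 0
    then show ?case by (simp add: init C_def)
  next
    case (Suc n)
    define b where "b = norm \<beta> * (C * M^n)"
    have "norm \<beta> * norm (w n) \<le> b" "b \<ge> 0" using Suc A M by (auto simp: b_def intro!: mult_left_mono mult_nonneg_nonneg)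
    then have "norm \<beta> * norm (w n) \<le> 4 * b" by linarith
    then have "norm (- \<beta> * w n) \<le> 4 * norm \<beta> * (C * M^n)" "norm (\<beta> * w n) \<le> 4 * norm \<beta> * (C * M^n)"
      by (simp_all add: b_def norm_mult mult.assoc)
    moreover have "norm (2 * w n - (u n + x n)) \<le> 4 * (C * M^n)"
      using norm_triangle_ineq4[of "2 * w n" "u n + x n"] norm_triangle_ineq[of "u n" "x n"] Suc by (simp add: norm_mult)
    then have "norm (\<beta> * (2 * w n - (u n + x n))) \<le> 4 * norm \<beta> * (C * M^n)"
      using mult_left_mono[of "norm (2 * w n - (u n + x n))" "4 * (C * M^n)" "norm \<beta>"] by (simp add: norm_mult)
    ultimately show ?case unfolding step_eqs
      using Suc Md e X0(1) by (intro conjI step) auto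
  qed
  define U X1 W where "U = eval_fps (Abs_fps u)" and "X1 = eval_fps (Abs_fps x)" and "W = eval_fps (Abs_fps w)"
  \<comment> \<open>Inside this radius the series converge and \<open>X\<close> stays away from the
    singular points 0 and 1.\<close>
  define r1 where "r1 = min (1/M) (min (norm X0) (norm e))"
  have r1: "r1 > 0" using M e X0 by (simp add: r1_def)
  have pt: "X0 + t \<noteq> 0" "e + t \<noteq> 0" "norm t < 1/M" if "norm t < r1" for t
  proof -
    have "norm t < norm X0" "norm t < norm e" "norm t < 1/M" using that by (auto simp: r1_def)
    then show "X0 + t \<noteq> 0" "e + t \<noteq> 0" "norm t < 1/M" by (auto simp: add_eq_0_iff2)
  qed
  have bd': "norm (u n) \<le> C * M^n" "norm (x n) \<le> C * M^n" "norm (w n) \<le> C * M^n" for n using bd by auto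
  have rad: "ereal (norm t) < fps_conv_radius (Abs_fps u)" "ereal (norm t) < fps_conv_radius (Abs_fps x)" 
    "ereal (norm t) < fps_conv_radius (Abs_fps w)" if "norm t < r1" for t :: complex
    by (rule powser_radius[OF M _ pt(3)[OF that]], rule bd')+
  have cmul: "eval_fps (fps_const k * F) t = k * eval_fps F t" if "ereal (norm t) < fps_conv_radius F" for F t and k :: complex
    using that by (subst eval_fps_mult) auto
  have dU: "(U has_field_derivative \<beta> * W t / (e + t)) (at t)"
    and dX: "(X1 has_field_derivative - \<beta> * W t / (X0 + t)) (at t)"
    and dW: "(W has_field_derivative \<beta> * (2 * W t - (U t + X1 t)) / (e + t)) (at t)" if t: "norm t < r1" for t
  proof -
    have E: "Abs_fps (\<lambda>n. - \<beta> * w n) = fps_const (- \<beta>) * Abs_fps w" "Abs_fps (\<lambda>n. \<beta> * w n) = fps_const \<beta> * Abs_fps w"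
      "Abs_fps (\<lambda>n. \<beta> * (2 * w n - (u n + x n))) = fps_const \<beta> * (fps_const 2 * Abs_fps w - (Abs_fps u + Abs_fps x))"
      by (simp_all add: fps_eq_iff)
    have sum: "ereal (norm t) < fps_conv_radius (Abs_fps u + Abs_fps x)"
      using rad(1,2)[OF t] by (intro less_le_trans[OF _ fps_conv_radius_add]) simp
    have w2: "ereal (norm t) < fps_conv_radius (fps_const 2 * Abs_fps w)"
      using rad(3)[OF t] by (intro less_le_trans[OF _ fps_conv_radius_mult]) simp
    have diff: "ereal (norm t) < fps_conv_radius (fps_const 2 * Abs_fps w - (Abs_fps u + Abs_fps x))"
      using sum w2 by (intro less_le_trans[OF _ fps_conv_radius_diff]) simp
    have ev: "eval_fps (Abs_fps (\<lambda>n. - \<beta> * w n)) t = - \<beta> * W t" "eval_fps (Abs_fps (\<lambda>n. \<beta> * w n)) t = \<beta> * W t"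
      "eval_fps (Abs_fps (\<lambda>n. \<beta> * (2 * w n - (u n + x n)))) t = \<beta> * (2 * W t - (U t + X1 t))"
      unfolding E cmul[OF rad(3)[OF t]] cmul[OF diff] eval_fps_diff[OF w2 sum] eval_fps_add[OF rad(1)[OF t] rad(2)[OF t]]
      by (simp_all add: U_def X1_def W_def)
    show "(U has_field_derivative \<beta> * W t / (e + t)) (at t)"
      using powser_ode[OF M pt(2)[OF t] pt(3)[OF t] bd'(1) rec(1)] unfolding ev U_def .
    show "(X1 has_field_derivative - \<beta> * W t / (X0 + t)) (at t)"
      using powser_ode[OF M pt(1)[OF t] pt(3)[OF t] bd'(2) rec(2)] unfolding ev X1_def .
    show "(W has_field_derivative \<beta> * (2 * W t - (U t + X1 t)) / (e + t)) (at t)"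
      using powser_ode[OF M pt(2)[OF t] pt(3)[OF t] bd'(3) rec(3)] unfolding ev W_def .
  qed
  define y where "y t = U t + X1 t" for t
  have dy: "(y has_field_derivative \<beta> * W t / (e + t) + - \<beta> * W t / (X0 + t)) (at t)" if "norm t < r1" for t
    unfolding y_def by (intro DERIV_add dU dX that)
  have y0: "y 0 = 1" and W0: "W 0 = v0" by (simp_all add: y_def U_def X1_def W_def eval_fps_at_0 init)
  have "isCont y 0" using dy[of 0] r1 by (auto intro: DERIV_isCont)
  then obtain r2 where r2: "r2 > 0" "\<And>t. norm t < r2 \<Longrightarrow> y t \<noteq> 0"
    using continuous_at_avoid[of 0 y 0] y0 by (auto simp: dist_norm)
  show ?thesis
  proof (intro exI[of _ "min r1 r2"] conjI exI[of _ "\<lambda>X. W (X - X0) / y (X - X0)"] ballI)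
    show "min r1 r2 > 0" using r1 r2 by simp
    show "W (X0 - X0) / y (X0 - X0) = v0" by (simp add: y0 W0)
    fix X assume "X \<in> ball X0 (min r1 r2)"
    then have t: "norm (X - X0) < r1" "norm (X - X0) < r2" by (auto simp: dist_norm norm_minus_commute)
    define t where "t = X - X0"
    have n: "X \<noteq> 0" "X - 1 \<noteq> 0" "y t \<noteq> 0" using pt(1,2)[OF t(1)] r2(2)[OF t(2)] by (auto simp: t_def e_def)
    have et: "e + t = X - 1" "X0 + t = X" by (auto simp: t_def e_def)
    have dW': "(W has_field_derivative \<beta> * (2 * W t - y t) / (X - 1)) (at t)" using dW[OF t(1)] unfolding t_def[symmetric] et y_def[symmetric] .
    have dy': "(y has_field_derivative \<beta> * W t / (X - 1) + - \<beta> * W t / X) (at t)" using dy[OF t(1)] unfolding t_def[symmetric] et .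
    have "((\<lambda>t. W t / y t) has_field_derivative - \<beta> * ((W t / y t)^2 - 2 * X * (W t / y t) + X) / (X*(X-1))) (at t)"
      by (rule DERIV_cong[OF DERIV_divide[OF dW' dy' n(3)]]) (use n in \<open>simp add: divide_simps power2_eq_square\<close>, use n in \<open>simp add: algebra_simps\<close>)
    then have "((\<lambda>t. W t / y t) \<circ> (\<lambda>X. X - X0) has_field_derivative - \<beta> * ((W t / y t)^2 - 2 * X * (W t / y t) + X) / (X*(X-1)) * 1) (at X)"
      by (intro DERIV_chain) (auto simp: t_def intro!: derivative_eq_intros)
    then show "((\<lambda>X. W (X - X0) / y (X - X0)) has_field_derivative - \<beta> * ((W (X - X0) / y (X - X0))^2 - 2 * X * (W (X - X0) / y (X - X0)) + X) / (X*(X-1))) (at X)"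
      by (simp add: o_def t_def)
  qed
qed

section \<open>Solutions of Painleve VI from the sigma form\<close>

text \<open>In canonical variables this is the line \<open>p = 0\<close>: for these parameters
  \<open>ham_q\<close> at \<open>p = 0\<close> is \<open>(t0 + t1 + T)^2 - ti^2 = 0\<close>, so the
  line is invariant, and the remaining equation \<open>t(t-1) q' = ham_p\<close> is the Riccati
  equation. There \<open>sig1 = - 4 beta^2\<close>, so \<open>Y\<close> is affine and the same for
  all these solutions. The proof verifies this directly from the Riccati equation.\<close>

lemma pvi_solution_if_riccati:
  assumes W: "open W" and n: "\<And>X. X \<in> W \<Longrightarrow> X \<noteq> 0 \<and> X \<noteq> 1 \<and> V X \<noteq> 0 \<and> V X \<noteq> 1 \<and> V X \<noteq> X"
    and dV: "\<And>X. X \<in> W \<Longrightarrow> (V has_field_derivative - \<beta> * ((V X)^2 - 2 * X * V X + X) / (X*(X-1))) (at X)"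
  shows "pvi_solution \<beta> \<beta> \<beta> (1-\<beta>) W V"
    and "X \<in> W \<Longrightarrow> X*(X-1) * H_VI \<beta> \<beta> \<beta> (1-\<beta>) V X = - (\<beta>^2) * (X - 1/2)"
proof -
  have V: "V holomorphic_on W" using dV W by (auto simp: holomorphic_on_open)
  have r: "X*(X-1) * deriv V X = - \<beta> * ((V X)^2 - 2 * X * V X + X)" if "X \<in> W" for X
    using DERIV_imp_deriv[OF dV[OF that]] n[OF that] by simp
  have d: "X^2*(X-1)^2 * deriv (deriv V) X = - \<beta> * (2 * (V X - X) * (- \<beta> * ((V X)^2 - 2 * X * V X + X)) + (1 - 2 * V X) * (X*(X-1)))
       - (2*X-1) * (- \<beta> * ((V X)^2 - 2 * X * V X + X))"
    if X: "X \<in> W" for X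
  proof -
    have ddV: "(deriv V has_field_derivative deriv (deriv V) X) (at X)"
      by (rule holomorphic_derivI[OF holomorphic_deriv[OF V W] W X])
    have "((\<lambda>X. X*(X-1) * deriv V X) has_field_derivative (2*X-1) * deriv V X + X*(X-1) * deriv (deriv V) X) (at X)"
      by (rule derivative_eq_intros ddV refl)+ (simp add: algebra_simps)
    moreover have "((\<lambda>X. - \<beta> * ((V X)^2 - 2 * X * V X + X)) has_field_derivative - \<beta> * (2 * (V X - X) * deriv V X + 1 - 2 * V X)) (at X)"
      by (rule derivative_eq_intros holomorphic_derivI[OF V W X] refl)+ (simp add: algebra_simps)
    then have "((\<lambda>X. X*(X-1) * deriv V X) has_field_derivative - \<beta> * (2 * (V X - X) * deriv V X + 1 - 2 * V X)) (at X)"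
      by (rule has_field_derivative_transform_within_open[OF _ W X]) (simp add: r)
    ultimately have "(2*X-1) * deriv V X + X*(X-1) * deriv (deriv V) X = - \<beta> * (2 * (V X - X) * deriv V X + 1 - 2 * V X)" by (rule DERIV_unique)
    then show ?thesis using r[OF X] by algebra
  qed
  have "deriv (deriv V) X = pvi_rhs \<beta> \<beta> \<beta> (1-\<beta>) X (V X) (deriv V X)" if X: "X \<in> W" for X
  proof -
    define q where "q = V X"
    have nq: "q \<noteq> 0" "q \<noteq> 1" "q \<noteq> X" "X \<noteq> 0" "X \<noteq> 1" using n[OF X] by (auto simp: q_def)
    define E where "E = 2*(q*(q-1)*(q-X))*(X^2*(X-1)^2)"
    have "E * deriv (deriv V) X = E * pvi_rhs \<beta> \<beta> \<beta> (1-\<beta>) X q (deriv V X)"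
      using pvi_rhs_cleared[OF nq, of \<beta> \<beta> \<beta> "1-\<beta>" "deriv V X"] d[OF X] unfolding r[OF X] q_def[symmetric] E_def by algebra
    moreover have "E \<noteq> 0" using nq by (simp add: E_def)
    ultimately show ?thesis by (simp add: q_def)
  qed
  then show "pvi_solution \<beta> \<beta> \<beta> (1-\<beta>) W V" using V n by (simp add: pvi_solution_def)
  show "X*(X-1) * H_VI \<beta> \<beta> \<beta> (1-\<beta>) V X = - (\<beta>^2) * (X - 1/2)" if X: "X \<in> W"
  proof -
    define q where "q = V X"
    have nq: "q \<noteq> 0" "q \<noteq> 1" "q \<noteq> X" "X \<noteq> 0" "X \<noteq> 1" using n[OF X] by (auto simp: q_def)
    define E where "E = q*(q-1)*(q-X)"
    define M where "M = X*(X-1) * H_VI \<beta> \<beta> \<beta> (1-\<beta>) V X"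
    have "8 * E * M = - 4 * E * (\<beta>^2) * (2*X - 1)"
      using H_VI_cleared[of V X, OF nq[unfolded q_def] refl refl, of \<beta> \<beta> \<beta> "1-\<beta>"] unfolding r[OF X] q_def[symmetric] E_def M_def[symmetric] by algebra
    then have "4 * E * (2 * M) = 4 * E * (- (\<beta>^2) * (2*X - 1))" by algebra
    moreover have "4 * E \<noteq> 0" using nq by (simp add: E_def)
    ultimately have "2 * M = - (\<beta>^2) * (2*X-1)" using mult_left_cancel by blast
    then show ?thesis unfolding M_def[symmetric] by (simp add: field_simps)
  qed
qed

text \<open>Converse of the passage from Painleve VI to \<open>Y\<close>, with \<open>V\<close>
  given by the inversion formula for \<open>ti = T = 0\<close>. SD-Ia and the third-order equation
  eliminate \<open>Y''^2\<close> and \<open>Y'''\<close>, which leaves polynomial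
  identities.\<close>

lemma pvi_solution_if_sigma:
  assumes W: "open W" and Y: "Y holomorphic_on W"
    and n: "\<And>X. X \<in> W \<Longrightarrow> X \<noteq> 0 \<and> X \<noteq> 1 \<and> V X \<noteq> 0 \<and> V X \<noteq> 1 \<and> V X \<noteq> X \<and> deriv Y X \<noteq> 0"
    and V: "\<And>X. X \<in> W \<Longrightarrow> V X = X - (Y X + (t0^2-t1^2)/8) / deriv Y X"
    and R3: "\<And>X. X \<in> W \<Longrightarrow> 8 * (t0^2+t1^2) * (deriv Y X)^2 = 16*(X*(X-1) * deriv (deriv Y) X)^2 + 64 * deriv Y X*(X * deriv Y X - Y X)^2
           - 64*(deriv Y X)^2*(X * deriv Y X-Y X) - (t0^2-t1^2)^2 * deriv Y X"
    and R4: "\<And>X. X \<in> W \<Longrightarrow> 32 * X*(X-1)*((2*X-1) * deriv (deriv Y) X + X*(X-1) * deriv (deriv (deriv Y)) X) * deriv Y X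
      = 32*(X*(X-1) * deriv (deriv Y) X)^2 + (64*(Y X)^2-(t0^2-t1^2)^2) * deriv Y X - 64*X*(X-1)*(deriv Y X)^3"
  shows "pvi_solution 0 t0 t1 1 W V"
    and "X \<in> W \<Longrightarrow> X*(X-1) * H_VI 0 t0 t1 1 V X = Y X"
proof -
  note hol = Y holomorphic_deriv[OF Y W] holomorphic_deriv[OF holomorphic_deriv[OF Y W] W]
  note der = hol[THEN holomorphic_derivI[OF _ W]]
  define \<delta> where "\<delta> = (t0^2-t1^2)/8"
  have dV: "(V has_field_derivative (Y X + \<delta>) * deriv (deriv Y) X / (deriv Y X)^2) (at X)" if X: "X \<in> W" for X
  proof -
    have y: "deriv Y X \<noteq> 0" using n[OF X] by blast
    have "((\<lambda>X. X - (Y X + \<delta>) / deriv Y X) has_field_derivative (Y X + \<delta>) * deriv (deriv Y) X / (deriv Y X)^2) (at X)"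
      by (rule derivative_eq_intros der X y refl)+ (use y in \<open>simp add: field_simps power2_eq_square\<close>)
    then show ?thesis by (rule has_field_derivative_transform_within_open[OF _ W X]) (simp add: V \<delta>_def)
  qed
  have ddV: "(deriv V has_field_derivative deriv (deriv Y) X / deriv Y X + (Y X + \<delta>) * deriv (deriv (deriv Y)) X / (deriv Y X)^2
      - 2 * (Y X + \<delta>) * (deriv (deriv Y) X)^2 / (deriv Y X)^3) (at X)" if X: "X \<in> W" for X
  proof -
    have y: "deriv Y X \<noteq> 0" using n[OF X] by blast
    have "((\<lambda>X. (Y X + \<delta>) * deriv (deriv Y) X / (deriv Y X)^2) has_field_derivative
      deriv (deriv Y) X / deriv Y X + (Y X + \<delta>) * deriv (deriv (deriv Y)) X / (deriv Y X)^2
      - 2 * (Y X + \<delta>) * (deriv (deriv Y) X)^2 / (deriv Y X)^3) (at X)"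
      by (rule derivative_eq_intros der X refl)+ (use y in \<open>simp_all add: field_simps power2_eq_square power3_eq_cube\<close>)
    then show ?thesis by (rule has_field_derivative_transform_within_open[OF _ W X]) (simp add: DERIV_imp_deriv[OF dV])
  qed
  have Vh: "V holomorphic_on W" using dV W by (auto simp: holomorphic_on_open)
  have main: "deriv (deriv V) X = pvi_rhs 0 t0 t1 1 X (V X) (deriv V X) \<and> X*(X-1) * H_VI 0 t0 t1 1 V X = Y X" if X: "X \<in> W" for X
  proof -
    \<comment> \<open>In the coordinates \<open>q = V\<close>, \<open>y = Y'\<close> and
      \<open>z = X(X-1) Y''/Y'\<close>, SD-Ia becomes a formula for \<open>z^2\<close> and
      \<open>X(X-1) V'\<close> becomes \<open>(X - q) z\<close>.\<close>
    define q y z Y2 Y3 where "q = V X" and "y = deriv Y X" and "z = X*(X-1) * deriv (deriv Y) X / deriv Y X"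
      and "Y2 = deriv (deriv Y) X" and "Y3 = deriv (deriv (deriv Y)) X"
    have nq: "q \<noteq> 0" "q \<noteq> 1" "q \<noteq> X" "X \<noteq> 0" "X \<noteq> 1" and y: "y \<noteq> 0" using n[OF X] by (auto simp: q_def y_def)
    have D: "Y X + \<delta> = y * (X - q)" using V[OF X] y by (simp add: q_def y_def \<delta>_def field_simps)
    then have Y0: "8 * Y X = 8 * y * (X - q) - (t0^2 - t1^2)" unfolding \<delta>_def by (simp add: field_simps)
    have Z: "X*(X-1)*Y2 = y * z" using y by (simp add: z_def y_def Y2_def)
    have "16 * y^2 * z^2 = 16 * y^2 * (t0^2*(1-q) + t1^2*q + 4*y*q*(1-q))"
    proof -
      have "8 * (t0^2+t1^2) * y^2 = 16*(y*z)^2 + y*(8*X*y - 8 * Y X)^2 - 8*y^2*(8*X*y-8 * Y X) - (t0^2-t1^2)^2 * y"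
        using R3[OF X] unfolding y_def[symmetric] Y2_def[symmetric] Z by algebra
      then show ?thesis unfolding Y0 by algebra
    qed
    then have z2: "z^2 = t0^2*(1-q) + t1^2*q + 4*y*q*(1-q)" using y by simp
    \<comment> \<open>The value of \<open>2 X(X-1) (X(X-1) Y'')' / Y'\<close>, found by inserting
      the expressions for \<open>Y\<close> and \<open>z^2\<close> into the third-order
      equation.\<close>
    define \<rho>2 where "\<rho>2 = - 4*y*q^2 - q*(t0^2-t1^2) - 8*(X-1)*y*q - (X-1)*(t0^2-t1^2) + 4*X*y + t0^2 + t1^2"
    define G where "G = X*(X-1)*((2*X-1)*Y2 + X*(X-1)*Y3)"
    have "32 * y * (2 * G) = 32 * y * (y * \<rho>2)"
    proof -
      have "32 * G * y = 32*(y*z)^2 + ((8 * Y X)^2 - (t0^2-t1^2)^2) * y - 64*X*(X-1)*y^3"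
        using R4[OF X] unfolding y_def[symmetric] Y2_def[symmetric] Y3_def[symmetric] Z G_def by algebra
      then show ?thesis unfolding Y0 \<rho>2_def power_mult_distrib z2 by algebra
    qed
    then have G: "2 * G = y * \<rho>2" using y by simp
    have w: "X*(X-1) * deriv V X = (X - q) * z"
    proof -
      have "X*(X-1) * deriv V X = y * (X - q) * (X*(X-1)*Y2) / y^2"
        unfolding DERIV_imp_deriv[OF dV[OF X]] D by (simp add: y_def Y2_def)
      then show ?thesis unfolding Z using y by (simp add: power2_eq_square)
    qed
    have d: "2 * (X^2*(X-1)^2 * deriv (deriv V) X) = 2*X*(X-1)*z + (X-q)*(\<rho>2 - 2*(2*X-1)*z) - 4*(X-q)*z^2"
    proof -
      have "2 * (X^2*(X-1)^2 * deriv (deriv V) X) = 2 * X*(X-1)*(X*(X-1)*Y2)/y + (y*(X-q)) * (2*G - 2*(2*X-1)*(X*(X-1)*Y2)) / y^2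
         - 4 * (y*(X-q)) * (X*(X-1)*Y2)^2/y^3"
        unfolding DERIV_imp_deriv[OF ddV[OF X]] D y_def[symmetric] Y2_def[symmetric] Y3_def[symmetric] G_def
        using y by (simp add: divide_simps) algebra
      also have "\<dots> = 2*X*(X-1)*z + (X-q)*(\<rho>2 - 2*(2*X-1)*z) - 4*(X-q)*z^2"
        unfolding G Z using y by (simp add: divide_simps) algebra
      finally show ?thesis .
    qed
    define E where "E = 2*(2*(q*(q-1)*(q-X)))*(X^2*(X-1)^2)"
    have "E * deriv (deriv V) X = E * pvi_rhs 0 t0 t1 1 X q (deriv V X)"
    proof -
      have "E * pvi_rhs 0 t0 t1 1 X q (deriv V X) = 2 * (((q-1)*(q-X) + q*(q-X) + q*(q-1))*((X-q)*z)^2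
      - 2*((2*X-1)*(q-X)+X*(X-1))*q*(q-1)*((X-q)*z)
      + (- (t0^2*X*((q-1)*(q-X))^2) + t1^2*(X-1)*(q*(q-X))^2))"
        using pvi_rhs_cleared[OF nq, of 0 t0 t1 1 "deriv V X", unfolded zero_power2 power_one diff_self mult_zero_left add_0_right diff_0]
        unfolding w E_def by algebra
      moreover have "E * deriv (deriv V) X = 2*(q*(q-1)*(q-X)) * (2*X*(X-1)*z + (X-q)*(\<rho>2 - 2*(2*X-1)*z) - 4*(X-q)*z^2)"
        unfolding d[symmetric] E_def by algebra
      ultimately show ?thesis unfolding \<rho>2_def power_mult_distrib z2 by algebra
    qed
    moreover have "E \<noteq> 0" using nq by (simp add: E_def)
    ultimately have 1: "deriv (deriv V) X = pvi_rhs 0 t0 t1 1 X (V X) (deriv V X)" by (simp add: q_def)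
    define M where "M = X*(X-1) * H_VI 0 t0 t1 1 V X"
    have "8 * (q*(q-1)*(q-X)) * M = 2*((X - q)*z)^2 + (- (t0^2) * (2*X - q)*(q-1)*(q-X) + t1^2 * (2*(X-1) - (q-1))*q*(q-X))"
      using H_VI_cleared[of V X, OF nq[unfolded q_def] refl refl, of 0 t0 t1 1] unfolding w q_def[symmetric] M_def[symmetric] by simp
    also have "\<dots> = (q*(q-1)*(q-X)) * (8 * Y X)" unfolding Y0 power_mult_distrib z2 by algebra
    finally have "M = Y X" using nq by simp
    then show ?thesis using 1 by (simp add: M_def)
  qed
  then show "pvi_solution 0 t0 t1 1 W V" using Vh n by (simp add: pvi_solution_def)
  show "X \<in> W \<Longrightarrow> X*(X-1) * H_VI 0 t0 t1 1 V X = Y X" using main by blast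
qed

text \<open>The first integral and the Gauss equation in the variable \<open>X\<close>. Both are
  kept because the second follows from the first by differentiation only after division by
  \<open>Y''\<close>.\<close>

definition sigma_ode :: "complex \<Rightarrow> complex \<Rightarrow> complex \<Rightarrow> (complex \<Rightarrow> complex) \<Rightarrow> complex \<Rightarrow> bool" where
  "sigma_ode c cq K Y X \<longleftrightarrow> X \<noteq> 0 \<and> X \<noteq> 1 \<and> deriv Y X \<noteq> 0 \<and>
    4 * (deriv Y X)^2 * (K + 2*cq*c) = 16*(X*(X-1) * deriv (deriv Y) X)^2 + 64 * deriv Y X*(X * deriv Y X-Y X)^2
           - 64*(deriv Y X)^2*(X * deriv Y X-Y X) - (cq*c)^2 * deriv Y X \<and>
    32 * X*(X-1)*((2*X-1) * deriv (deriv Y) X + X*(X-1) * deriv (deriv (deriv Y)) X) * deriv Y X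
      = 32*(X*(X-1) * deriv (deriv Y) X)^2 + (64*(Y X)^2-(cq*c)^2) * deriv Y X - 64*X*(X-1)*(deriv Y X)^3"

text \<open>\<open>h\<close> regarded as a function of \<open>X\<close> near one point: since
  \<open>X_of\<close> is even, \<open>h\<close> need not be a function of \<open>X\<close> on all of
  \<open>D\<close>.\<close>

definition X_chart ::
  "complex set \<Rightarrow> complex \<Rightarrow> (complex \<Rightarrow> complex) \<Rightarrow> complex \<Rightarrow> real \<Rightarrow> (complex \<Rightarrow> complex) \<Rightarrow> bool" where
  "X_chart D cq h \<eta>0 r Y \<longleftrightarrow> r > 0 \<and> ball \<eta>0 r \<subseteq> D \<and> inj_on X_of (ball \<eta>0 r) \<and> X_of holomorphic_on ball \<eta>0 r \<and>
    open (X_of ` ball \<eta>0 r) \<and> Y holomorphic_on X_of ` ball \<eta>0 r \<and> (\<forall>s\<in>ball \<eta>0 r. h s = - 8 / cq * Y (X_of s))"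

lemma X_of_local_coordinate:
  assumes D: "open D" "0 \<notin> D" "1 \<notin> D" "-1 \<notin> D" and h: "h holomorphic_on D" and cq: "cq \<noteq> 0" and \<eta>0: "\<eta>0 \<in> D"
  shows "\<exists>r Y. X_chart D cq h \<eta>0 r Y"
proof -
  obtain r1 where r1: "r1 > 0" "ball \<eta>0 r1 \<subseteq> D" using D(1) \<eta>0 openE by blast
  \<comment> \<open>\<open>X_of\<close> identifies only \<open>s\<close> and \<open>- s\<close>; a
    ball of radius at most \<open>|eta0|\<close> around \<open>eta0\<close> contains no such
    pair.\<close>
  define r where "r = min r1 (norm \<eta>0)"
  define B where "B = ball \<eta>0 r"
  have \<eta>n: "\<eta>0 \<noteq> 0" using D(2) \<eta>0 by auto
  have r: "r > 0" using r1 \<eta>n by (simp add: r_def)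
  have BD: "B \<subseteq> D" using r1 by (auto simp: B_def r_def)
  have n: "1 - s^2 \<noteq> 0" if "s \<in> B" for s using X_of_facts(1)[of s] D BD that by auto
  have inj: "inj_on X_of B"
  proof (rule inj_onI)
    fix s t assume st: "s \<in> B" "t \<in> B" "X_of s = X_of t"
    then have "s^2 = t^2" using n[of s] n[of t] by (simp add: X_of_def field_simps)
    then have "s = t \<or> s = - t" by (simp add: power2_eq_iff)
    moreover have "s \<noteq> - t"
    proof
      assume "s = - t"
      then have "2 * norm \<eta>0 = norm ((\<eta>0 - s) + (\<eta>0 - t))" by (simp add: norm_mult flip: mult_2)
      also have "\<dots> \<le> norm (\<eta>0 - s) + norm (\<eta>0 - t)" by (rule norm_triangle_ineq)
      also have "\<dots> < 2 * norm \<eta>0" using st(1,2) by (auto simp: B_def r_def dist_norm)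
      finally show False by simp
    qed
    ultimately show "s = t" by blast
  qed
  have Xh: "X_of holomorphic_on B" unfolding X_of_def[abs_def] using n by (intro holomorphic_intros) auto
  have oB: "open B" by (simp add: B_def)
  have op: "open (X_of ` B)" by (rule open_mapping_thm3[OF Xh oB inj])
  obtain g where g: "g holomorphic_on X_of ` B" "\<And>z. z \<in> B \<Longrightarrow> g (X_of z) = z"
    using holomorphic_has_inverse[OF Xh oB inj] by metis
  have gB: "g ` X_of ` B \<subseteq> D" using g(2) BD by auto
  have "(\<lambda>X. - cq / 8 * (h \<circ> g) X) holomorphic_on X_of ` B"
    by (intro holomorphic_intros holomorphic_on_compose g holomorphic_on_subset[OF h] gB)
  moreover have "\<forall>s\<in>B. h s = - 8 / cq * (- cq / 8 * (h \<circ> g) (X_of s))" using g(2) cq by simp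
  ultimately show ?thesis using r BD inj Xh op unfolding B_def X_chart_def by blast
qed

lemma sigma_odeD:
  assumes "sigma_ode c cq K Y X"
  shows "4 * (deriv Y X)^2 * (K + 2*cq*c) = 16*(X*(X-1) * deriv (deriv Y) X)^2 + 64 * deriv Y X*(X * deriv Y X-Y X)^2
           - 64*(deriv Y X)^2*(X * deriv Y X-Y X) - (cq*c)^2 * deriv Y X"
    "32 * X*(X-1)*((2*X-1) * deriv (deriv Y) X + X*(X-1) * deriv (deriv (deriv Y)) X) * deriv Y X
      = 32*(X*(X-1) * deriv (deriv Y) X)^2 + (64*(Y X)^2-(cq*c)^2) * deriv Y X - 64*X*(X-1)*(deriv Y X)^3"
  using assms unfolding sigma_ode_def by blast+

lemma SD_Ia_of_first_integral:
  assumes "sigma_ode c cq K Y X"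
  shows "SD_Ia ((K + 2 * cq * c) / 4) 0 (- K * (K + 4 * cq * c) / 64) 0 Y X"
proof -
  have R3: "4 * (deriv Y X)^2 * (K + 2*cq*c) = 16*(X*(X-1) * deriv (deriv Y) X)^2 + 64 * deriv Y X*(X * deriv Y X-Y X)^2
           - 64*(deriv Y X)^2*(X * deriv Y X-Y X) - (cq*c)^2 * deriv Y X" using assms by (simp add: sigma_ode_def)
  define L y Z where "L = X * deriv Y X - Y X" and "y = deriv Y X" and "Z = X*(X-1) * deriv (deriv Y) X"
  \<comment> \<open>The coefficient of \<open>Y'\<close> in SD-Ia: the terms in \<open>K\<close>
    cancel, and the \<open>(cq c)^2\<close> of the first integral remains.\<close>
  have a: "- K * (K + 4 * cq * c) / 64 + ((K + 2 * cq * c) / 4)^2 / 4 = (cq*c)^2/16"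
    by (simp add: power2_eq_square field_simps)
  have "16 * (- (Z^2) - 4 * y * L^2 + 4 * y^2 * L + (K + 2 * cq * c) / 4 * y^2 + (cq*c)^2/16 * y)
    = 4 * y^2 * (K + 2*cq*c) - (16*Z^2 + 64 * y * L^2 - 64 * y^2 * L - (cq*c)^2 * y)"
    by (simp add: field_simps)
  also have "\<dots> = 0" using R3 unfolding L_def y_def Z_def by simp
  finally have "- (Z^2) - 4 * y * L^2 + 4 * y^2 * L + (K + 2 * cq * c) / 4 * y^2 + (cq*c)^2/16 * y = 0"
    unfolding mult_eq_0_iff by - (erule disjE, simp, assumption)
  then show ?thesis unfolding SD_Ia_def Let_def a unfolding L_def y_def Z_def by simp
qed

lemma deriv_eq_0_if_const:
  assumes "open M" "X \<in> M" "\<And>x. x \<in> M \<Longrightarrow> f x = (k::complex)"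
  shows "deriv f X = 0"
  using has_field_derivative_transform_within_open[OF DERIV_const[of k] assms(1,2)] assms(3) by (intro DERIV_imp_deriv) auto

text \<open>The centre is removed for \<open>V\<close> because \<open>V\<close> may equal 0, 1 or
  \<open>X\<close> there, where Painleve VI and \<open>H_VI\<close> are singular. The function
  \<open>Y\<close> extends across the centre, so SD-Ia is stated on the whole neighbourhood.\<close>

definition pvi_local_parametrization ::
  "complex \<Rightarrow> complex set \<Rightarrow> complex \<Rightarrow> complex \<Rightarrow> (complex \<Rightarrow> complex) \<Rightarrow> complex \<Rightarrow> complex \<Rightarrow> complex \<Rightarrow> complex \<Rightarrow> complex \<Rightarrow> bool" where
  "pvi_local_parametrization c D cq K h ti t0 t1 tX \<eta>0 \<longleftrightarrow>
    (\<exists>N V Y. open N \<and> connected N \<and> \<eta>0 \<in> N \<and> N \<subseteq> D \<and> inj_on X_of N \<and>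
             V meromorphic_on X_of ` N \<and>
             pvi_solution ti t0 t1 tX (X_of ` (N - {\<eta>0})) V \<and>
             (\<forall>\<eta>\<in>N - {\<eta>0}. h \<eta> = - 8 / cq * (X_of \<eta> * (X_of \<eta> - 1) * H_VI ti t0 t1 tX V (X_of \<eta>))) \<and>
             Y holomorphic_on X_of ` N \<and>
             (\<forall>X\<in>X_of ` (N - {\<eta>0}). Y X = X * (X - 1) * H_VI ti t0 t1 tX V X) \<and>
             (\<forall>X\<in>X_of ` N. SD_Ia ((K + 2 * cq * c) / 4) 0 (- K * (K + 4 * cq * c) / 64) 0 Y X))"

lemma pvi_local_parametrizationI:
  assumes chart: "X_chart D cq h \<eta>0 r Y" and ode: "\<And>X. X \<in> X_of ` ball \<eta>0 r \<Longrightarrow> sigma_ode c cq K Y X"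
    and r': "r' > 0" "r' \<le> r" and V: "V holomorphic_on X_of ` ball \<eta>0 r'"
    and sol: "pvi_solution ti t0 t1 tX (X_of ` (ball \<eta>0 r' - {\<eta>0})) V"
    and H: "\<And>X. X \<in> X_of ` (ball \<eta>0 r' - {\<eta>0}) \<Longrightarrow> X*(X-1) * H_VI ti t0 t1 tX V X = Y X"
  shows "pvi_local_parametrization c D cq K h ti t0 t1 tX \<eta>0"
proof -
  have r: "r > 0" "ball \<eta>0 r \<subseteq> D" "inj_on X_of (ball \<eta>0 r)" "X_of holomorphic_on ball \<eta>0 r"
    and Y: "Y holomorphic_on X_of ` ball \<eta>0 r" "\<forall>s\<in>ball \<eta>0 r. h s = - 8 / cq * Y (X_of s)"
    using chart by (simp_all add: X_chart_def)
  have sub: "ball \<eta>0 r' \<subseteq> ball \<eta>0 r" using r' by auto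
  have "open (X_of ` ball \<eta>0 r')"
    using open_mapping_thm3[OF holomorphic_on_subset[OF r(4) sub] _ inj_on_subset[OF r(3) sub]] by simp
  then have "V meromorphic_on X_of ` ball \<eta>0 r'"
    using V by (intro analytic_on_imp_meromorphic_on) (simp add: analytic_on_open)
  moreover have "\<eta>0 \<in> ball \<eta>0 r'" "ball \<eta>0 r' \<subseteq> D" using r r' sub by auto
  moreover have "h s = - 8 / cq * (X_of s * (X_of s - 1) * H_VI ti t0 t1 tX V (X_of s))" if "s \<in> ball \<eta>0 r' - {\<eta>0}" for s
    using Y(2) sub that H[of "X_of s"] by auto
  moreover have "\<forall>X\<in>X_of ` ball \<eta>0 r'. SD_Ia ((K + 2 * cq * c) / 4) 0 (- K * (K + 4 * cq * c) / 64) 0 Y X" using SD_Ia_of_first_integral[OF ode] sub by blast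
  moreover have "\<forall>X\<in>X_of ` (ball \<eta>0 r' - {\<eta>0}). Y X = X * (X - 1) * H_VI ti t0 t1 tX V X" using H by simp
  ultimately show ?thesis
    unfolding pvi_local_parametrization_def
    using sol inj_on_subset[OF r(3) sub] holomorphic_on_subset[OF Y(1) image_mono[OF sub]] open_ball connected_ball by blast
qed

section \<open>Local Painleve VI parametrisation: generic and affine \<open>h\<close>\<close>

lemma reduced_solution_local_sigma:
  assumes rs: "reduced_solution c D cq K v h q" and D: "open D" "0 \<notin> D" "1 \<notin> D" "-1 \<notin> D" and \<eta>0: "\<eta>0 \<in> D"
  shows "\<exists>r Y. X_chart D cq h \<eta>0 r Y \<and> (\<forall>X\<in>X_of ` ball \<eta>0 r. sigma_ode c cq K Y X) \<and>
    (\<forall>s\<in>ball \<eta>0 r. deriv h s = - 8 / cq * (deriv Y (X_of s) * (2* s/(1-s^2)^2)))"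
proof -
  have cq: "cq \<noteq> 0" and h: "h holomorphic_on D" and vq: "vq_form cq D v h q"
    and FI: "\<And>\<eta>. \<eta> \<in> D \<Longrightarrow> first_integral c v h q \<eta> = K" and g: "\<And>\<eta>. \<eta> \<in> D \<Longrightarrow> reduced_gauss c v h q \<eta>"
    using rs by (auto simp: reduced_solution_def reduced_system_def)
  obtain r Y where chart: "X_chart D cq h \<eta>0 r Y" using X_of_local_coordinate[OF D h cq \<eta>0] by blast
  then have r: "r > 0" "ball \<eta>0 r \<subseteq> D" "open (X_of ` ball \<eta>0 r)"
    and Y: "Y holomorphic_on X_of ` ball \<eta>0 r" "\<forall>s\<in>ball \<eta>0 r. h s = - 8 / cq * Y (X_of s)"
    by (simp_all add: X_chart_def)
  have D': "0 \<notin> ball \<eta>0 r" "1 \<notin> ball \<eta>0 r" "-1 \<notin> ball \<eta>0 r" using D(2-4) r(2) by blast+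
  have vq': "vq_form cq (ball \<eta>0 r) v h q" using vq r(2) by (auto simp: vq_form_def)
  note R = reduction_in_X[OF open_ball D' cq r(3) order.refl Y vq']
  have "sigma_ode c cq K Y (X_of s)" if s: "s \<in> ball \<eta>0 r" for s
  proof -
    have s0: "s \<noteq> 0" "s \<noteq> 1" "s \<noteq> - 1" using D' s by auto
    have FI': "first_integral c v h q s = K" and g': "reduced_gauss c v h q s"
      using FI g r(2) s by blast+
    show ?thesis unfolding sigma_ode_def
      using X_of_facts(2,3)[OF s0] R(2)[OF s] R(3)[OF s, of c, unfolded FI'] R(4)[OF s, of c] g' by blast
  qed
  then show ?thesis using chart R(1) by blast
qed

text \<open>The holomorphic \<open>V\<close> meets 0, 1 and \<open>X\<close> only at isolated
  points: \<open>V\<close> identically 0 or 1 would force \<open>Y'' = 0\<close>, and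
  \<open>V\<close> identically \<open>X\<close> would make \<open>Y\<close> constant although
  \<open>Y'\<close> has no zero.\<close>

lemma pvi_local_parametrization_nonaffine:
  assumes rs: "reduced_solution c D cq K v h q" and D: "open D" "connected D" "0 \<notin> D" "1 \<notin> D" "-1 \<notin> D" and \<eta>0: "\<eta>0 \<in> D"
    and na: "\<not> (\<exists>k. \<forall>\<eta>\<in>D. deriv h \<eta> * (1-\<eta>^2)^2 / \<eta> = k)"
    and t: "t0^2 = K/4 + cq*c" "t1^2 = K/4"
  shows "pvi_local_parametrization c D cq K h 0 t0 t1 1 \<eta>0"
proof -
  have h: "h holomorphic_on D" and cq: "cq \<noteq> 0" using rs by (auto simp: reduced_solution_def reduced_system_def)
  obtain r Y where chart: "X_chart D cq h \<eta>0 r Y" and ode: "\<And>X. X \<in> X_of ` ball \<eta>0 r \<Longrightarrow> sigma_ode c cq K Y X"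
    and dh: "\<And>s. s \<in> ball \<eta>0 r \<Longrightarrow> deriv h s = - 8 / cq * (deriv Y (X_of s) * (2 * s/(1-s^2)^2))"
    using reduced_solution_local_sigma[OF rs D(1,3-5) \<eta>0] by blast
  define B M where "B = ball \<eta>0 r" and "M = X_of ` B"
  have r: "r > 0" "B \<subseteq> D" "inj_on X_of B" "X_of holomorphic_on B" "open M" and Y: "Y holomorphic_on M"
    using chart by (simp_all add: X_chart_def B_def M_def)
  have \<eta>B: "\<eta>0 \<in> B" using r by (simp add: B_def)
  have B: "open B" "connected B" by (simp_all add: B_def)
  have s0: "s \<noteq> 0" "1 - s^2 \<noteq> 0" if "s \<in> B" for s using X_of_facts(1)[of s] D(3-5) r(2) that by auto
  have n: "X \<noteq> 0" "X \<noteq> 1" "deriv Y X \<noteq> 0" if "X \<in> M" for X using ode that by (auto simp: sigma_ode_def M_def B_def)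
  note hol = Y holomorphic_deriv[OF Y r(5)] holomorphic_deriv[OF holomorphic_deriv[OF Y r(5)] r(5)]
  note der = hol[THEN holomorphic_derivI[OF _ r(5)]]
  \<comment> \<open>The expression in \<open>na\<close> equals \<open>- 16/cq\<close> times
    \<open>Y'\<close>. Were \<open>Y'\<close> constant on this chart, analytic continuation would
    make the expression constant on all of \<open>D\<close>.\<close>
  have Y2: "\<exists>X\<in>M. deriv (deriv Y) X \<noteq> 0"
  proof (rule ccontr)
    assume "\<not> ?thesis"
    then have d0: "(deriv Y has_field_derivative 0) (at X)" if "X \<in> M" for X using der(2)[OF that] that by simp
    have con: "connected M" unfolding M_def
      by (intro connected_continuous_image holomorphic_on_imp_continuous_on r B)
    obtain k where k: "\<And>X. X \<in> M \<Longrightarrow> deriv Y X = k" using constant_if_DERIV_0[OF r(5) con d0] by blast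
    define k' where "k' = - 16 / cq * k"
    have loc: "deriv h s * (1-s^2)^2 / s - k' = 0" if s: "s \<in> B" for s
      using dh[of s] k[of "X_of s"] s0[OF s] s by (simp add: M_def B_def k'_def)
    have hol: "(\<lambda>s. deriv h s * (1-s^2)^2 / s - k') holomorphic_on D"
      using D by (intro holomorphic_intros h) auto
    have "deriv h s * (1-s^2)^2 / s - k' = 0" if "s \<in> D" for s
      by (rule analytic_continuation_open[OF B(1) D(1) _ D(2) r(2) hol holomorphic_on_const _ that]) (use \<eta>B loc in auto)
    then have "\<forall>s\<in>D. deriv h s * (1-s^2)^2 / s = k'" by simp
    then show False using na by blast
  qed
  define \<delta> where "\<delta> = (t0^2 - t1^2)/8"
  define V where "V X = X - (Y X + \<delta>) / deriv Y X" for X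
  have Vh: "V holomorphic_on M" unfolding V_def[abs_def] using n r(5) by (intro holomorphic_intros hol) auto
  have key: "\<forall>\<^sub>F s in at \<eta>0. V (X_of s) \<noteq> a (X_of s)"
    if a: "a holomorphic_on M" and ne: "\<not> (\<forall>X\<in>M. V X = a X)" for a
  proof -
    obtain s1 where s1: "s1 \<in> B" "V (X_of s1) \<noteq> a (X_of s1)" using ne by (auto simp: M_def)
    have "(\<lambda>s. (V \<circ> X_of) s - (a \<circ> X_of) s) holomorphic_on B"
      by (intro holomorphic_intros holomorphic_on_compose r(4)) (use Vh a in \<open>simp_all add: M_def\<close>)
    from non_zero_neighbour_alt[OF this B \<eta>B s1(1)] s1(2) show ?thesis by (auto elim: eventually_mono)
  qed
  have ne0: "\<not> (\<forall>X\<in>M. V X = k)" if k: "k = 0 \<or> k = 1" for k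
  proof
    assume all: "\<forall>X\<in>M. V X = k"
    obtain X where X: "X \<in> M" "deriv (deriv Y) X \<noteq> 0" using Y2 by blast
    have e: "(X - k) * deriv Y X - (Y X + \<delta>) = 0" if "X \<in> M" for X
      using all n(3)[OF that] that by (auto simp: V_def field_simps)
    have "((\<lambda>X. (X - k) * deriv Y X - (Y X + \<delta>)) has_field_derivative (X - k) * deriv (deriv Y) X) (at X)"
      by (rule derivative_eq_intros der X refl)+ (simp add: algebra_simps)
    moreover have "deriv (\<lambda>X. (X - k) * deriv Y X - (Y X + \<delta>)) X = 0" by (rule deriv_eq_0_if_const[OF r(5) X(1) e])
    ultimately have "(X - k) * deriv (deriv Y) X = 0" using DERIV_imp_deriv by fastforce
    then show False using k X n[OF X(1)] by auto
  qed
  have ne1: "\<not> (\<forall>X\<in>M. V X = X)"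
  proof
    assume "\<forall>X\<in>M. V X = X"
    then have e: "Y X = - \<delta>" if "X \<in> M" for X using n(3)[OF that] that by (auto simp: V_def add_eq_0_iff2)
    have X: "X_of \<eta>0 \<in> M" using \<eta>B by (simp add: M_def)
    have "deriv Y (X_of \<eta>0) = 0" by (rule deriv_eq_0_if_const[OF r(5) X e])
    then show False using n(3)[OF X] by simp
  qed
  have "\<forall>\<^sub>F s in at \<eta>0. V (X_of s) \<noteq> 0 \<and> V (X_of s) \<noteq> 1 \<and> V (X_of s) \<noteq> X_of s"
    by (intro eventually_conj key[of "\<lambda>_. 0"] key[of "\<lambda>_. 1"] key[of "\<lambda>X. X"] holomorphic_on_const holomorphic_on_ident ne1 ne0) auto
  then obtain r' where r': "r' > 0" "\<And>s. s \<noteq> \<eta>0 \<Longrightarrow> dist s \<eta>0 < r' \<Longrightarrow> V (X_of s) \<noteq> 0 \<and> V (X_of s) \<noteq> 1 \<and> V (X_of s) \<noteq> X_of s"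
    unfolding eventually_at by blast
  define \<rho> where "\<rho> = min r r'"
  define W where "W = X_of ` (ball \<eta>0 \<rho> - {\<eta>0})"
  have sub: "ball \<eta>0 \<rho> - {\<eta>0} \<subseteq> B" "ball \<eta>0 \<rho> \<subseteq> B" by (auto simp: \<rho>_def B_def)
  have WM: "W \<subseteq> M" using sub by (auto simp: W_def M_def)
  have W: "open W" unfolding W_def
    by (rule open_mapping_thm3[OF holomorphic_on_subset[OF r(4) sub(1)] _ inj_on_subset[OF r(3) sub(1)]]) (intro open_delete open_ball)
  have Vn: "V X \<noteq> 0 \<and> V X \<noteq> 1 \<and> V X \<noteq> X" if "X \<in> W" for X
    using that r'(2) by (auto simp: W_def \<rho>_def dist_commute)
  have n': "X \<noteq> 0 \<and> X \<noteq> 1 \<and> V X \<noteq> 0 \<and> V X \<noteq> 1 \<and> V X \<noteq> X \<and> deriv Y X \<noteq> 0" if "X \<in> W" for X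
    using Vn[OF that] n[of X] WM that by blast
  have ts: "8 * (t0^2 + t1^2) = 4 * (K + 2*cq*c)" "t0^2 - t1^2 = cq*c" unfolding t by (simp_all add: field_simps)
  have R: "8 * (t0^2+t1^2) * (deriv Y X)^2 = 16*(X*(X-1) * deriv (deriv Y) X)^2 + 64 * deriv Y X*(X * deriv Y X - Y X)^2
           - 64*(deriv Y X)^2*(X * deriv Y X-Y X) - (t0^2-t1^2)^2 * deriv Y X"
     "32 * X*(X-1)*((2*X-1) * deriv (deriv Y) X + X*(X-1) * deriv (deriv (deriv Y)) X) * deriv Y X
      = 32*(X*(X-1) * deriv (deriv Y) X)^2 + (64*(Y X)^2-(t0^2-t1^2)^2) * deriv Y X - 64*X*(X-1)*(deriv Y X)^3" if "X \<in> W" for X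
  proof -
    have o: "sigma_ode c cq K Y X" using ode[of X] that WM by (auto simp: M_def B_def)
    show "8 * (t0^2+t1^2) * (deriv Y X)^2 = 16*(X*(X-1) * deriv (deriv Y) X)^2 + 64 * deriv Y X*(X * deriv Y X - Y X)^2
           - 64*(deriv Y X)^2*(X * deriv Y X-Y X) - (t0^2-t1^2)^2 * deriv Y X"
      using sigma_odeD(1)[OF o] unfolding ts by algebra
    show "32 * X*(X-1)*((2*X-1) * deriv (deriv Y) X + X*(X-1) * deriv (deriv (deriv Y)) X) * deriv Y X
      = 32*(X*(X-1) * deriv (deriv Y) X)^2 + (64*(Y X)^2-(t0^2-t1^2)^2) * deriv Y X - 64*X*(X-1)*(deriv Y X)^3"
      using sigma_odeD(2)[OF o] unfolding ts .
  qed
  have V': "V X = X - (Y X + (t0^2-t1^2)/8) / deriv Y X" for X by (simp add: V_def \<delta>_def)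
  have YW: "Y holomorphic_on W" by (rule holomorphic_on_subset[OF Y WM])
  show ?thesis
  proof (rule pvi_local_parametrizationI[OF chart ode, of \<rho> V])
    show "0 < \<rho>" "\<rho> \<le> r" using r r' by (auto simp: \<rho>_def)
    show "V holomorphic_on X_of ` ball \<eta>0 \<rho>" by (rule holomorphic_on_subset[OF Vh]) (use sub in \<open>auto simp: M_def\<close>)
    show "pvi_solution 0 t0 t1 1 (X_of ` (ball \<eta>0 \<rho> - {\<eta>0})) V"
      unfolding W_def[symmetric] by (rule pvi_solution_if_sigma(1)[OF W YW n' V' R])
    show "X*(X-1) * H_VI 0 t0 t1 1 V X = Y X" if "X \<in> X_of ` (ball \<eta>0 \<rho> - {\<eta>0})" for X
      by (rule pvi_solution_if_sigma(2)[OF W YW n' V' R that[folded W_def]])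
  qed
qed

text \<open>With \<open>Y'' = 0\<close> the third-order equation becomes
  \<open>64 Y^2 - (cq c)^2 = 64 X(X-1) y^2\<close>. Differentiating it fixes the constant term of
  \<open>Y\<close>, inserting the result fixes \<open>(cq c)^2\<close>, and SD-Ia then fixes
  \<open>K\<close>.\<close>

lemma affine_sigma:
  assumes M: "open M" "X \<in> M" and Y: "Y holomorphic_on M" and y: "\<And>X. X \<in> M \<Longrightarrow> deriv Y X = y"
    and ode: "\<And>X. X \<in> M \<Longrightarrow> sigma_ode c cq K Y X"
  shows "K + 2*cq*c = - 8 * y" "(cq*c)^2 = 16*y^2" "Y X = y * (X - 1/2)"
proof -
  have y0: "y \<noteq> 0" using ode[OF M(2)] y[OF M(2)] by (simp add: sigma_ode_def)
  have Y2: "deriv (deriv Y) X = 0" if "X \<in> M" for X by (rule deriv_eq_0_if_const[OF M(1) that y])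
  have Y3: "deriv (deriv (deriv Y)) X = 0" if "X \<in> M" for X by (rule deriv_eq_0_if_const[OF M(1) that Y2])
  have E: "64*(Y X)^2-(cq*c)^2 - 64*X*(X-1)*y^2 = 0" if X: "X \<in> M" for X
  proof -
    have "y * (64*(Y X)^2-(cq*c)^2 - 64*X*(X-1)*y^2) = 0"
      using sigma_odeD(2)[OF ode[OF X], unfolded y[OF X] Y2[OF X] Y3[OF X] mult_zero_right add_0 zero_power2] by algebra
    then show ?thesis using y0 by simp
  qed
  have "((\<lambda>X. 64*(Y X)^2-(cq*c)^2 - 64*X*(X-1)*y^2) has_field_derivative 128 * Y X * y - 64 * (2*X-1)*y^2) (at X)"
    by (rule derivative_eq_intros holomorphic_derivI[OF Y M, unfolded y[OF M(2)]] refl)+ (simp add: algebra_simps)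
  moreover have "deriv (\<lambda>X. 64*(Y X)^2-(cq*c)^2 - 64*X*(X-1)*y^2) X = 0" by (rule deriv_eq_0_if_const[OF M E])
  ultimately have "128 * Y X * y - 64 * (2*X-1)*y^2 = 0" using DERIV_imp_deriv by fastforce
  then have "64 * y * (2 * Y X) = 64 * y * ((2*X - 1)*y)" by algebra
  then have Yy: "2 * Y X = (2*X-1)*y" using y0 by simp
  then show "Y X = y * (X - 1/2)" by (simp add: field_simps)
  show c2: "(cq*c)^2 = 16*y^2"
    using E[OF M(2)] Yy by algebra
  have "(4*y*y) * (K + 2*cq*c) = (4*y*y) * (- 8*y)"
    using sigma_odeD(1)[OF ode[OF M(2)], unfolded y[OF M(2)] Y2[OF M(2)] mult_zero_right add_0 zero_power2] Yy c2 by algebra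
  then show "K + 2*cq*c = - 8 * y" by (rule mult_left_cancel[of "4*y*y", THEN iffD1, rotated]) (use y0 in simp)
qed

lemma pvi_local_parametrization_affine:
  assumes rs: "reduced_solution c D cq K v h q" and D: "open D" "0 \<notin> D" "1 \<notin> D" "-1 \<notin> D" and \<eta>0: "\<eta>0 \<in> D"
    and k: "\<And>\<eta>. \<eta> \<in> D \<Longrightarrow> deriv h \<eta> * (1-\<eta>^2)^2 / \<eta> = k"
    and \<beta>: "\<beta>^2 = (K + 2*cq*c)/8"
  shows "pvi_local_parametrization c D cq K h \<beta> \<beta> \<beta> (1-\<beta>) \<eta>0" "(K + 2*cq*c)^2 = 4 * (cq*c)^2"
proof -
  have cq: "cq \<noteq> 0" using rs by (auto simp: reduced_solution_def)
  obtain r Y where chart: "X_chart D cq h \<eta>0 r Y" and ode: "\<And>X. X \<in> X_of ` ball \<eta>0 r \<Longrightarrow> sigma_ode c cq K Y X"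
    and dh: "\<And>s. s \<in> ball \<eta>0 r \<Longrightarrow> deriv h s = - 8 / cq * (deriv Y (X_of s) * (2 * s/(1-s^2)^2))"
    using reduced_solution_local_sigma[OF rs D \<eta>0] by blast
  define B M where "B = ball \<eta>0 r" and "M = X_of ` B"
  have r: "r > 0" "B \<subseteq> D" "inj_on X_of B" "X_of holomorphic_on B" "open M" and Y: "Y holomorphic_on M"
    using chart by (simp_all add: X_chart_def B_def M_def)
  have \<eta>B: "\<eta>0 \<in> B" using r by (simp add: B_def)
  have s0: "s \<noteq> 0" "1 - s^2 \<noteq> 0" if "s \<in> B" for s using X_of_facts(1)[of s] D(2-4) r(2) that by auto
  define y where "y = - cq * k / 16"
  have y: "deriv Y X = y" if X: "X \<in> M" for X
  proof -
    obtain s where s: "s \<in> B" "X = X_of s" using X by (auto simp: M_def)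
    have "k = - 16 / cq * deriv Y X" using k[of s] dh[of s] s0[OF s(1)] s r(2) by (auto simp: B_def)
    then show ?thesis using cq by (simp add: y_def)
  qed
  note A = affine_sigma[OF r(5) _ Y y ode[folded B_def, folded M_def]]
  have X0: "X_of \<eta>0 \<in> M" using \<eta>B by (simp add: M_def)
  have X0n: "X_of \<eta>0 \<noteq> 0" "X_of \<eta>0 \<noteq> 1" using ode[of "X_of \<eta>0"] r(1) by (auto simp: sigma_ode_def)
  show "(K + 2*cq*c)^2 = 4 * (cq*c)^2" using A(1,2)[OF X0] by algebra
  have \<beta>y: "\<beta>^2 = - y" using \<beta> A(1)[OF X0] by simp
  \<comment> \<open>Any initial value off the three singular ones will do, because all solutions of
    the Riccati equation have the same Hamiltonian function.\<close>
  obtain v0 where v0: "v0 \<notin> {0, 1, X_of \<eta>0}"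
    using ex_new_if_finite[OF infinite_UNIV_char_0, of "{0, 1, X_of \<eta>0}"] by blast
  obtain r1 V where r1: "r1 > 0" and V0: "V (X_of \<eta>0) = v0" and
    dV: "\<And>X. X \<in> ball (X_of \<eta>0) r1 \<Longrightarrow> (V has_field_derivative - \<beta> * ((V X)^2 - 2 * X * V X + X) / (X*(X-1))) (at X)"
    using riccati_local_solution[OF X0n, of v0 \<beta>] by blast
  have "continuous (at (X_of \<eta>0)) V" using dV[of "X_of \<eta>0"] r1 by (auto intro: DERIV_isCont)
  moreover have "continuous (at \<eta>0) X_of"
    using holomorphic_on_imp_continuous_on[OF r(4)] \<eta>B by (simp add: B_def continuous_on_eq_continuous_at)
  ultimately have ct: "continuous (at \<eta>0) (\<lambda>s. V (X_of s))" "continuous (at \<eta>0) (\<lambda>s. V (X_of s) - X_of s)"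
    using isCont_o2[of \<eta>0 X_of V] by (auto intro: continuous_intros)
  obtain e0 e1 e2 e3 where e: "e0 > 0" "e1 > 0" "e2 > 0" "e3 > 0"
    "\<And>s. dist \<eta>0 s < e0 \<Longrightarrow> V (X_of s) \<noteq> 0" "\<And>s. dist \<eta>0 s < e1 \<Longrightarrow> V (X_of s) \<noteq> 1"
    "\<And>s. dist \<eta>0 s < e2 \<Longrightarrow> V (X_of s) - X_of s \<noteq> 0" "\<And>s. dist s \<eta>0 < e3 \<Longrightarrow> dist (X_of s) (X_of \<eta>0) < r1"
    using continuous_at_avoid[OF ct(1), of 0] continuous_at_avoid[OF ct(1), of 1] continuous_at_avoid[OF ct(2), of 0]
      \<open>continuous (at \<eta>0) X_of\<close>[unfolded continuous_at_eps_delta] r1 v0 V0 by auto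
  define r' where "r' = min (min e0 e1) (min e2 e3)"
  have r': "r' > 0" "\<And>s. dist s \<eta>0 < r' \<Longrightarrow> V (X_of s) \<noteq> 0 \<and> V (X_of s) \<noteq> 1 \<and> V (X_of s) \<noteq> X_of s \<and> X_of s \<in> ball (X_of \<eta>0) r1"
    using e by (auto simp: r'_def dist_commute)
  define \<rho> where "\<rho> = min r r'"
  define W where "W = X_of ` ball \<eta>0 \<rho>"
  have sub: "ball \<eta>0 \<rho> \<subseteq> B" by (auto simp: \<rho>_def B_def)
  have WM: "W \<subseteq> M" using sub by (auto simp: W_def M_def)
  have W: "open W" unfolding W_def
    by (rule open_mapping_thm3[OF holomorphic_on_subset[OF r(4) sub] _ inj_on_subset[OF r(3) sub]]) (rule open_ball)
  have Wn: "X \<noteq> 0 \<and> X \<noteq> 1 \<and> V X \<noteq> 0 \<and> V X \<noteq> 1 \<and> V X \<noteq> X" and WdV: "(V has_field_derivative - \<beta> * ((V X)^2 - 2 * X * V X + X) / (X*(X-1))) (at X)" if X: "X \<in> W" for X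
  proof -
    obtain s where s: "X = X_of s" "dist s \<eta>0 < r'" using X by (auto simp: W_def \<rho>_def dist_commute)
    have "X \<noteq> 0 \<and> X \<noteq> 1" using ode[of X] X WM by (auto simp: M_def B_def sigma_ode_def)
    then show "X \<noteq> 0 \<and> X \<noteq> 1 \<and> V X \<noteq> 0 \<and> V X \<noteq> 1 \<and> V X \<noteq> X" using r'(2)[OF s(2)] s by auto
    show "(V has_field_derivative - \<beta> * ((V X)^2 - 2 * X * V X + X) / (X*(X-1))) (at X)" using dV[of X] r'(2)[OF s(2)] s by auto
  qed
  have P: "pvi_solution \<beta> \<beta> \<beta> (1-\<beta>) W V" by (rule pvi_solution_if_riccati(1)[OF W Wn WdV])
  have PH: "X*(X-1) * H_VI \<beta> \<beta> \<beta> (1-\<beta>) V X = - (\<beta>^2) * (X - 1/2)" if "X \<in> W" for X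
    by (rule pvi_solution_if_riccati(2)[OF W Wn WdV that])
  have Vh: "V holomorphic_on W" using WdV W by (auto simp: holomorphic_on_open)
  have sub': "X_of ` (ball \<eta>0 \<rho> - {\<eta>0}) \<subseteq> W" by (auto simp: W_def)
  show "pvi_local_parametrization c D cq K h \<beta> \<beta> \<beta> (1-\<beta>) \<eta>0"
  proof (rule pvi_local_parametrizationI[OF chart ode, of \<rho> V])
    show "0 < \<rho>" "\<rho> \<le> r" using r r' by (auto simp: \<rho>_def)
    show "V holomorphic_on X_of ` ball \<eta>0 \<rho>" using Vh by (simp add: W_def)
    show "pvi_solution \<beta> \<beta> \<beta> (1-\<beta>) (X_of ` (ball \<eta>0 \<rho> - {\<eta>0})) V"
      using P sub' holomorphic_on_subset[OF Vh sub'] by (auto simp: pvi_solution_def)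
    fix X assume "X \<in> X_of ` (ball \<eta>0 \<rho> - {\<eta>0})"
    then have X: "X \<in> W" using sub' by blast
    show "X*(X-1) * H_VI \<beta> \<beta> \<beta> (1-\<beta>) V X = Y X"
      using PH[OF X] A(3)[of X] WM X \<beta>y by auto
  qed
qed

lemma exists_pvi_parametrization:
  assumes rs: "reduced_solution c D cq K v h q" and D: "open D" "connected D" "D \<noteq> {}" "0 \<notin> D" "1 \<notin> D" "-1 \<notin> D"
  shows "\<exists>ti t0 t1 tX. bonnet_params c cq K ti t0 t1 tX \<and> (\<forall>\<eta>0\<in>D. pvi_local_parametrization c D cq K h ti t0 t1 tX \<eta>0)"
proof (cases "\<exists>k. \<forall>\<eta>\<in>D. deriv h \<eta> * (1-\<eta>^2)^2 / \<eta> = k")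
  case True
  then obtain k where k: "\<And>\<eta>. \<eta> \<in> D \<Longrightarrow> deriv h \<eta> * (1-\<eta>^2)^2 / \<eta> = k" by blast
  define \<beta> where "\<beta> = csqrt ((K + 2*cq*c)/8)"
  have \<beta>: "\<beta>^2 = (K + 2*cq*c)/8" by (simp add: \<beta>_def)
  obtain \<eta> where \<eta>: "\<eta> \<in> D" using D(3) by blast
  have A: "pvi_local_parametrization c D cq K h \<beta> \<beta> \<beta> (1-\<beta>) \<eta>0" "(K + 2*cq*c)^2 = 4 * (cq*c)^2" if "\<eta>0 \<in> D" for \<eta>0
    using pvi_local_parametrization_affine[OF rs D(1,4-6) that _ \<beta>] k by blast+
  \<comment> \<open>This is what makes equal parameters admissible: for them \<open>A3\<close> is
    zero.\<close>
  have "K * (K + 4*cq*c) = 0" using A(2)[OF \<eta>] by algebra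
  then have "bonnet_params c cq K \<beta> \<beta> \<beta> (1-\<beta>)"
    unfolding bonnet_params_def A0_def A2_def A3_def A4_def using \<beta> by (simp add: field_simps)
  then show ?thesis using A(1) by blast
next
  case False
  define t0 t1 where "t0 = csqrt (K/4 + cq*c)" and "t1 = csqrt (K/4)"
  have t: "t0^2 = K/4 + cq*c" "t1^2 = K/4" by (simp_all add: t0_def t1_def)
  have "bonnet_params c cq K 0 t0 t1 1"
    unfolding bonnet_params_def A0_def A2_def A3_def A4_def t by (simp add: field_simps)
  then show ?thesis using pvi_local_parametrization_nonaffine[OF rs D(1,2,4-6) _ False t] by blast
qed

section \<open>The Gauss-Codazzi system of the reduction\<close>

lemma open_slices:
  fixes G :: "(complex \<times> complex) set"
  assumes "open G"
  shows "open {s. (s, zb) \<in> G}" "open {s. (z, s) \<in> G}"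
proof -
  have "open ((\<lambda>s. (s, zb)) -` G)" "open ((\<lambda>s. (z, s)) -` G)"
    by (intro open_vimage assms continuous_intros)+
  then show "open {s. (s, zb) \<in> G}" "open {s. (z, s) \<in> G}" by (simp_all add: vimage_def)
qed

lemma holomorphic2_onI:
  assumes "\<And>z zb. (z, zb) \<in> G \<Longrightarrow> isCont (\<lambda>p. f (fst p) (snd p)) (z, zb)"
    "\<And>z zb. (z, zb) \<in> G \<Longrightarrow> (\<lambda>s. f s zb) field_differentiable at z"
    "\<And>z zb. (z, zb) \<in> G \<Longrightarrow> (\<lambda>s. f z s) field_differentiable at zb"
  shows "holomorphic2_on G f"
  unfolding holomorphic2_on_def using assms
  by (auto simp: case_prod_unfold intro!: continuous_at_imp_continuous_on)

lemma holomorphic2_onD: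
  assumes "holomorphic2_on G f" "open G" "(z, zb) \<in> G"
  shows "isCont (\<lambda>p. f (fst p) (snd p)) (z, zb)" "(\<lambda>s. f s zb) field_differentiable at z" "(\<lambda>s. f z s) field_differentiable at zb"
  using assms by (auto simp: holomorphic2_on_def case_prod_unfold continuous_on_eq_continuous_at)

lemma holomorphic2_on_fst:
  assumes "\<And>z zb. (z, zb) \<in> G \<Longrightarrow> a field_differentiable at z"
  shows "holomorphic2_on G (\<lambda>z zb. a z)"
proof (rule holomorphic2_onI)
  fix z zb assume z: "(z, zb) \<in> G"
  show "isCont (\<lambda>p. a (fst p)) (z, zb)"
    using field_differentiable_imp_continuous_at[OF assms[OF z]] by (intro isCont_o2[where g = a and f = fst]) (auto intro: continuous_intros)
qed (use assms in auto)

lemma holomorphic2_on_snd: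
  assumes "\<And>z zb. (z, zb) \<in> G \<Longrightarrow> a field_differentiable at zb"
  shows "holomorphic2_on G (\<lambda>z zb. a zb)"
proof (rule holomorphic2_onI)
  fix z zb assume z: "(z, zb) \<in> G"
  show "isCont (\<lambda>p. a (snd p)) (z, zb)"
    using field_differentiable_imp_continuous_at[OF assms[OF z]] by (intro isCont_o2[where g = a and f = snd]) (auto intro: continuous_intros)
qed (use assms in auto)

lemma holomorphic2_on_mult:
  assumes "open G" "holomorphic2_on G f" "holomorphic2_on G g"
  shows "holomorphic2_on G (\<lambda>z zb. f z zb * g z zb)"
  using assms by (intro holomorphic2_onI) (auto intro!: continuous_intros field_differentiable_mult dest: holomorphic2_onD)

lemma holomorphic2_on_add:
  assumes "open G" "holomorphic2_on G f" "holomorphic2_on G g"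
  shows "holomorphic2_on G (\<lambda>z zb. f z zb + g z zb)"
  using assms by (intro holomorphic2_onI) (auto intro!: continuous_intros field_differentiable_add dest: holomorphic2_onD)

lemma holomorphic2_on_divide:
  assumes "open G" "holomorphic2_on G f" "holomorphic2_on G g" "\<And>z zb. (z, zb) \<in> G \<Longrightarrow> g z zb \<noteq> 0"
  shows "holomorphic2_on G (\<lambda>z zb. f z zb / g z zb)"
  using assms by (intro holomorphic2_onI) (auto intro!: continuous_intros field_differentiable_divide dest: holomorphic2_onD)

lemma holomorphic2_on_const: "holomorphic2_on G (\<lambda>z zb. k)"
  by (rule holomorphic2_onI) auto

lemma holomorphic2_on_compose:
  assumes G: "open G" and F: "holomorphic2_on G F" and f: "f holomorphic_on D" "open D"
    and FD: "\<And>z zb. (z, zb) \<in> G \<Longrightarrow> F z zb \<in> D"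
  shows "holomorphic2_on G (\<lambda>z zb. f (F z zb))"
proof (rule holomorphic2_onI)
  fix z zb assume z: "(z, zb) \<in> G"
  have fd: "f field_differentiable at (F z zb)" using holomorphic_on_imp_differentiable_at[OF f FD[OF z]] .
  note FF = holomorphic2_onD[OF F G z]
  show "isCont (\<lambda>p. f (F (fst p) (snd p))) (z, zb)"
    using isCont_o2[OF FF(1), of f] field_differentiable_imp_continuous_at[OF fd] by simp
  show "(\<lambda>s. f (F s zb)) field_differentiable at z" "(\<lambda>s. f (F z s)) field_differentiable at zb"
    using field_differentiable_compose[OF FF(2), of f] field_differentiable_compose[OF FF(3), of f] fd by (simp_all add: o_def)
qed

lemma holomorphic2_on_cong:
  assumes G: "open G" and f: "holomorphic2_on G f" and eq: "\<And>z zb. (z, zb) \<in> G \<Longrightarrow> g z zb = f z zb"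
  shows "holomorphic2_on G g"
proof -
  have "continuous_on G (\<lambda>(z, zb). g z zb) = continuous_on G (\<lambda>(z, zb). f z zb)"
    by (rule continuous_on_cong) (auto simp: eq)
  moreover have "(\<lambda>s. g s zb) field_differentiable at z" "(\<lambda>s. g z s) field_differentiable at zb" if z: "(z, zb) \<in> G" for z zb
  proof -
    obtain d e where d: "((\<lambda>s. f s zb) has_field_derivative d) (at z)" "((\<lambda>s. f z s) has_field_derivative e) (at zb)"
      using holomorphic2_onD(2,3)[OF f G z] unfolding field_differentiable_def by blast
    have "((\<lambda>s. g s zb) has_field_derivative d) (at z)"
      by (rule has_field_derivative_transform_within_open[OF d(1) open_slices(1)[OF G]]) (use z eq in auto)
    moreover have "((\<lambda>s. g z s) has_field_derivative e) (at zb)"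
      by (rule has_field_derivative_transform_within_open[OF d(2) open_slices(2)[OF G]]) (use z eq in auto)
    ultimately show "(\<lambda>s. g s zb) field_differentiable at z" "(\<lambda>s. g z s) field_differentiable at zb"
      unfolding field_differentiable_def by blast+
  qed
  ultimately show ?thesis using f unfolding holomorphic2_on_def by auto
qed

lemma D1_eqI: "((\<lambda>s. f s zb) has_field_derivative d) (at z) \<Longrightarrow> D1 f z zb = d"
  by (simp add: D1_def DERIV_imp_deriv)

lemma D2_eqI: "((\<lambda>s. f z s) has_field_derivative d) (at zb) \<Longrightarrow> D2 f z zb = d"
  by (simp add: D2_def DERIV_imp_deriv)

lemma D2_eqI_cong:
  assumes "open G" "(z, zb) \<in> G" "\<And>z zb. (z, zb) \<in> G \<Longrightarrow> f z zb = g z zb" "((\<lambda>s. g z s) has_field_derivative d) (at zb)"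
  shows "D2 f z zb = d"
  by (rule D2_eqI, rule has_field_derivative_transform_within_open[OF assms(4) open_slices(2)[OF assms(1)]]) (use assms in auto)

text \<open>\<open>u\<close> is known only through \<open>exp u = E\<close>. Whatever the branch,
  its first derivative is the logarithmic derivative \<open>M\<close> of \<open>E\<close>, so the
  mixed derivative can be computed from \<open>M\<close>.\<close>

lemma D2_D1_logarithm:
  assumes G: "open G" and u: "holomorphic2_on G u" and E: "\<And>z zb. (z, zb) \<in> G \<Longrightarrow> exp (u z zb) = E z zb"
    and M: "\<And>z zb. (z, zb) \<in> G \<Longrightarrow> ((\<lambda>s. E s zb) has_field_derivative E z zb * M z zb) (at z)"
    and z: "(z, zb) \<in> G" and m: "((\<lambda>s. M z s) has_field_derivative m) (at zb)"
  shows "D2 (D1 u) z zb = m"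
proof (rule D2_eqI_cong[where g = M, OF G z _ m])
  fix z zb assume z: "(z, zb) \<in> G"
  obtain d where d: "((\<lambda>s. u s zb) has_field_derivative d) (at z)"
    using holomorphic2_onD(2)[OF u G z] unfolding field_differentiable_def by blast
  have "((\<lambda>s. exp (u s zb)) has_field_derivative exp (u z zb) * d) (at z)"
    by (rule derivative_eq_intros d refl)+
  moreover have "((\<lambda>s. exp (u s zb)) has_field_derivative E z zb * M z zb) (at z)"
    by (rule has_field_derivative_transform_within_open[OF M[OF z] open_slices(1)[OF G]]) (use z E in auto)
  ultimately have "exp (u z zb) * d = E z zb * M z zb" by (rule DERIV_unique)
  then have "d = M z zb" unfolding E[OF z, symmetric] by simp
  then show "D1 u z zb = M z zb" by (simp add: D1_def DERIV_imp_deriv[OF d])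
qed

lemma reduction_facts:
  assumes rd: "reduction_domain g1 g2 D G" and z: "(z, zb) \<in> G"
  shows "g1 z \<noteq> 0" "g2 zb \<noteq> 0" "deriv g1 z \<noteq> 0" "deriv g2 zb \<noteq> 0" "g1 z / g2 zb \<in> D"
    "(g1 has_field_derivative deriv g1 z) (at z)" "(g2 has_field_derivative deriv g2 zb) (at zb)"
    "(deriv g1 has_field_derivative deriv (deriv g1) z) (at z)" "deriv g2 field_differentiable at zb"
    "((\<lambda>s. g1 s / g2 zb) has_field_derivative deriv g1 z / g2 zb) (at z)"
    "((\<lambda>s. g1 z / g2 s) has_field_derivative - (g1 z * deriv g2 zb / (g2 zb)^2)) (at zb)"
proof -
  have a: "g1 analytic_on {z}" "g2 analytic_on {zb}" using rd z by (auto simp: reduction_domain_def)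
  show n: "g1 z \<noteq> 0" "g2 zb \<noteq> 0" "deriv g1 z \<noteq> 0" "deriv g2 zb \<noteq> 0" "g1 z / g2 zb \<in> D"
    using rd z by (auto simp: reduction_domain_def)
  show d: "(g1 has_field_derivative deriv g1 z) (at z)" "(g2 has_field_derivative deriv g2 zb) (at zb)"
    "(deriv g1 has_field_derivative deriv (deriv g1) z) (at z)"
    using a analytic_deriv[OF a(1)] by (auto simp: DERIV_deriv_iff_field_differentiable intro: analytic_on_imp_differentiable_at)
  show "deriv g2 field_differentiable at zb" using analytic_deriv[OF a(2)] by (auto intro: analytic_on_imp_differentiable_at)
  show "((\<lambda>s. g1 s / g2 zb) has_field_derivative deriv g1 z / g2 zb) (at z)"
    by (rule DERIV_cdivide[OF d(1)])
  show "((\<lambda>s. g1 z / g2 s) has_field_derivative - (g1 z * deriv g2 zb / (g2 zb)^2)) (at zb)"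
    by (rule derivative_eq_intros d n refl)+ (simp add: power2_eq_square)
qed

lemma reduction_compose:
  assumes rd: "reduction_domain g1 g2 D G" and z: "(z, zb) \<in> G" and f: "f holomorphic_on D" "open D"
  shows "((\<lambda>s. f (g1 s / g2 zb)) has_field_derivative deriv f (g1 z / g2 zb) * (deriv g1 z / g2 zb)) (at z)"
    "((\<lambda>s. f (g1 z / g2 s)) has_field_derivative deriv f (g1 z / g2 zb) * - (g1 z * deriv g2 zb / (g2 zb)^2)) (at zb)"
  using DERIV_chain2[OF holomorphic_derivI[OF f reduction_facts(5)[OF rd z]] reduction_facts(10)[OF rd z]]
    DERIV_chain2[OF holomorphic_derivI[OF f reduction_facts(5)[OF rd z]] reduction_facts(11)[OF rd z]] by auto

lemma reduction_holomorphic2: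
  assumes rd: "reduction_domain g1 g2 D G" and f: "f holomorphic_on D" "open D"
  shows "holomorphic2_on G (red_H g1 g2 f)" "holomorphic2_on G (red_Q g1 g2 f)" "holomorphic2_on G (red_R g1 g2 f)"
proof -
  have G: "open G" using rd by (simp add: reduction_domain_def)
  note F = reduction_facts[OF rd]
  have fd: "g1 field_differentiable at z" "deriv g1 field_differentiable at z" "g2 field_differentiable at zb" if "(z, zb) \<in> G" for z zb
    using F(6,7,8)[OF that] by (auto simp: field_differentiable_def)
  have h1: "holomorphic2_on G (\<lambda>z zb. g1 z)" "holomorphic2_on G (\<lambda>z zb. deriv g1 z)" "holomorphic2_on G (\<lambda>z zb. g2 zb)"
    "holomorphic2_on G (\<lambda>z zb. deriv g2 zb)"
    by (rule holomorphic2_on_fst holomorphic2_on_snd, erule fd F(9))+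
  note I = holomorphic2_on_mult[OF G] holomorphic2_on_divide[OF G]
  show H: "holomorphic2_on G (red_H g1 g2 f)"
    unfolding red_H_def by (rule holomorphic2_on_compose[OF G _ f]) (use F in \<open>auto intro!: I h1\<close>)
  have "holomorphic2_on G (\<lambda>z zb. deriv g1 z * deriv g1 z / (g1 z * g1 z) * red_H g1 g2 f z zb)"
    "holomorphic2_on G (\<lambda>z zb. deriv g2 zb * deriv g2 zb / (g1 z * g1 z) * red_H g1 g2 f z zb)"
    by (intro I h1 H; use F in simp)+
  then show "holomorphic2_on G (red_Q g1 g2 f)" "holomorphic2_on G (red_R g1 g2 f)"
    unfolding red_Q_def red_R_def red_H_def power2_eq_square .
qed

lemma gauss_codazzi_reduction:
  assumes sys: "reduced_system c D v h q" and D: "open D" "0 \<notin> D" "1 \<notin> D" "-1 \<notin> D"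
    and rd: "reduction_domain g1 g2 D G"
    and u: "holomorphic2_on G u" "\<And>z zb. (z, zb) \<in> G \<Longrightarrow> exp (u z zb) = red_E g1 g2 v z zb"
  shows "gauss_codazzi c G u (red_H g1 g2 h) (red_Q g1 g2 q) (red_R g1 g2 q)"
proof -
  have hol: "v holomorphic_on D" "h holomorphic_on D" "q holomorphic_on D" and v0: "\<And>s. s \<in> D \<Longrightarrow> v s \<noteq> 0"
    using sys by (auto simp: reduced_system_def)
  have G: "open G" using rd by (simp add: reduction_domain_def)
  define L where "L = (\<lambda>s. s * deriv v s / v s)"
  have Lh: "L holomorphic_on D" unfolding L_def using D(1) v0 by (intro holomorphic_intros hol) auto
  \<comment> \<open>The logarithmic \<open>z\<close>-derivative of the metric coefficient;
    \<open>zb\<close> enters only through \<open>L\<close>, so the mixed derivative sees nothing of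
    \<open>g1''\<close>.\<close>
  define M where "M z zb = deriv (deriv g1) z / deriv g1 z - 2 * deriv g1 z / g1 z + deriv g1 z / g1 z * L (g1 z / g2 zb)" for z zb
  have M: "((\<lambda>s. red_E g1 g2 v s zb) has_field_derivative red_E g1 g2 v z zb * M z zb) (at z)" if z: "(z, zb) \<in> G" for z zb
  proof -
    note F = reduction_facts[OF rd z]
    define x y e where "x = g1 z" and "y = g2 zb" and "e = v (x / y)"
    have n: "x \<noteq> 0" "y \<noteq> 0" "e \<noteq> 0" "deriv g1 z \<noteq> 0" using F v0 by (auto simp: x_def y_def e_def)
    have "((\<lambda>s. deriv g1 s * deriv g2 zb / (g1 s)^2) has_field_derivative
       deriv (deriv g1) z * deriv g2 zb / x^2 - 2 * deriv g1 z * deriv g2 zb * deriv g1 z / x^3) (at z)"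
      by (rule derivative_eq_intros F(6,8) F(1) refl)+
         (use n in \<open>simp_all add: x_def[symmetric] field_simps power2_eq_square power3_eq_cube\<close>)
    from DERIV_mult[OF this reduction_compose(1)[OF rd z hol(1) D(1)]]
    have "((\<lambda>s. red_E g1 g2 v s zb) has_field_derivative
       (deriv (deriv g1) z * deriv g2 zb / x^2 - 2 * deriv g1 z * deriv g2 zb * deriv g1 z / x^3) * e
        + deriv g1 z * deriv g2 zb / x^2 * (deriv v (x/y) * (deriv g1 z / y))) (at z)"
      unfolding red_E_def by (simp add: x_def y_def e_def algebra_simps)
    also have "(deriv (deriv g1) z * deriv g2 zb / x^2 - 2 * deriv g1 z * deriv g2 zb * deriv g1 z / x^3) * e
        + deriv g1 z * deriv g2 zb / x^2 * (deriv v (x/y) * (deriv g1 z / y)) = red_E g1 g2 v z zb * M z zb"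
      unfolding red_E_def M_def L_def x_def[symmetric] y_def[symmetric] e_def[symmetric]
      using n by (simp add: field_simps power2_eq_square power3_eq_cube)
    finally show ?thesis .
  qed
  have main: "D2 (D1 u) z zb + 1/2 * ((red_H g1 g2 h z zb)^2 - c^2) * exp (u z zb)
          - 2 * red_Q g1 g2 q z zb * red_R g1 g2 q z zb * exp (- u z zb) = 0 \<and>
        D2 (red_Q g1 g2 q) z zb = 1/2 * D1 (red_H g1 g2 h) z zb * exp (u z zb) \<and>
        D1 (red_R g1 g2 q) z zb = 1/2 * D2 (red_H g1 g2 h) z zb * exp (u z zb)" if z: "(z, zb) \<in> G" for z zb
  proof -
    note F = reduction_facts[OF rd z]
    define x y x' y' where "x = g1 z" and "y = g2 zb" and "x' = deriv g1 z" and "y' = deriv g2 zb"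
    define s where "s = x / y"
    have n: "x \<noteq> 0" "y \<noteq> 0" "x' \<noteq> 0" "y' \<noteq> 0" and sD: "s \<in> D"
      using F by (auto simp: x_def y_def x'_def y'_def s_def)
    note S = reduced_system_facts[OF sys D sD]
    have xs: "x = s * y" using n by (simp add: s_def)
    have EE: "exp (u z zb) = x' * y' / x^2 * v s" using u(2)[OF z] by (simp add: red_E_def x_def y_def x'_def y'_def s_def)
    have QQ: "red_Q g1 g2 q z zb = x'^2 / x^2 * q s" "red_R g1 g2 q z zb = y'^2 / x^2 * q s" "red_H g1 g2 h z zb = h s"
      by (simp_all add: red_Q_def red_R_def red_H_def x_def y_def x'_def y'_def s_def)
    define L' where "L' = ((h s)^2 - c^2) / (2 * s^2) * v s - 2 * (q s)^2 / (s^2 * v s)"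
    have "deriv L s = L'" using DERIV_imp_deriv[OF S(9)] by (simp add: L_def L'_def)
    then have "((\<lambda>s. L (g1 z / g2 s)) has_field_derivative L' * - (x * y' / y^2)) (at zb)"
      using reduction_compose(2)[OF rd z Lh D(1)] by (simp add: x_def y_def y'_def s_def)
    from DERIV_add[OF DERIV_const[of "deriv (deriv g1) z / deriv g1 z - 2 * deriv g1 z / g1 z"] DERIV_cmult[OF this, of "x'/x"]]
    have "((\<lambda>s. M z s) has_field_derivative x' / x * (L' * - (x * y' / y^2))) (at zb)"
      unfolding M_def by (simp add: x_def x'_def)
    note m = this
    have DD: "D2 (D1 u) z zb = x' / x * (L' * - (x * y' / y^2))"
      by (rule D2_D1_logarithm[where M = M and E = "red_E g1 g2 v"]) (use G u M z m in auto)
    have H1: "D1 (red_H g1 g2 h) z zb = deriv h s * (x' / y)"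
      by (rule D1_eqI) (use reduction_compose(1)[OF rd z hol(2) D(1)] in \<open>simp add: red_H_def x_def y_def x'_def s_def\<close>)
    have H2: "D2 (red_H g1 g2 h) z zb = deriv h s * - (x * y' / y^2)"
      by (rule D2_eqI) (use reduction_compose(2)[OF rd z hol(2) D(1)] in \<open>simp add: red_H_def x_def y_def y'_def s_def\<close>)
    have Q2: "D2 (red_Q g1 g2 q) z zb = x'^2 / x^2 * (deriv q s * - (x * y' / y^2))"
      by (rule D2_eqI) (use DERIV_cmult[OF reduction_compose(2)[OF rd z hol(3) D(1)], of "x'^2/x^2"] in \<open>simp add: red_Q_def x_def y_def x'_def y'_def s_def\<close>)
    have "((\<lambda>s. (deriv g2 zb)^2 / (g1 s)^2) has_field_derivative - 2 * y'^2 * x' / x^3) (at z)"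
      by (rule derivative_eq_intros F(6) F(1) refl)+
         (use n in \<open>simp_all add: x_def[symmetric] x'_def[symmetric] y'_def[symmetric] field_simps power2_eq_square power3_eq_cube\<close>)
    from DERIV_mult[OF this reduction_compose(1)[OF rd z hol(3) D(1)]]
    have "((\<lambda>s. (deriv g2 zb)^2 / (g1 s)^2 * q (g1 s / g2 zb)) has_field_derivative
       - 2 * y'^2 * x' / x^3 * q s + y'^2 / x^2 * (deriv q s * (x' / y))) (at z)"
      by (simp add: x_def y_def x'_def y'_def s_def algebra_simps)
    then have R1: "D1 (red_R g1 g2 q) z zb = - 2 * y'^2 * x' / x^3 * q s + y'^2 / x^2 * (deriv q s * (x' / y))"
      by (intro D1_eqI) (simp add: red_R_def)
    have vh: "deriv h s = - 2 * s * deriv q s / v s" using S(7,4) by (simp add: field_simps)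
    have q2: "q s = s * (1 - s^2) * deriv q s / 2" using S(8) by simp
    show ?thesis
    proof (intro conjI)
      show "D2 (D1 u) z zb + 1/2 * ((red_H g1 g2 h z zb)^2 - c^2) * exp (u z zb)
          - 2 * red_Q g1 g2 q z zb * red_R g1 g2 q z zb * exp (- u z zb) = 0"
        unfolding DD QQ exp_minus EE L'_def unfolding xs using n S(4,5) by (simp add: divide_simps) (simp add: algebra_simps power2_eq_square)
      show "D2 (red_Q g1 g2 q) z zb = 1/2 * D1 (red_H g1 g2 h) z zb * exp (u z zb)"
        unfolding Q2 H1 EE vh unfolding xs using n S(4,5) by (simp add: divide_simps power2_eq_square)
      show "D1 (red_R g1 g2 q) z zb = 1/2 * D2 (red_H g1 g2 h) z zb * exp (u z zb)"
        unfolding R1 H2 EE vh q2 unfolding xs using n S(4,5) by (simp add: divide_simps) (simp add: algebra_simps power2_eq_square power3_eq_cube)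
    qed
  qed
  show ?thesis unfolding gauss_codazzi_def
    using u(1) reduction_holomorphic2[OF rd hol(2) D(1)] reduction_holomorphic2[OF rd hol(3) D(1)] main by auto
qed

text \<open>With the explicit \<open>q\<close> both quotients equal
  \<open>(g1^2 - g2^2) / cq\<close>, a function of \<open>z\<close> plus a function of
  \<open>zb\<close>, which the mixed derivative annihilates.\<close>

lemma inverse_Q_harmonic:
  assumes cq: "cq \<noteq> 0" and q: "\<And>s. s \<in> D \<Longrightarrow> q s = cq * s^2 / (s^2 - 1)" and D: "0 \<notin> D" "1 \<notin> D" "-1 \<notin> D"
    and rd: "reduction_domain g1 g2 D G"
  shows "\<And>z zb. (z, zb) \<in> G \<Longrightarrow> red_Q g1 g2 q z zb \<noteq> 0 \<and> red_R g1 g2 q z zb \<noteq> 0 \<and>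
           (deriv g1 z)^2 / red_Q g1 g2 q z zb = 1 / cq * ((g1 z)^2 - (g2 zb)^2) \<and>
           (deriv g2 zb)^2 / red_R g1 g2 q z zb = 1 / cq * ((g1 z)^2 - (g2 zb)^2)"
    "harmonic2_on G (\<lambda>z zb. (deriv g1 z)^2 / red_Q g1 g2 q z zb)"
    "harmonic2_on G (\<lambda>z zb. (deriv g2 zb)^2 / red_R g1 g2 q z zb)"
proof -
  have G: "open G" using rd by (simp add: reduction_domain_def)
  show eq: "red_Q g1 g2 q z zb \<noteq> 0 \<and> red_R g1 g2 q z zb \<noteq> 0 \<and>
           (deriv g1 z)^2 / red_Q g1 g2 q z zb = 1 / cq * ((g1 z)^2 - (g2 zb)^2) \<and>
           (deriv g2 zb)^2 / red_R g1 g2 q z zb = 1 / cq * ((g1 z)^2 - (g2 zb)^2)" if z: "(z, zb) \<in> G" for z zb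
  proof -
    note F = reduction_facts[OF rd z]
    define s where "s = g1 z / g2 zb"
    have sD: "s \<in> D" using F(5) by (simp add: s_def)
    have n: "s \<noteq> 0" "1 - s^2 \<noteq> 0" "s^2 - 1 \<noteq> 0" using X_of_facts(1)[of s] sD D by auto
    have xs: "g1 z = s * g2 zb" using F by (simp add: s_def)
    have qs: "q s = cq * s^2 / (s^2 - 1)" by (rule q[OF sD])
    show ?thesis unfolding red_Q_def red_R_def s_def[symmetric] qs unfolding xs
      using n F(2,3,4) cq by (auto simp: divide_simps) (auto simp: algebra_simps power2_eq_square)
  qed
  note F = reduction_facts[OF rd]
  have h: "harmonic2_on G (\<lambda>z zb. f z zb)" if f: "\<And>z zb. (z, zb) \<in> G \<Longrightarrow> f z zb = 1 / cq * ((g1 z)^2 - (g2 zb)^2)" for f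
  proof -
    have fd: "g1 field_differentiable at z" "(\<lambda>s. - (g2 s * g2 s)) field_differentiable at zb" if "(z, zb) \<in> G" for z zb
      using F(6,7)[OF that] by (auto simp: field_differentiable_def intro!: derivative_eq_intros)
    have "holomorphic2_on G (\<lambda>z zb. 1 / cq * (g1 z * g1 z + - (g2 zb * g2 zb)))"
      by (intro holomorphic2_on_mult holomorphic2_on_add G holomorphic2_on_const holomorphic2_on_fst holomorphic2_on_snd[where a = "\<lambda>s. - (g2 s * g2 s)"]; erule fd)
    then have "holomorphic2_on G f"
      by (rule holomorphic2_on_cong[OF G]) (simp add: f power2_eq_square)
    moreover have "D2 (D1 f) z zb = 0" if z: "(z, zb) \<in> G" for z zb
    proof (rule D2_eqI_cong[OF G z])
      show "D1 f z zb = 1 / cq * (2 * g1 z * deriv g1 z)" if z: "(z, zb) \<in> G" for z zb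
      proof (rule D1_eqI, rule has_field_derivative_transform_within_open[OF _ open_slices(1)[OF G, of zb]])
        show "((\<lambda>s. 1 / cq * ((g1 s)^2 - (g2 zb)^2)) has_field_derivative 1 / cq * (2 * g1 z * deriv g1 z)) (at z)"
          by (rule derivative_eq_intros F(6)[OF z] refl)+ simp
      qed (use z f in auto)
    qed auto
    ultimately show ?thesis unfolding harmonic2_on_def by auto
  qed
  show "harmonic2_on G (\<lambda>z zb. (deriv g1 z)^2 / red_Q g1 g2 q z zb)" "harmonic2_on G (\<lambda>z zb. (deriv g2 zb)^2 / red_R g1 g2 q z zb)"
    by (rule h, use eq in blast)+
qed

section \<open>The solution of Bonnet\<close>

lemma sinh_cosh_exp:
  fixes x e :: complex
  assumes "e = exp x"
  shows "sinh x = (e^2 - 1) / (2 * e)" "cosh x = (e^2 + 1) / (2 * e)" "e \<noteq> 0" "sinh x = 0 \<longleftrightarrow> e^2 = 1"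
proof -
  show e: "e \<noteq> 0" by (simp add: assms)
  have "exp (-x) = 1/e" by (simp add: assms exp_minus divide_inverse)
  then show s: "sinh x = (e^2 - 1) / (2 * e)" and "cosh x = (e^2 + 1) / (2 * e)"
    using e by (simp_all add: sinh_field_def cosh_field_def assms[symmetric] field_simps power2_eq_square)
  show "sinh x = 0 \<longleftrightarrow> e^2 = 1" unfolding s using e by simp
qed

text \<open>This ratio is the only part of Bonnet's \<open>Q\<close> that is not a function of
  \<open>xi\<close>. Under the opposite translations of \<open>w\<close> and \<open>wb\<close> the
  growing exponentials dominate and leave \<open>- exp (a + b)\<close>, again a function of
  \<open>xi\<close>: hence the reduced \<open>Q\<close> as a limit.\<close>

lemma sinh_ratio_limit:
  fixes a b :: complex
  shows "((\<lambda>t::real. sinh (b + 2 * of_real t) / sinh (a - 2 * of_real t)) \<longlongrightarrow> - exp (a + b)) at_top"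
proof -
  have e0: "((\<lambda>t::real. exp (- 4 * t)) \<longlongrightarrow> 0) at_top" by real_asymp
  have e1: "((\<lambda>t::real. of_real (exp (- 4 * t)) :: complex) \<longlongrightarrow> of_real 0) at_top" by (intro tendsto_of_real e0)
  \<comment> \<open>The common factor \<open>exp (2 t)\<close> is cancelled, which leaves only the
    decaying \<open>exp (- 4 t)\<close>. The equality also holds at a zero of the denominator, where
    both quotients are 0.\<close>
  have eq: "sinh (b + 2 * of_real t) / sinh (a - 2 * of_real t) =
     (exp b - exp (-b) * of_real (exp (- 4 * t))) / (exp a * of_real (exp (- 4 * t)) - exp (-a))" for t :: real
  proof -
    define E where "E = (exp (2 * of_real t) :: complex)"
    have E: "E \<noteq> 0" "exp (- (2 * of_real t)) = inverse E" by (simp_all add: E_def exp_minus)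
    have "of_real (exp (- 4 * t)) = exp (- (2 * of_real t + 2 * of_real t) :: complex)" by (simp flip: exp_of_real)
    then have E4: "of_real (exp (- 4 * t)) = inverse (E * E)" by (simp only: exp_minus exp_add E_def)
    have "sinh (b + 2 * of_real t) = E * (exp b - exp (-b) * inverse (E * E)) / 2"
      "sinh (a - 2 * of_real t) = E * (exp a * inverse (E * E) - exp (-a)) / 2"
      using E by (simp_all add: sinh_field_def exp_add exp_diff E_def[symmetric] field_simps exp_minus)
    note sE = this
    show ?thesis unfolding sE E4 using E(1) by simp
  qed
  have "((\<lambda>t::real. (exp b - exp (-b) * of_real (exp (- 4 * t))) / (exp a * of_real (exp (- 4 * t)) - exp (-a)))
     \<longlongrightarrow> (exp b - exp (-b) * of_real 0) / (exp a * of_real 0 - exp (-a))) at_top"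
    by (rule tendsto_divide tendsto_diff tendsto_mult tendsto_const e1)+ simp
  also have "(exp b - exp (-b) * of_real 0) / (exp a * of_real 0 - exp (-a)) = - exp (a + b)"
    by (simp add: exp_add exp_minus field_simps)
  finally show ?thesis unfolding eq .
qed

lemma sinh_ratio_limit':
  fixes a b :: complex
  shows "((\<lambda>t::real. sinh (a - 2 * of_real t) / sinh (b + 2 * of_real t)) \<longlongrightarrow> - exp (- (a + b))) at_top"
proof -
  have "((\<lambda>t::real. inverse (sinh (b + 2 * of_real t) / sinh (a - 2 * of_real t))) \<longlongrightarrow> inverse (- exp (a + b))) at_top"
    by (intro tendsto_inverse sinh_ratio_limit) simp
  moreover have "inverse (- exp (a + b)) = - exp (- (a + b))" by (simp only: inverse_minus_eq exp_minus)
  ultimately show ?thesis by (simp only: inverse_divide)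
qed

lemma bonnet_R_swap: "bonnet_R cz ch chq w wb = bonnet_Q cz ch chq wb w"
  by (simp add: bonnet_Q_def bonnet_R_def add.commute)

text \<open>The addition formula turns the numerator of the derivative into
  \<open>sinh (2 cz w)\<close>, which cancels against the denominator of \<open>Q\<close>. The
  result depends on \<open>xi\<close> alone, as it must if the mean curvature does.\<close>

lemma bonnet_Q_deriv:
  assumes "sinh (4 * cz * ((w + wb) / 2)) \<noteq> 0" "sinh (2 * cz * w) \<noteq> 0"
  shows "((\<lambda>s. bonnet_Q cz ch chq w s) has_field_derivative chq / ch * (4 * cz / sinh (4 * cz * ((w + wb) / 2)))^2) (at wb)"
proof -
  define A B where "A = 2 * cz * w" and "B = 2 * cz * wb"
  have AB: "4 * cz * ((w + wb) / 2) = A + B" by (simp add: A_def B_def field_simps)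
  have n: "sinh (A + B) \<noteq> 0" "sinh A \<noteq> 0" using assms unfolding AB A_def[symmetric] by blast+
  have sA: "cosh B * sinh (A + B) - sinh B * cosh (A + B) = sinh A" using sinh_diff[of "A + B" B] by (simp add: mult_ac)
  have "((\<lambda>s. sinh (2 * cz * s) / sinh (4 * cz * ((w + s) / 2))) has_field_derivative
      2 * cz * (cosh B * sinh (A + B) - sinh B * cosh (A + B)) / (sinh (A + B))^2) (at wb)"
    by (rule derivative_eq_intros refl assms)+ (simp_all only: AB B_def[symmetric], use n in \<open>simp_all add: field_simps power2_eq_square\<close>)
  from DERIV_cmult[OF this, of "2 * chq / ch * 4 * cz / sinh A"]
  have "((\<lambda>s. 2 * chq / ch * 4 * cz / sinh A * (sinh (2 * cz * s) / sinh (4 * cz * ((w + s) / 2)))) has_field_derivative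
      2 * chq / ch * 4 * cz / sinh A * (2 * cz * sinh A / (sinh (A + B))^2)) (at wb)"
    unfolding sA .
  also have "2 * chq / ch * 4 * cz / sinh A * (2 * cz * sinh A / (sinh (A + B))^2) = chq / ch * (4 * cz / sinh (A + B))^2"
    using n by (simp add: power2_eq_square)
  finally show ?thesis unfolding AB bonnet_Q_def A_def[symmetric] by (simp add: mult_ac)
qed

lemma bonnet_QR:
  assumes "sinh (2 * cz * w) \<noteq> 0" "sinh (2 * cz * wb) \<noteq> 0"
  shows "bonnet_Q cz ch chq w wb * bonnet_R cz ch chq w wb = (2 * chq / ch)^2 * (4 * cz / sinh (4 * cz * ((w + wb) / 2)))^2"
  using assms by (simp add: bonnet_Q_def bonnet_R_def power2_eq_square mult_ac)

lemma bonnet_holomorphic2: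
  assumes G: "open G" and n: "\<And>w wb. (w, wb) \<in> G \<Longrightarrow> sinh (4 * cz * ((w + wb) / 2)) \<noteq> 0 \<and> sinh (2 * cz * w) \<noteq> 0 \<and> sinh (2 * cz * wb) \<noteq> 0"
  shows "holomorphic2_on G (bonnet_Q cz ch chq)" "holomorphic2_on G (bonnet_R cz ch chq)"
proof -
  have fst: "holomorphic2_on G (\<lambda>w wb. w)" and snd: "holomorphic2_on G (\<lambda>w wb. wb)"
    by (rule holomorphic2_on_fst holomorphic2_on_snd, rule field_differentiable_ident)+
  note I = holomorphic2_on_mult[OF G] holomorphic2_on_divide[OF G] holomorphic2_on_add[OF G] holomorphic2_on_const fst snd
  have sinh: "holomorphic2_on G (\<lambda>w wb. sinh (F w wb))" if "holomorphic2_on G F" for F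
    by (rule holomorphic2_on_compose[OF G that, of sinh UNIV]) (use has_field_derivative_sinh[OF DERIV_ident] in \<open>auto simp: holomorphic_on_open\<close>)
  have "holomorphic2_on G (\<lambda>w wb. k * (4 * cz * sinh (2 * cz * wb) / (sinh (2 * cz * w) * sinh (4 * cz * ((w + wb) / 2)))))"
    "holomorphic2_on G (\<lambda>w wb. k * (4 * cz * sinh (2 * cz * w) / (sinh (2 * cz * wb) * sinh (4 * cz * ((w + wb) / 2)))))" for k
    by (intro I sinh; use n in simp)+
  then show "holomorphic2_on G (bonnet_Q cz ch chq)" "holomorphic2_on G (bonnet_R cz ch chq)"
    unfolding bonnet_Q_def[abs_def] bonnet_R_def[abs_def] .
qed

section \<open>The Gauss-Codazzi system for Bonnet's data, reduced to the variable
  \<open>xi\<close>\<close>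

lemma holomorphic2_on_mid:
  assumes G: "open G" and f: "f holomorphic_on \<Xi>" "open \<Xi>" and m: "\<And>w wb. (w, wb) \<in> G \<Longrightarrow> (w + wb) / 2 \<in> \<Xi>"
  shows "holomorphic2_on G (\<lambda>w wb. f ((w + wb) / 2))"
proof (rule holomorphic2_on_compose[OF G _ f m])
  have "holomorphic2_on G (\<lambda>w wb. (w + wb) * (1/2))"
    by (intro holomorphic2_on_mult holomorphic2_on_add G holomorphic2_on_const holomorphic2_on_fst holomorphic2_on_snd field_differentiable_ident)
  then show "holomorphic2_on G (\<lambda>w wb. (w + wb) / 2)" by simp
qed

lemma mid_derivs:
  assumes f: "f holomorphic_on \<Xi>" "open \<Xi>" and m: "(w + wb) / 2 \<in> \<Xi>"
  shows "((\<lambda>s. f ((s + wb) / 2)) has_field_derivative deriv f ((w + wb) / 2) / 2) (at w)"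
    "((\<lambda>s. f ((w + s) / 2)) has_field_derivative deriv f ((w + wb) / 2) / 2) (at wb)"
proof -
  have d: "((\<lambda>s. (s + wb) / 2) has_field_derivative 1/2) (at w)" "((\<lambda>s. (w + s) / 2) has_field_derivative 1/2) (at wb)"
    by (rule derivative_eq_intros refl | simp)+
  show "((\<lambda>s. f ((s + wb) / 2)) has_field_derivative deriv f ((w + wb) / 2) / 2) (at w)"
    "((\<lambda>s. f ((w + s) / 2)) has_field_derivative deriv f ((w + wb) / 2) / 2) (at wb)"
    using DERIV_chain2[OF holomorphic_derivI[OF f m] d(1)] DERIV_chain2[OF holomorphic_derivI[OF f m] d(2)] by simp_all
qed

text \<open>The Gauss equation of a solution in Bonnet's form, as an equation in the single variable \<open>\<xi>\<close>.\<close>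

definition bonnet_gauss :: "complex \<Rightarrow> complex \<Rightarrow> complex \<Rightarrow> complex \<Rightarrow> (complex \<Rightarrow> complex) \<Rightarrow> (complex \<Rightarrow> complex) \<Rightarrow> complex \<Rightarrow> bool" where
  "bonnet_gauss c cz ch chq vh hh \<xi> \<longleftrightarrow>
     deriv (\<lambda>\<xi>. deriv vh \<xi> / vh \<xi>) \<xi> + 8 * chq * ((hh \<xi>)^2 - c^2 / ch^2) * vh \<xi> - 8 * chq * (4 * cz / sinh (4 * cz * \<xi>))^2 / vh \<xi> = 0"

lemma gauss_equation_bonnet:
  assumes \<Xi>: "open \<Xi>" and hol: "vh holomorphic_on \<Xi>" and v0: "\<And>\<xi>. \<xi> \<in> \<Xi> \<Longrightarrow> vh \<xi> \<noteq> 0" and nz: "ch \<noteq> 0" "chq \<noteq> 0"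
    and G: "open G" and m: "\<And>w wb. (w, wb) \<in> G \<Longrightarrow> (w + wb) / 2 \<in> \<Xi> \<and> sinh (2 * cz * w) \<noteq> 0 \<and> sinh (2 * cz * wb) \<noteq> 0"
    and u: "holomorphic2_on G u" "\<And>w wb. (w, wb) \<in> G \<Longrightarrow> exp (u w wb) = 4 * (chq / ch^2) * vh ((w + wb) / 2)"
    and w: "(w, wb) \<in> G"
  shows "D2 (D1 u) w wb + 1/2 * ((ch * hh ((w + wb) / 2))^2 - c^2) * exp (u w wb)
          - 2 * bonnet_Q cz ch chq w wb * bonnet_R cz ch chq w wb * exp (- u w wb) = 0
    \<longleftrightarrow> bonnet_gauss c cz ch chq vh hh ((w + wb) / 2)"
proof -
  define L where "L = (\<lambda>\<xi>. deriv vh \<xi> / vh \<xi>)"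
  have Lh: "L holomorphic_on \<Xi>" unfolding L_def using v0 \<Xi> by (intro holomorphic_intros hol) auto
  define \<xi> where "\<xi> = (w + wb) / 2"
  have \<xi>: "\<xi> \<in> \<Xi>" using m[OF w] by (simp add: \<xi>_def)
  define k where "k = 4 * (chq / ch^2)"
  have k: "k \<noteq> 0" using nz by (simp add: k_def)
  have DD: "D2 (D1 u) w wb = deriv L \<xi> / 2 / 2"
  proof (rule D2_D1_logarithm[where M = "\<lambda>w wb. L ((w + wb) / 2) / 2" and E = "\<lambda>w wb. k * vh ((w + wb) / 2)", OF G u(1) _ _ w])
    show "exp (u z zb) = k * vh ((z + zb) / 2)" if "(z, zb) \<in> G" for z zb using u(2)[OF that] by (simp add: k_def)
    show "((\<lambda>s. k * vh ((s + zb) / 2)) has_field_derivative k * vh ((z + zb) / 2) * (L ((z + zb) / 2) / 2)) (at z)" if z: "(z, zb) \<in> G" for z zb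
    proof -
      have z': "(z + zb) / 2 \<in> \<Xi>" using m[OF z] by blast
      show ?thesis using DERIV_cmult[OF mid_derivs(1)[OF hol \<Xi> z'], of k] v0[OF z'] by (simp add: L_def)
    qed
    show "((\<lambda>s. L ((w + s) / 2) / 2) has_field_derivative deriv L \<xi> / 2 / 2) (at wb)"
      using DERIV_cdivide[OF mid_derivs(2)[OF Lh \<Xi> \<xi>[unfolded \<xi>_def]], of 2] by (simp add: \<xi>_def)
  qed
  define S where "S = (4 * cz / sinh (4 * cz * \<xi>))^2"
  have QR: "bonnet_Q cz ch chq w wb * bonnet_R cz ch chq w wb = (2 * chq / ch)^2 * S"
    using bonnet_QR[of cz w wb] m[OF w] by (simp add: S_def \<xi>_def)
  define Z where "Z = D2 (D1 u) w wb + 1/2 * ((ch * hh \<xi>)^2 - c^2) * exp (u w wb)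
          - 2 * (bonnet_Q cz ch chq w wb * bonnet_R cz ch chq w wb) * exp (- u w wb)"
  \<comment> \<open>The factor 4 undoes the two halves that \<open>xi = (w + wb)/2\<close>
    contributes to the mixed derivative.\<close>
  have "4 * Z = deriv L \<xi> + 8 * chq * ((hh \<xi>)^2 - c^2 / ch^2) * vh \<xi> - 8 * chq * S / vh \<xi>"
    unfolding Z_def DD QR exp_minus u(2)[OF w] \<xi>_def[symmetric] using nz v0[OF \<xi>] by (simp add: field_simps power2_eq_square)
  then have "Z = 0 \<longleftrightarrow> bonnet_gauss c cz ch chq vh hh \<xi>" unfolding bonnet_gauss_def L_def[symmetric] S_def[symmetric] by (metis mult_eq_0_iff zero_neq_numeral)
  then show ?thesis unfolding Z_def \<xi>_def by (simp only: mult.assoc)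
qed

lemma gauss_codazzi_bonnet:
  assumes \<Xi>: "open \<Xi>" and hol: "vh holomorphic_on \<Xi>" "hh holomorphic_on \<Xi>" and nz: "cz \<noteq> 0" "ch \<noteq> 0" "chq \<noteq> 0"
    and S: "\<And>\<xi>. \<xi> \<in> \<Xi> \<Longrightarrow> sinh (4 * cz * \<xi>) \<noteq> 0 \<and> vh \<xi> * deriv hh \<xi> = (4 * cz / sinh (4 * cz * \<xi>))^2 \<and> bonnet_gauss c cz ch chq vh hh \<xi>"
    and G: "open G" and m: "\<And>w wb. (w, wb) \<in> G \<Longrightarrow> (w + wb) / 2 \<in> \<Xi> \<and> sinh (2 * cz * w) \<noteq> 0 \<and> sinh (2 * cz * wb) \<noteq> 0"
    and u: "holomorphic2_on G u" "\<And>w wb. (w, wb) \<in> G \<Longrightarrow> exp (u w wb) = 4 * (chq / ch^2) * vh ((w + wb) / 2)"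
  shows "gauss_codazzi c G u (\<lambda>w wb. ch * hh ((w + wb) / 2)) (bonnet_Q cz ch chq) (bonnet_R cz ch chq)"
proof -
  have v0: "vh \<xi> \<noteq> 0" if "\<xi> \<in> \<Xi>" for \<xi> using S[OF that] nz(1) by auto
  have n: "sinh (4 * cz * ((w + wb) / 2)) \<noteq> 0 \<and> sinh (2 * cz * w) \<noteq> 0 \<and> sinh (2 * cz * wb) \<noteq> 0" if "(w, wb) \<in> G" for w wb
    using m[OF that] S[of "(w + wb) / 2"] by blast
  have "D2 (D1 u) w wb + 1/2 * ((ch * hh ((w + wb) / 2))^2 - c^2) * exp (u w wb)
          - 2 * bonnet_Q cz ch chq w wb * bonnet_R cz ch chq w wb * exp (- u w wb) = 0 \<and>
        D2 (bonnet_Q cz ch chq) w wb = 1/2 * D1 (\<lambda>w wb. ch * hh ((w + wb) / 2)) w wb * exp (u w wb) \<and>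
        D1 (bonnet_R cz ch chq) w wb = 1/2 * D2 (\<lambda>w wb. ch * hh ((w + wb) / 2)) w wb * exp (u w wb)" if w: "(w, wb) \<in> G" for w wb
  proof -
    define \<xi> where "\<xi> = (w + wb) / 2"
    have \<xi>: "\<xi> \<in> \<Xi>" using m[OF w] by (simp add: \<xi>_def)
    have H: "D1 (\<lambda>w wb. ch * hh ((w + wb) / 2)) w wb = ch * (deriv hh \<xi> / 2)" "D2 (\<lambda>w wb. ch * hh ((w + wb) / 2)) w wb = ch * (deriv hh \<xi> / 2)"
      unfolding \<xi>_def by (rule D1_eqI D2_eqI, rule DERIV_cmult, rule mid_derivs[OF hol(2) \<Xi> \<xi>[unfolded \<xi>_def]])+
    have Q: "D2 (bonnet_Q cz ch chq) w wb = chq / ch * (vh \<xi> * deriv hh \<xi>)"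
      using bonnet_Q_deriv[of cz w wb ch chq] n[OF w] S[OF \<xi>] by (simp add: D2_def DERIV_imp_deriv \<xi>_def)
    have R: "D1 (bonnet_R cz ch chq) w wb = chq / ch * (vh \<xi> * deriv hh \<xi>)"
      using bonnet_Q_deriv[of cz wb w ch chq] n[OF w] S[OF \<xi>] by (simp add: D1_def bonnet_R_swap DERIV_imp_deriv \<xi>_def add.commute)
    show ?thesis
    proof (intro conjI)
      show "D2 (D1 u) w wb + 1/2 * ((ch * hh ((w + wb) / 2))^2 - c^2) * exp (u w wb)
          - 2 * bonnet_Q cz ch chq w wb * bonnet_R cz ch chq w wb * exp (- u w wb) = 0"
        by (rule gauss_equation_bonnet[OF \<Xi> hol(1) v0 nz(2,3) G m u w, THEN iffD2]) (use S[OF \<xi>] in \<open>auto simp: \<xi>_def\<close>)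
    qed (use nz in \<open>simp_all add: H Q R u(2)[OF w] \<xi>_def[symmetric] power2_eq_square\<close>)
  qed
  moreover have "holomorphic2_on G (\<lambda>w wb. ch * hh ((w + wb) / 2))"
    using m by (intro holomorphic2_on_mult holomorphic2_on_const G holomorphic2_on_mid[OF G hol(2) \<Xi>]) auto
  ultimately show ?thesis unfolding gauss_codazzi_def using u(1) bonnet_holomorphic2[OF G n] by auto
qed

text \<open>Logarithmic derivative of \<open>vh hh' = S\<close>, where \<open>S\<close> contributes
  \<open>- 8 cz coth (4 cz xi)\<close>. Thus the squared bracket of Bonnet's first integral is the
  square of \<open>vh'/vh\<close>.\<close>

lemma bonnet_log_deriv:
  assumes \<Xi>: "open \<Xi>" and hol: "vh holomorphic_on \<Xi>" "hh holomorphic_on \<Xi>" and cz: "cz \<noteq> 0"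
    and S: "\<And>\<xi>. \<xi> \<in> \<Xi> \<Longrightarrow> sinh (4 * cz * \<xi>) \<noteq> 0 \<and> vh \<xi> * deriv hh \<xi> = (4 * cz / sinh (4 * cz * \<xi>))^2"
    and \<xi>: "\<xi> \<in> \<Xi>"
  shows "deriv (deriv hh) \<xi> / deriv hh \<xi> + 8 * cz * (cosh (4 * cz * \<xi>) / sinh (4 * cz * \<xi>)) = - (deriv vh \<xi> / vh \<xi>)"
proof -
  define s where "s = sinh (4 * cz * \<xi>)"
  define d where "d = cosh (4 * cz * \<xi>)"
  have n: "s \<noteq> 0" and eq: "vh \<xi> * deriv hh \<xi> = (4 * cz / s)^2" using S[OF \<xi>] by (auto simp: s_def)
  have n2: "vh \<xi> \<noteq> 0" "deriv hh \<xi> \<noteq> 0" using eq n cz by auto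
  have "((\<lambda>\<xi>. (4 * cz / sinh (4 * cz * \<xi>))^2) has_field_derivative - (8 * cz * (d / s)) * (4 * cz / s)^2) (at \<xi>)"
    by (rule derivative_eq_intros refl n[unfolded s_def])+ (simp only: s_def[symmetric] d_def[symmetric], use n in \<open>simp add: field_simps power2_eq_square power3_eq_cube\<close>)
  then have "((\<lambda>\<xi>. vh \<xi> * deriv hh \<xi>) has_field_derivative - (8 * cz * (d / s)) * (4 * cz / s)^2) (at \<xi>)"
    by (rule has_field_derivative_transform_within_open[OF _ \<Xi> \<xi>]) (use S in auto)
  moreover have "((\<lambda>\<xi>. vh \<xi> * deriv hh \<xi>) has_field_derivative deriv vh \<xi> * deriv hh \<xi> + deriv (deriv hh) \<xi> * vh \<xi>) (at \<xi>)"
    by (intro DERIV_mult holomorphic_derivI[OF _ \<Xi> \<xi>] hol holomorphic_deriv \<Xi>)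
  ultimately have "deriv vh \<xi> * deriv hh \<xi> + deriv (deriv hh) \<xi> * vh \<xi> = - (8 * cz * (d / s)) * (vh \<xi> * deriv hh \<xi>)"
    unfolding eq by (rule DERIV_unique[rotated])
  then have "(deriv (deriv hh) \<xi> / deriv hh \<xi> + 8 * cz * (d / s)) * (vh \<xi> * deriv hh \<xi>) = - (deriv vh \<xi> / vh \<xi>) * (vh \<xi> * deriv hh \<xi>)"
    using n2 by (simp add: distrib_right) algebra
  moreover have "vh \<xi> * deriv hh \<xi> \<noteq> 0" using n2 by simp
  ultimately have "deriv (deriv hh) \<xi> / deriv hh \<xi> + 8 * cz * (d / s) = - (deriv vh \<xi> / vh \<xi>)"
    using mult_right_cancel by blast
  then show ?thesis unfolding s_def d_def .
qed

text \<open>Under \<open>eta = exp (4 cz xi)\<close> the operator \<open>eta d/d eta\<close> becomes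
  \<open>d/d xi\<close> divided by \<open>4 cz\<close>. The factor between \<open>v\<close> and
  \<open>vh\<close> comes from equating the two metrics for \<open>g1 = exp (2 cz w)\<close>,
  \<open>g2 = exp (- 2 cz wb)\<close>, and \<open>cq\<close> from matching \<open>Q\<close> in the
  limit. The equations are transferred as equivalences, so the lemma serves both directions.\<close>

lemma bonnet_transfer:
  fixes c cz ch chq cq :: complex
  assumes \<Xi>: "open \<Xi>" and D: "open D" "0 \<notin> D" "1 \<notin> D" "-1 \<notin> D"
    and hol: "v holomorphic_on D" "h holomorphic_on D" "vh holomorphic_on \<Xi>" "hh holomorphic_on \<Xi>"
    and vh0: "\<forall>\<xi>\<in>\<Xi>. vh \<xi> \<noteq> 0" and nz: "cz \<noteq> 0" "ch \<noteq> 0" "chq \<noteq> 0" and cq: "cq = - 4 * chq / (ch * cz)"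
    and vhrel: "\<forall>\<xi>\<in>\<Xi>. exp (4 * cz * \<xi>) \<in> D \<and> v (exp (4 * cz * \<xi>)) = - chq / (ch^2 * cz^2) * exp (4 * cz * \<xi>) * vh \<xi> \<and>
       h (exp (4 * cz * \<xi>)) = ch * hh \<xi>"
    and q: "\<forall>\<eta>\<in>D. q \<eta> = cq * \<eta>^2 / (\<eta>^2 - 1)"
    and \<xi>: "\<xi> \<in> \<Xi>" and e: "e = exp (4 * cz * \<xi>)"
  shows "sinh (4 * cz * \<xi>) \<noteq> 0"
    and "deriv h e \<noteq> 0 \<and> v e = 4 * cq * e^2 / ((1 - e^2)^2 * deriv h e) \<longleftrightarrow> vh \<xi> * deriv hh \<xi> = (4 * cz / sinh (4 * cz * \<xi>))^2"
    and "16 * cz^2 * (first_integral c v h q e + 2 * cq * c) = (deriv vh \<xi> / vh \<xi>)^2 + 16 * chq * (((hh \<xi>)^2 - c^2 / ch^2) * vh \<xi>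
       + (4 * cz / sinh (4 * cz * \<xi>))^2 / vh \<xi> + 8 * cz * (cosh (4 * cz * \<xi>) / sinh (4 * cz * \<xi>)) * hh \<xi>)"
    and "reduced_gauss c v h q e \<longleftrightarrow> bonnet_gauss c cz ch chq vh hh \<xi>"
proof -
  note SC = sinh_cosh_exp[OF e]
  note v0 = vh0[rule_format] and rel = vhrel[rule_format]
  have eD: "e \<in> D" and re: "v e = - chq / (ch^2 * cz^2) * e * vh \<xi>" "h e = ch * hh \<xi>" using rel[OF \<xi>] by (auto simp: e)
  have e1: "e \<noteq> 0" "1 - e^2 \<noteq> 0" using X_of_facts(1)[of e] D eD by auto
  then have e2: "e^2 - 1 \<noteq> 0" by auto
  show s0: "sinh (4 * cz * \<xi>) \<noteq> 0" using SC(4) e1(2) by auto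
  define y S k where "y = vh \<xi>" and "S = (4 * cz / sinh (4 * cz * \<xi>))^2" and "k = cosh (4 * cz * \<xi>) / sinh (4 * cz * \<xi>)"
  have S: "S = 64 * cz^2 * e^2 / (e^2 - 1)^2" using SC(1,3) e2 by (simp add: S_def power_divide power_mult_distrib)
  have k: "k = (e^2 + 1) / (e^2 - 1)" using SC(1,2,3) e2 by (simp add: k_def)
  have y0: "y \<noteq> 0" using v0[OF \<xi>] by (simp add: y_def)
  have dexp: "((\<lambda>\<xi>. exp (4 * cz * \<xi>)) has_field_derivative exp (4 * cz * \<xi>) * (4 * cz)) (at \<xi>)" for \<xi>
    by (rule derivative_eq_intros refl)+ simp
  have chain: "((\<lambda>\<xi>. f (exp (4 * cz * \<xi>))) has_field_derivative deriv f (exp (4 * cz * \<xi>)) * (exp (4 * cz * \<xi>) * (4 * cz))) (at \<xi>)"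
    if "f holomorphic_on D'" "open D'" "exp (4 * cz * \<xi>) \<in> D'" for f \<xi> D'
    by (rule DERIV_chain2[OF holomorphic_derivI[OF that] dexp])
  have dh: "deriv h e * (4 * cz * e) = ch * deriv hh \<xi>"
  proof -
    have "((\<lambda>\<xi>. ch * hh \<xi>) has_field_derivative ch * deriv hh \<xi>) (at \<xi>)"
      by (rule DERIV_cmult[OF holomorphic_derivI[OF hol(4) \<Xi> \<xi>]])
    then have "((\<lambda>\<xi>. h (exp (4 * cz * \<xi>))) has_field_derivative ch * deriv hh \<xi>) (at \<xi>)"
      by (rule has_field_derivative_transform_within_open[OF _ \<Xi> \<xi>]) (use rel in auto)
    from DERIV_unique[OF this chain[OF hol(2) D(1)]] show ?thesis using eD by (simp add: e mult_ac)
  qed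
  show "deriv h e \<noteq> 0 \<and> v e = 4 * cq * e^2 / ((1 - e^2)^2 * deriv h e) \<longleftrightarrow> vh \<xi> * deriv hh \<xi> = (4 * cz / sinh (4 * cz * \<xi>))^2"
  proof -
    have hh': "deriv hh \<xi> = deriv h e * (4 * cz * e) / ch" using dh nz by (simp add: field_simps)
    have "y * deriv hh \<xi> = S \<longleftrightarrow> y * deriv h e = ch * S / (4 * cz * e)"
      unfolding hh' using nz e1 by (simp add: field_simps)
    also have "ch * S / (4 * cz * e) = 16 * ch * cz * e / (1 - e^2)^2"
      unfolding S using nz e1 e2 by (simp add: divide_simps power2_eq_square) (simp add: algebra_simps)
    also have "y * deriv h e = 16 * ch * cz * e / (1 - e^2)^2 \<longleftrightarrow> v e * deriv h e = 4 * cq * e^2 / (1 - e^2)^2"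
    proof -
      have "v e * deriv h e = (- chq * e / (ch^2 * cz^2)) * (y * deriv h e)" unfolding re(1) y_def by simp
      moreover have "4 * cq * e^2 / (1 - e^2)^2 = (- chq * e / (ch^2 * cz^2)) * (16 * ch * cz * e / (1 - e^2)^2)"
        unfolding cq using nz e1 by (simp add: divide_simps power2_eq_square)
      moreover have "- chq * e / (ch^2 * cz^2) \<noteq> 0" using nz e1 by simp
      ultimately show ?thesis using mult_left_cancel by metis
    qed
    also have "v e * deriv h e = 4 * cq * e^2 / (1 - e^2)^2 \<longleftrightarrow> deriv h e \<noteq> 0 \<and> v e = 4 * cq * e^2 / ((1 - e^2)^2 * deriv h e)"
    proof (cases "deriv h e = 0")
      case True
      then show ?thesis using cq nz e1 by simp
    next
      case False
      then show ?thesis using e1 by (simp add: divide_simps mult_ac)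
    qed
    finally show ?thesis unfolding y_def S_def by blast
  qed
  \<comment> \<open>\<open>v\<close> is known to be nonzero only on the image of \<Xi>, so its
    logarithmic derivative is formed on this open subset of \<open>D\<close>.\<close>
  define D' where "D' = {s \<in> D. v s \<noteq> 0}"
  have D': "open D'" using open_nonzero_set[OF hol(1) D(1)] unfolding D'_def .
  define L where "L = (\<lambda>s. s * deriv v s / v s)"
  have vD': "v holomorphic_on D'" "deriv v holomorphic_on D'"
    using hol(1) holomorphic_deriv[OF hol(1) D(1)] by (auto simp: D'_def intro: holomorphic_on_subset)
  have Lh: "L holomorphic_on D'" unfolding L_def by (intro holomorphic_intros vD' D') (auto simp: D'_def)
  have xD': "exp (4 * cz * \<xi>) \<in> D'" if "\<xi> \<in> \<Xi>" for \<xi> using rel[OF that] v0[OF that] nz by (simp add: D'_def)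
  have LL: "L (exp (4 * cz * \<xi>)) = 1 + deriv vh \<xi> / vh \<xi> / (4 * cz)" if \<xi>: "\<xi> \<in> \<Xi>" for \<xi>
  proof -
    define e y p where "e = exp (4 * cz * \<xi>)" and "y = vh \<xi>" and "p = - chq / (ch^2 * cz^2)"
    have n: "e \<noteq> 0" "y \<noteq> 0" "p \<noteq> 0" using v0[OF \<xi>] nz by (auto simp: e_def y_def p_def)
    have "((\<lambda>\<xi>. p * exp (4 * cz * \<xi>) * vh \<xi>) has_field_derivative p * e * (4 * cz) * y + p * e * deriv vh \<xi>) (at \<xi>)"
      by (rule derivative_eq_intros holomorphic_derivI[OF hol(3) \<Xi> \<xi>] refl)+ (simp add: e_def y_def)
    then have "((\<lambda>\<xi>. v (exp (4 * cz * \<xi>))) has_field_derivative p * e * (4 * cz) * y + p * e * deriv vh \<xi>) (at \<xi>)"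
      by (rule has_field_derivative_transform_within_open[OF _ \<Xi> \<xi>]) (use rel in \<open>auto simp: p_def\<close>)
    from DERIV_unique[OF chain[OF hol(1) D(1)] this] have "deriv v e * e * (4 * cz) = p * e * (4 * cz) * y + p * e * deriv vh \<xi>"
      using rel[OF \<xi>] by (simp add: e_def mult.assoc)
    then have dv: "deriv v e * e = p * e * y + p * e * deriv vh \<xi> / (4 * cz)" using nz by (simp add: field_simps)
    have ve: "v e = p * e * y" using rel[OF \<xi>] by (simp add: e_def y_def p_def)
    have "L e = (deriv v e * e) / v e" by (simp add: L_def)
    also have "\<dots> = 1 + deriv vh \<xi> / y / (4 * cz)" unfolding dv ve using n nz by (simp add: field_simps)
    finally show ?thesis by (simp add: e_def y_def)
  qed
  define l where "l = deriv vh \<xi> / vh \<xi>"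
  have Le: "e * deriv v e / v e - 1 = l / (4 * cz)" using LL[OF \<xi>] by (simp add: L_def l_def e)
  have "(\<lambda>\<xi>. deriv vh \<xi> / vh \<xi>) holomorphic_on \<Xi>" using v0 \<Xi> by (intro holomorphic_intros hol) auto
  from DERIV_add[OF DERIV_const DERIV_cdivide[OF holomorphic_derivI[OF this \<Xi> \<xi>], of "4 * cz"], of 1]
  have "((\<lambda>\<xi>. L (exp (4 * cz * \<xi>))) has_field_derivative 0 + deriv (\<lambda>\<xi>. deriv vh \<xi> / vh \<xi>) \<xi> / (4 * cz)) (at \<xi>)"
    by (rule has_field_derivative_transform_within_open[OF _ \<Xi> \<xi>]) (simp add: LL)
  from DERIV_unique[OF chain[OF Lh D' xD'[OF \<xi>]] this]
  have dL: "16 * cz^2 * e * deriv L e = deriv (\<lambda>\<xi>. deriv vh \<xi> / vh \<xi>) \<xi>"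
    unfolding e[symmetric] using nz by (simp add: field_simps power2_eq_square)
  have qe: "q e = cq * e^2 / (e^2 - 1)" using q eD by blast
  have T1: "16 * cz^2 * (((h e)^2 - c^2) * v e / e) = - (16 * chq * ((hh \<xi>)^2 - c^2 / ch^2) * y)"
    unfolding re y_def[symmetric] using nz e1 by (simp add: field_simps power2_eq_square)
  have T2: "16 * cz^2 * (4 * (q e)^2 / (e * v e)) = - (16 * chq * S / y)"
    unfolding re y_def[symmetric] qe cq S using nz e1 e2 y0 by (simp add: divide_simps) algebra
  \<comment> \<open>Here the shift \<open>2 cq c\<close> is absorbed: what remains of the terms
    linear in \<open>q\<close> is proportional to \<open>h (e^2 + 1)/(e^2 - 1)\<close>, and the
    fraction is the hyperbolic cotangent.\<close>
  have T3: "16 * cz^2 * (2 * (h e + c) * q e + 2 * (h e - c) * q e / e^2 - 2 * cq * c) = - (128 * chq * cz * k * hh \<xi>)"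
  proof -
    have "2 * (x + c) * (cq * e^2 / A) + 2 * (x - c) * (cq * e^2 / A) / e^2 - 2 * cq * c = 2 * cq * x * ((e^2 + 1) / A)"
      if "A = e^2 - 1" "A \<noteq> 0" for A x
    proof -
      have "2 * (x - c) * (cq * e^2 / A) / e^2 = 2 * (x - c) * cq / A" using e1 by simp
      moreover have "2 * cq * c = 2 * cq * c * A / A" using that by simp
      ultimately have "2 * (x + c) * (cq * e^2 / A) + 2 * (x - c) * (cq * e^2 / A) / e^2 - 2 * cq * c
         = (2 * (x + c) * (cq * e^2) + 2 * (x - c) * cq - 2 * cq * c * A) / A"
        by (simp only: add_divide_distrib diff_divide_distrib times_divide_eq_right)
      also have "2 * (x + c) * (cq * e^2) + 2 * (x - c) * cq - 2 * cq * c * A = 2 * cq * x * (e^2 + 1)" unfolding that(1) by algebra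
      finally show ?thesis by simp
    qed
    from this[OF refl e2, of "h e"] have "2 * (h e + c) * q e + 2 * (h e - c) * q e / e^2 - 2 * cq * c = 2 * cq * h e * k"
      unfolding qe k .
    moreover have "cq * ch * cz = - 4 * chq" using nz by (simp add: cq)
    ultimately show ?thesis unfolding re by algebra
  qed
  show "16 * cz^2 * (first_integral c v h q e + 2 * cq * c) = (deriv vh \<xi> / vh \<xi>)^2 + 16 * chq * (((hh \<xi>)^2 - c^2 / ch^2) * vh \<xi>
       + (4 * cz / sinh (4 * cz * \<xi>))^2 / vh \<xi> + 8 * cz * (cosh (4 * cz * \<xi>) / sinh (4 * cz * \<xi>)) * hh \<xi>)"
  proof -
    have "16 * cz^2 * (first_integral c v h q e + 2 * cq * c) = 16 * cz^2 * (l / (4 * cz))^2 - 16 * cz^2 * (((h e)^2 - c^2) * v e / e)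
      - 16 * cz^2 * (2 * (h e + c) * q e + 2 * (h e - c) * q e / e^2 - 2 * cq * c) - 16 * cz^2 * (4 * (q e)^2 / (e * v e))"
      unfolding first_integral_def Le by (simp add: algebra_simps)
    also have "16 * cz^2 * (l / (4 * cz))^2 = l^2" using nz by (simp add: power_divide power_mult_distrib)
    finally show ?thesis unfolding T1 T2 T3 S_def[symmetric] k_def[symmetric] y_def[symmetric] l_def
      by (simp add: algebra_simps)
  qed
  have "16 * cz^2 * e * (deriv L e - ((h e)^2 - c^2) / (2 * e^2) * v e + 2 * (q e)^2 / (e^2 * v e))
     = 16 * cz^2 * e * deriv L e - (16 * cz^2 * (((h e)^2 - c^2) * v e / e)) / 2 + (16 * cz^2 * (4 * (q e)^2 / (e * v e))) / 2"
  proof -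
    have "e * (((h e)^2 - c^2) / (2 * e^2) * v e) = (((h e)^2 - c^2) * v e / e) / 2"
      "e * (2 * (q e)^2 / (e^2 * v e)) = (4 * (q e)^2 / (e * v e)) / 2"
      using e1 by (simp_all add: power2_eq_square[of e])
    moreover have "16 * cz^2 * e * (a - b + d) = 16 * cz^2 * e * a - 16 * cz^2 * (e * b) + 16 * cz^2 * (e * d)" for a b d
      by (simp add: algebra_simps)
    ultimately show ?thesis by (simp only: times_divide_eq_right)
  qed
  also have "\<dots> = deriv (\<lambda>\<xi>. deriv vh \<xi> / vh \<xi>) \<xi> + 8 * chq * ((hh \<xi>)^2 - c^2 / ch^2) * vh \<xi> - 8 * chq * S / vh \<xi>"
    unfolding dL T1 T2 y_def by simp
  finally have "bonnet_gauss c cz ch chq vh hh \<xi> \<longleftrightarrow> 16 * cz^2 * e * (deriv L e - ((h e)^2 - c^2) / (2 * e^2) * v e + 2 * (q e)^2 / (e^2 * v e)) = 0"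
    unfolding bonnet_gauss_def S_def by simp
  also have "\<dots> \<longleftrightarrow> reduced_gauss c v h q e" unfolding reduced_gauss_def L_def using nz e1 by simp
  finally show "reduced_gauss c v h q e \<longleftrightarrow> bonnet_gauss c cz ch chq vh hh \<xi>" by blast
qed

lemma first_integral_bonnet_form:
  fixes vh hh :: "complex \<Rightarrow> complex"
  assumes "vh \<xi> \<noteq> 0" "vh \<xi> * h' = S" "h' \<noteq> 0" "h'' / h' + k = - (deriv vh \<xi> / vh \<xi>)"
  shows "(h'' / h' + k)^2 + 16 * chq * (S * (((hh \<xi>)^2 - C) / h') + h' + k * hh \<xi>)
    = (deriv vh \<xi> / vh \<xi>)^2 + 16 * chq * (((hh \<xi>)^2 - C) * vh \<xi> + S / vh \<xi> + k * hh \<xi>)"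
proof -
  have e: "S * (((hh \<xi>)^2 - C) / h') = ((hh \<xi>)^2 - C) * vh \<xi>" "S / vh \<xi> = h'"
    using assms(1-3) by (auto simp: assms(2)[symmetric])
  show ?thesis unfolding assms(4) e power2_minus ..
qed

text \<open>The normalisation is \<open>chq = 1\<close>; then \<open>cq = - 4 chq / (ch cz)\<close>
  forces \<open>ch\<close>, and \<open>vh\<close>, \<open>hh\<close> are read off from
  \<open>bonnet_transfer\<close>.\<close>

lemma reduced_to_bonnet:
  assumes rs: "reduced_solution c D cq K v h q" and D: "open D" "0 \<notin> D" "1 \<notin> D" "-1 \<notin> D" and cz: "cz \<noteq> 0"
    and ch: "ch = - 4 / (cq * cz)"
    and \<Xi>: "open \<Xi>" "connected \<Xi>" "\<And>\<xi>. \<xi> \<in> \<Xi> \<Longrightarrow> exp (4 * cz * \<xi>) \<in> D"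
    and hh: "hh = (\<lambda>\<xi>. h (exp (4 * cz * \<xi>)) / ch)" and vh: "vh = (\<lambda>\<xi>. - (ch^2 * cz^2) * v (exp (4 * cz * \<xi>)) / exp (4 * cz * \<xi>))"
  shows "bonnet_solution c cz ch 1 (16 * cz^2 * (K + 2 * cq * c)) \<Xi> vh hh"
proof -
  have cq: "cq \<noteq> 0" and hol: "v holomorphic_on D" "h holomorphic_on D" and vq: "vq_form cq D v h q" and v0: "\<And>\<eta>. \<eta> \<in> D \<Longrightarrow> v \<eta> \<noteq> 0"
    and FI: "\<And>\<eta>. \<eta> \<in> D \<Longrightarrow> first_integral c v h q \<eta> = K" and g: "\<And>\<eta>. \<eta> \<in> D \<Longrightarrow> reduced_gauss c v h q \<eta>"
    using rs by (auto simp: reduced_solution_def reduced_system_def)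
  have ch0: "ch \<noteq> 0" using cq cz by (simp add: ch)
  have cq': "cq = - 4 * 1 / (ch * cz)" using cq cz by (simp add: ch)
  have eh: "(\<lambda>\<xi>. exp (4 * cz * \<xi>)) holomorphic_on \<Xi>" by (intro holomorphic_intros)
  have vhol: "(\<lambda>\<xi>. v (exp (4 * cz * \<xi>))) holomorphic_on \<Xi>" "(\<lambda>\<xi>. h (exp (4 * cz * \<xi>))) holomorphic_on \<Xi>"
    using holomorphic_on_compose_gen[OF eh hol(1)] holomorphic_on_compose_gen[OF eh hol(2)] \<Xi>(3) by (auto simp: o_def)
  have hol': "vh holomorphic_on \<Xi>" "hh holomorphic_on \<Xi>"
    unfolding vh hh by (intro holomorphic_intros vhol; simp add: ch0)+
  have vh0: "vh \<xi> \<noteq> 0" if "\<xi> \<in> \<Xi>" for \<xi> using v0[OF \<Xi>(3)[OF that]] ch0 cz by (simp add: vh)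
  have vh0': "\<forall>\<xi>\<in>\<Xi>. vh \<xi> \<noteq> 0" using vh0 by blast
  have rel: "\<forall>\<xi>\<in>\<Xi>. exp (4 * cz * \<xi>) \<in> D \<and> v (exp (4 * cz * \<xi>)) = - 1 / (ch^2 * cz^2) * exp (4 * cz * \<xi>) * vh \<xi> \<and> h (exp (4 * cz * \<xi>)) = ch * hh \<xi>"
    using \<Xi>(3) ch0 cz by (simp add: vh hh)
  have q: "\<forall>\<eta>\<in>D. q \<eta> = cq * \<eta>^2 / (\<eta>^2 - 1)" using vq by (simp add: vq_form_def)
  have T: "sinh (4 * cz * \<xi>) \<noteq> 0 \<and> vh \<xi> * deriv hh \<xi> = (4 * cz / sinh (4 * cz * \<xi>))^2 \<and> bonnet_gauss c cz ch 1 vh hh \<xi> \<and>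
      16 * cz^2 * (K + 2 * cq * c) = (deriv vh \<xi> / vh \<xi>)^2 + 16 * 1 * (((hh \<xi>)^2 - c^2 / ch^2) * vh \<xi>
       + (4 * cz / sinh (4 * cz * \<xi>))^2 / vh \<xi> + 8 * cz * (cosh (4 * cz * \<xi>) / sinh (4 * cz * \<xi>)) * hh \<xi>)" if \<xi>: "\<xi> \<in> \<Xi>" for \<xi>
  proof -
    define e where "e = exp (4 * cz * \<xi>)"
    have eD: "e \<in> D" using \<Xi>(3)[OF \<xi>] by (simp add: e_def)
    note B = bonnet_transfer[where v = v and h = h and q = q and vh = vh and hh = hh, OF \<Xi>(1) D hol hol' vh0' cz ch0 one_neq_zero cq' rel q \<xi> e_def]
    have "deriv h e \<noteq> 0 \<and> v e = 4 * cq * e^2 / ((1 - e^2)^2 * deriv h e)" using vq eD by (simp add: vq_form_def)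
    then have 2: "vh \<xi> * deriv hh \<xi> = (4 * cz / sinh (4 * cz * \<xi>))^2" by (subst B(2)[symmetric])
    have 4: "bonnet_gauss c cz ch 1 vh hh \<xi>" using g[OF eD] by (subst B(4)[symmetric])
    have 1: "sinh (4 * cz * \<xi>) \<noteq> 0" by (rule B(1))
    have 3: "16 * cz^2 * (K + 2 * cq * c) = (deriv vh \<xi> / vh \<xi>)^2 + 16 * 1 * (((hh \<xi>)^2 - c^2 / ch^2) * vh \<xi>
       + (4 * cz / sinh (4 * cz * \<xi>))^2 / vh \<xi> + 8 * cz * (cosh (4 * cz * \<xi>) / sinh (4 * cz * \<xi>)) * hh \<xi>)"
      unfolding FI[OF eD, symmetric] by (rule B(3))
    show ?thesis using 1 2 3 4 by blast
  qed
  have K: "16 * cz^2 * (K + 2 * cq * c) = (deriv (deriv hh) \<xi> / deriv hh \<xi> + 8 * cz * (cosh (4 * cz * \<xi>) / sinh (4 * cz * \<xi>)))^2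
     + 16 * 1 * ((4 * cz / sinh (4 * cz * \<xi>))^2 * (((hh \<xi>)^2 - (1 * c / ch)^2) / deriv hh \<xi>) + deriv hh \<xi>
       + 8 * cz * (cosh (4 * cz * \<xi>) / sinh (4 * cz * \<xi>)) * hh \<xi>)" if \<xi>: "\<xi> \<in> \<Xi>" for \<xi>
  proof -
    have l: "deriv (deriv hh) \<xi> / deriv hh \<xi> + 8 * cz * (cosh (4 * cz * \<xi>) / sinh (4 * cz * \<xi>)) = - (deriv vh \<xi> / vh \<xi>)"
      using T by (intro bonnet_log_deriv[OF \<Xi>(1) hol' cz _ \<xi>]) blast
    have n: "vh \<xi> * deriv hh \<xi> = (4 * cz / sinh (4 * cz * \<xi>))^2" "deriv hh \<xi> \<noteq> 0" using T[OF \<xi>] cz by auto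
    \<comment> \<open>With \<open>chq = 1\<close> Bonnet's constant \<open>C\<close> is the
      \<open>(c / ch)^2\<close> that the Gauss equation requires.\<close>
    have C: "(1 * c / ch)^2 = c^2 / ch^2" by (simp add: power_divide)
    note F = first_integral_bonnet_form[where hh = hh and chq = 1 and C = "c^2 / ch^2", OF vh0[OF \<xi>] n l]
    show ?thesis unfolding C by (rule trans[OF _ F[symmetric]]) (use T[OF \<xi>] in blast)
  qed
  have GC: "gauss_codazzi c G u (\<lambda>w wb. ch * hh ((w + wb) / 2)) (bonnet_Q cz ch 1) (bonnet_R cz ch 1)"
    if "open G" "\<forall>(w, wb)\<in>G. (w + wb) / 2 \<in> \<Xi> \<and> sinh (2 * cz * w) \<noteq> 0 \<and> sinh (2 * cz * wb) \<noteq> 0"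
      "holomorphic2_on G u" "\<forall>(w, wb)\<in>G. exp (u w wb) = 4 * (1 / ch^2) * vh ((w + wb) / 2)" for G u
    using that T by (intro gauss_codazzi_bonnet[OF \<Xi>(1) hol' cz ch0 one_neq_zero]) auto
  have T': "sinh (4 * cz * \<xi>) \<noteq> 0 \<and> vh \<xi> * deriv hh \<xi> - (4 * cz / sinh (4 * cz * \<xi>))^2 = 0" if "\<xi> \<in> \<Xi>" for \<xi>
    using T[OF that] by simp
  have 1: "\<forall>\<xi>\<in>\<Xi>. sinh (4 * cz * \<xi>) \<noteq> 0 \<and> vh \<xi> * deriv hh \<xi> - (4 * cz / sinh (4 * cz * \<xi>))^2 = 0 \<and>
     16 * cz^2 * (K + 2 * cq * c) = (deriv (deriv hh) \<xi> / deriv hh \<xi> + 8 * cz * (cosh (4 * cz * \<xi>) / sinh (4 * cz * \<xi>)))^2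
     + 16 * 1 * ((4 * cz / sinh (4 * cz * \<xi>))^2 * (((hh \<xi>)^2 - (1 * c / ch)^2) / deriv hh \<xi>) + deriv hh \<xi>
       + 8 * cz * (cosh (4 * cz * \<xi>) / sinh (4 * cz * \<xi>)) * hh \<xi>)"
  proof (intro ballI conjI)
    fix \<xi> assume \<xi>: "\<xi> \<in> \<Xi>"
    show "sinh (4 * cz * \<xi>) \<noteq> 0" "vh \<xi> * deriv hh \<xi> - (4 * cz / sinh (4 * cz * \<xi>))^2 = 0"
      using T'[OF \<xi>] by (rule conjunct1, rule conjunct2)
  qed (rule K)
  have 2: "\<forall>G u. open G \<longrightarrow>
        (\<forall>(w, wb)\<in>G. (w + wb) / 2 \<in> \<Xi> \<and> sinh (2 * cz * w) \<noteq> 0 \<and> sinh (2 * cz * wb) \<noteq> 0) \<longrightarrow>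
        holomorphic2_on G u \<longrightarrow>
        (\<forall>(w, wb)\<in>G. exp (u w wb) = 4 * (1 / ch^2) * vh ((w + wb) / 2)) \<longrightarrow>
        gauss_codazzi c G u (\<lambda>w wb. ch * hh ((w + wb) / 2)) (bonnet_Q cz ch 1) (bonnet_R cz ch 1)"
    by (intro allI impI) (rule GC)
  show ?thesis unfolding bonnet_solution_def Let_def
    by (rule conjI[OF cz conjI[OF ch0 conjI[OF one_neq_zero conjI[OF \<Xi>(1) conjI[OF \<Xi>(2) conjI[OF hol'(1) conjI[OF hol'(2) conjI[OF 1 2]]]]]]]])
qed

text \<open>The choice of \<open>g1\<close> and \<open>g2\<close> makes
  \<open>g1/g2 = exp (4 cz xi)\<close>. The product \<open>Q R\<close> agrees exactly because the
  two sinh ratios in it are reciprocal; \<open>Q\<close> and \<open>R\<close> separately agree only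
  in the limit.\<close>

lemma reduced_identical_to_bonnet:
  assumes rd: "reduction_domain g1 g2 D G" and cz: "cz \<noteq> 0" and cq: "cq \<noteq> 0" and D: "0 \<notin> D" "1 \<notin> D" "-1 \<notin> D"
    and q: "\<And>\<eta>. \<eta> \<in> D \<Longrightarrow> q \<eta> = cq * \<eta>^2 / (\<eta>^2 - 1)" and ch: "ch = - 4 / (cq * cz)"
    and \<phi>: "\<And>z zb. (z, zb) \<in> G \<Longrightarrow> \<phi> analytic_on {z} \<and> \<psi> analytic_on {zb} \<and> g1 z = exp (2 * cz * \<phi> z) \<and> g2 zb = exp (- 2 * cz * \<psi> zb)"
    and hh: "hh = (\<lambda>\<xi>. h (exp (4 * cz * \<xi>)) / ch)" and vh: "vh = (\<lambda>\<xi>. - (ch^2 * cz^2) * v (exp (4 * cz * \<xi>)) / exp (4 * cz * \<xi>))"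
    and z: "(z, zb) \<in> G"
  shows "identical_to_bonnet cz ch 1 vh hh v h q g1 g2 \<phi> \<psi> z zb"
proof -
  have G: "open G" using rd by (simp add: reduction_domain_def)
  define w wb w' wb' e x y where "w = \<phi> z" and "wb = \<psi> zb" and "w' = deriv \<phi> z" and "wb' = deriv \<psi> zb"
    and "e = exp (4 * cz * ((w + wb) / 2))" and "x = g1 z" and "y = g2 zb"
  have ch0: "ch \<noteq> 0" using cq cz by (simp add: ch)
  have xy: "x = exp (2 * cz * w)" "y = exp (- 2 * cz * wb)" using \<phi>[OF z] by (auto simp: x_def y_def w_def wb_def)
  have n: "x \<noteq> 0" "y \<noteq> 0" by (simp_all add: xy)
  have "x / y = exp (2 * cz * w - - 2 * cz * wb)" unfolding xy by (rule exp_diff[symmetric])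
  also have "\<dots> = e" unfolding e_def by (rule arg_cong[where f = exp]) (simp add: field_simps)
  finally have e: "x / y = e" .
  have xe: "x = e * y" using e n by (simp add: field_simps)
  have e0: "e \<noteq> 0" using n e by auto
  have eD: "e \<in> D" using reduction_facts(5)[OF rd z] e by (simp add: x_def y_def)
  have e1: "1 - e^2 \<noteq> 0" "e^2 - 1 \<noteq> 0" using X_of_facts(1)[of e] eD D by auto
  have qe: "q e = cq * e^2 / (e^2 - 1)" by (rule q[OF eD])
  have d\<phi>: "(\<phi> has_field_derivative w') (at z)" "(\<psi> has_field_derivative wb') (at zb)"
    using \<phi>[OF z] by (auto simp: w'_def wb'_def DERIV_deriv_iff_field_differentiable intro: analytic_on_imp_differentiable_at)
  have g1': "deriv g1 z = 2 * cz * w' * x"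
  proof (rule DERIV_imp_deriv, rule has_field_derivative_transform_within_open[OF _ open_slices(1)[OF G, of zb]])
    show "((\<lambda>s. exp (2 * cz * \<phi> s)) has_field_derivative 2 * cz * w' * x) (at z)"
      by (rule derivative_eq_intros d\<phi> refl)+ (simp add: xy w_def)
  qed (use z \<phi> in auto)
  have g2': "deriv g2 zb = - 2 * cz * wb' * y"
  proof (rule DERIV_imp_deriv, rule has_field_derivative_transform_within_open[OF _ open_slices(2)[OF G, of z]])
    show "((\<lambda>s. exp (- 2 * cz * \<psi> s)) has_field_derivative - 2 * cz * wb' * y) (at zb)"
      by (rule derivative_eq_intros d\<phi> refl)+ (simp add: xy wb_def)
  qed (use z \<phi> in auto)
  have E: "red_E g1 g2 v z zb = 4 * (1 / ch^2) * vh ((w + wb) / 2) * w' * wb'"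
    unfolding red_E_def x_def[symmetric] y_def[symmetric] g1' g2' e vh e_def[symmetric]
    unfolding xe using n e0 ch0 cz by (simp add: field_simps power2_eq_square)
  have H: "red_H g1 g2 h z zb = ch * hh ((w + wb) / 2)"
    unfolding red_H_def x_def[symmetric] y_def[symmetric] e hh e_def[symmetric] using ch0 by simp
  have Q: "red_Q g1 g2 q z zb = 4 * cz^2 * w'^2 * q e"
    unfolding red_Q_def x_def[symmetric] y_def[symmetric] g1' e using n by (simp add: power_mult_distrib)
  have R: "red_R g1 g2 q z zb = 4 * cz^2 * wb'^2 * q e / e^2"
    unfolding red_R_def x_def[symmetric] y_def[symmetric] g2' e unfolding xe using n e0 by (simp add: power_mult_distrib)
  note SC = sinh_cosh_exp[OF e_def]
  have cc: "cq = - 4 / (ch * cz)" using cq cz by (simp add: ch)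
  have P: "red_Q g1 g2 q z zb * red_R g1 g2 q z zb = (bonnet_Q cz ch 1 w wb * w'^2) * (bonnet_R cz ch 1 w wb * wb'^2)"
    if "sinh (2 * cz * w) \<noteq> 0" "sinh (2 * cz * wb) \<noteq> 0"
  proof -
    have "(bonnet_Q cz ch 1 w wb * w'^2) * (bonnet_R cz ch 1 w wb * wb'^2) = (bonnet_Q cz ch 1 w wb * bonnet_R cz ch 1 w wb) * (w'^2 * wb'^2)"
      by (simp add: mult_ac)
    also have "bonnet_Q cz ch 1 w wb * bonnet_R cz ch 1 w wb = (2 * 1 / ch)^2 * (4 * cz * (2 * e) / (e^2 - 1))^2"
      unfolding bonnet_QR[OF that] SC(1) by simp
    finally show ?thesis unfolding Q R qe cc using e0 e1 cz ch0 by (simp add: power_divide power_mult_distrib power2_eq_square mult_ac)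
  qed
  \<comment> \<open>The translations fix \<open>xi\<close>, so in Bonnet's \<open>Q\<close> and
    \<open>R\<close> only the sinh ratio depends on \<open>t\<close>.\<close>
  have xi: "(w - of_real t / cz + (wb + of_real t / cz)) / 2 = (w + wb) / 2" for t :: real by simp
  have arg: "2 * cz * (wb + of_real t / cz) = 2 * cz * wb + 2 * of_real t" "2 * cz * (w - of_real t / cz) = 2 * cz * w - 2 * of_real t" for t :: real
    using cz by (simp_all add: field_simps)
  have ee: "exp (2 * cz * w + 2 * cz * wb) = e" unfolding e_def by (rule arg_cong[where f = exp]) (simp add: field_simps)
  have bq: "bonnet_Q cz ch 1 (w - of_real t / cz) (wb + of_real t / cz) = 2 / ch * 4 * cz / ((e^2 - 1) / (2 * e)) *
       (sinh (2 * cz * wb + 2 * of_real t) / sinh (2 * cz * w - 2 * of_real t))"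
    "bonnet_R cz ch 1 (w - of_real t / cz) (wb + of_real t / cz) = 2 / ch * 4 * cz / ((e^2 - 1) / (2 * e)) *
       (sinh (2 * cz * w - 2 * of_real t) / sinh (2 * cz * wb + 2 * of_real t))" for t :: real
    unfolding bonnet_Q_def bonnet_R_def xi arg SC(1) by (simp_all add: mult_ac)
  have "((\<lambda>t::real. bonnet_Q cz ch 1 (w - of_real t / cz) (wb + of_real t / cz) * w'^2)
            \<longlongrightarrow> 2 / ch * 4 * cz / ((e^2 - 1) / (2 * e)) * (- e) * w'^2) at_top"
    unfolding bq using sinh_ratio_limit[of "2 * cz * wb" "2 * cz * w"] unfolding ee by (intro tendsto_mult tendsto_const)
  also have "2 / ch * 4 * cz / ((e^2 - 1) / (2 * e)) * (- e) * w'^2 = red_Q g1 g2 q z zb"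
    unfolding Q qe cc using e0 e1 cz ch0 by (simp add: field_simps power2_eq_square)
  finally have LQ: "((\<lambda>t::real. bonnet_Q cz ch 1 (w - of_real t / cz) (wb + of_real t / cz) * w'^2) \<longlongrightarrow> red_Q g1 g2 q z zb) at_top" .
  have "((\<lambda>t::real. bonnet_R cz ch 1 (w - of_real t / cz) (wb + of_real t / cz) * wb'^2)
            \<longlongrightarrow> 2 / ch * 4 * cz / ((e^2 - 1) / (2 * e)) * (- exp (- (2 * cz * w + 2 * cz * wb))) * wb'^2) at_top"
    unfolding bq by (intro tendsto_mult tendsto_const sinh_ratio_limit')
  also have "2 / ch * 4 * cz / ((e^2 - 1) / (2 * e)) * (- exp (- (2 * cz * w + 2 * cz * wb))) * wb'^2 = red_R g1 g2 q z zb"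
    unfolding R qe cc exp_minus ee using e0 e1 cz ch0 by (simp add: field_simps power2_eq_square)
  finally have LR: "((\<lambda>t::real. bonnet_R cz ch 1 (w - of_real t / cz) (wb + of_real t / cz) * wb'^2) \<longlongrightarrow> red_R g1 g2 q z zb) at_top" .
  show ?thesis
    unfolding identical_to_bonnet_def Let_def w_def[symmetric] wb_def[symmetric] w'_def[symmetric] wb'_def[symmetric]
    using E H P LQ LR by blast
qed

text \<open>The exponential need not be injective on \<Xi>. Near each point of \<open>D\<close> a
  branch of the logarithm through a chosen preimage gives a holomorphic right inverse, along which
  \<open>f\<close> is locally \<open>F\<close> composed with that branch.\<close>

lemma holomorphic_on_exp_descent:
  assumes \<Xi>: "open \<Xi>" and a: "a \<noteq> 0" and F: "F holomorphic_on \<Xi>" and D: "D = (\<lambda>\<xi>. exp (a * \<xi>)) ` \<Xi>"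
    and f: "\<And>\<xi>. \<xi> \<in> \<Xi> \<Longrightarrow> f (exp (a * \<xi>)) = F \<xi>"
  shows "f holomorphic_on D"
proof (rule holomorphic_onI)
  fix \<eta>0 assume "\<eta>0 \<in> D"
  then obtain \<xi>0 where \<xi>0: "\<xi>0 \<in> \<Xi>" "\<eta>0 = exp (a * \<xi>0)" by (auto simp: D)
  have n: "\<eta>0 \<noteq> 0" by (simp add: \<xi>0)
  define g where "g \<eta> = \<xi>0 + Ln (\<eta> / \<eta>0) / a" for \<eta>
  \<comment> \<open>On this ball the quotient of a point by the centre has positive real part, so it
    avoids the branch cut of \<open>Ln\<close>.\<close>
  define B where "B = ball \<eta>0 (norm \<eta>0)"
  have pos: "\<eta> / \<eta>0 \<notin> \<real>\<^sub>\<le>\<^sub>0 \<and> \<eta> \<noteq> 0" if "\<eta> \<in> B" for \<eta>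
  proof -
    have "norm (1 - \<eta> / \<eta>0) = norm (\<eta>0 - \<eta>) / norm \<eta>0" using n by (simp add: norm_divide[symmetric] diff_divide_distrib)
    also have "\<dots> < 1" using that n by (simp add: B_def dist_norm)
    finally have "norm (1 - \<eta> / \<eta>0) < 1" .
    then have "Re (1 - \<eta> / \<eta>0) < 1" using complex_Re_le_cmod[of "1 - \<eta> / \<eta>0"] by linarith
    then have "Re (\<eta> / \<eta>0) > 0" by simp
    then show ?thesis by (auto simp: complex_nonpos_Reals_iff)
  qed
  have gh: "g holomorphic_on B" unfolding g_def[abs_def] using pos a n by (intro holomorphic_intros) auto
  have g: "exp (a * g \<eta>) = \<eta>" if "\<eta> \<in> B" for \<eta>
    using pos[OF that] n a by (simp add: g_def distrib_left exp_add \<xi>0(2)[symmetric])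
  define N where "N = B \<inter> g -` \<Xi>"
  have N: "open N" unfolding N_def
    by (rule continuous_open_preimage[OF holomorphic_on_imp_continuous_on[OF gh] _ \<Xi>]) (simp add: B_def)
  have g0: "g \<eta>0 = \<xi>0" using n by (simp add: g_def)
  have \<eta>N: "\<eta>0 \<in> N" using n \<xi>0 g0 by (simp add: N_def B_def)
  have "(F \<circ> g) holomorphic_on N"
    by (rule holomorphic_on_compose_gen[OF holomorphic_on_subset[OF gh] F]) (auto simp: N_def)
  then have "f holomorphic_on N"
    by (rule holomorphic_transform) (use f g in \<open>force simp: N_def\<close>)
  then have "f field_differentiable at \<eta>0" using holomorphic_on_imp_differentiable_at[OF _ N \<eta>N] by blast
  then show "f field_differentiable at \<eta>0 within D" by (rule field_differentiable_at_within)
qed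

lemma bonnet_to_reduced:
  assumes bs: "bonnet_solution c cz ch chq Kh \<Xi> vh hh" and cc: "(chq * c)^2 = c^2"
    and D: "open D" "0 \<notin> D" "1 \<notin> D" "-1 \<notin> D" and DX: "D = (\<lambda>\<xi>. exp (4 * cz * \<xi>)) ` \<Xi>"
    and rel: "\<And>\<xi>. \<xi> \<in> \<Xi> \<Longrightarrow> v (exp (4 * cz * \<xi>)) = - chq / (ch^2 * cz^2) * exp (4 * cz * \<xi>) * vh \<xi> \<and> h (exp (4 * cz * \<xi>)) = ch * hh \<xi>"
    and cq: "cq = - 4 * chq / (ch * cz)" and q: "\<And>\<eta>. \<eta> \<in> D \<Longrightarrow> q \<eta> = cq * \<eta>^2 / (\<eta>^2 - 1)"
  shows "reduced_solution c D cq (Kh / (16 * cz^2) - 2 * cq * c) v h q"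
proof -
  have nz: "cz \<noteq> 0" "ch \<noteq> 0" "chq \<noteq> 0" and \<Xi>: "open \<Xi>" and hol: "vh holomorphic_on \<Xi>" "hh holomorphic_on \<Xi>"
    using bs by (auto simp: bonnet_solution_def)
  have S: "sinh (4 * cz * \<xi>) \<noteq> 0 \<and> vh \<xi> * deriv hh \<xi> = (4 * cz / sinh (4 * cz * \<xi>))^2" 
    and K: "Kh = (deriv (deriv hh) \<xi> / deriv hh \<xi> + 8 * cz * (cosh (4 * cz * \<xi>) / sinh (4 * cz * \<xi>)))^2
     + 16 * chq * ((4 * cz / sinh (4 * cz * \<xi>))^2 * (((hh \<xi>)^2 - (chq * c / ch)^2) / deriv hh \<xi>) + deriv hh \<xi>
       + 8 * cz * (cosh (4 * cz * \<xi>) / sinh (4 * cz * \<xi>)) * hh \<xi>)" if "\<xi> \<in> \<Xi>" for \<xi>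
    using bs that unfolding bonnet_solution_def Let_def right_minus_eq by blast+
  have GC: "gauss_codazzi c G u (\<lambda>w wb. ch * hh ((w + wb) / 2)) (bonnet_Q cz ch chq) (bonnet_R cz ch chq)"
    if "open G" "\<forall>(w, wb)\<in>G. (w + wb) / 2 \<in> \<Xi> \<and> sinh (2 * cz * w) \<noteq> 0 \<and> sinh (2 * cz * wb) \<noteq> 0"
      "holomorphic2_on G u" "\<forall>(w, wb)\<in>G. exp (u w wb) = 4 * (chq / ch^2) * vh ((w + wb) / 2)" for G u
    using bs that unfolding bonnet_solution_def by blast
  have n: "vh \<xi> \<noteq> 0" "deriv hh \<xi> \<noteq> 0" if "\<xi> \<in> \<Xi>" for \<xi> using S[OF that] nz by auto
  \<comment> \<open>The Gauss equation is available only for functions of two variables with a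
    logarithm \<open>u\<close> of the metric. Such a logarithm exists over a ball around \<xi>, and
    the equation is evaluated at the diagonal point \<open>w = wb\<close>.\<close>
  have BG: "bonnet_gauss c cz ch chq vh hh \<xi>" if \<xi>: "\<xi> \<in> \<Xi>" for \<xi>
  proof -
    obtain r where r: "r > 0" "ball \<xi> r \<subseteq> \<Xi>" using \<Xi> \<xi> openE by blast
    have kh: "(\<lambda>\<xi>. 4 * (chq / ch^2) * vh \<xi>) holomorphic_on ball \<xi> r" by (intro holomorphic_intros holomorphic_on_subset[OF hol(1) r(2)])
    have k0: "4 * (chq / ch^2) * vh x \<noteq> 0" if "x \<in> ball \<xi> r" for x using n(1)[of x] nz r that by auto
    obtain L where L: "L holomorphic_on ball \<xi> r" "\<And>x. x \<in> ball \<xi> r \<Longrightarrow> exp (L x) = 4 * (chq / ch^2) * vh x"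
      by (rule holomorphic_logarithm_exists[OF convex_ball open_ball kh k0, of \<xi>]) (use r in auto)
    define G where "G = {p. (fst p + snd p) / 2 \<in> ball \<xi> r} \<inter> {p. sinh (2 * cz * fst p) \<noteq> 0} \<inter> {p :: complex \<times> complex. sinh (2 * cz * snd p) \<noteq> 0}"
    have cs: "continuous_on UNIV (sinh :: complex \<Rightarrow> complex)"
      unfolding sinh_field_def[abs_def] by (intro continuous_intros) auto
    have G: "open G" unfolding G_def
    proof (intro open_Int)
      have "continuous_on UNIV (\<lambda>p :: complex \<times> complex. (fst p + snd p) / 2)" by (intro continuous_intros) auto
      from open_vimage[OF open_ball this] show "open {p. (fst p + snd p) / 2 \<in> ball \<xi> r}" by (simp add: vimage_def)
      show "open {p. sinh (2 * cz * fst p) \<noteq> 0}" "open {p :: complex \<times> complex. sinh (2 * cz * snd p) \<noteq> 0}"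
        by (intro open_Collect_neq continuous_intros continuous_on_compose2[OF cs]; simp)+
    qed
    have m: "(w + wb) / 2 \<in> \<Xi> \<and> sinh (2 * cz * w) \<noteq> 0 \<and> sinh (2 * cz * wb) \<noteq> 0" "(w + wb) / 2 \<in> ball \<xi> r" if "(w, wb) \<in> G" for w wb
      using that r(2) by (auto simp: G_def)
    define u where "u w wb = L ((w + wb) / 2)" for w wb
    have u: "holomorphic2_on G u" unfolding u_def[abs_def] by (rule holomorphic2_on_mid[OF G L(1) open_ball m(2)])
    have ue: "exp (u w wb) = 4 * (chq / ch^2) * vh ((w + wb) / 2)" if "(w, wb) \<in> G" for w wb
      using L(2)[OF m(2)[OF that]] by (simp add: u_def)
    have gc: "gauss_codazzi c G u (\<lambda>w wb. ch * hh ((w + wb) / 2)) (bonnet_Q cz ch chq) (bonnet_R cz ch chq)"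
      by (rule GC[OF G _ u]) (use m ue in auto)
    \<comment> \<open>The double-angle formula shows that \<open>sinh (2 cz xi)\<close> is nonzero,
      so the diagonal point lies in \<open>G\<close>.\<close>
    have "sinh (2 * (2 * cz * \<xi>)) \<noteq> 0" using S[OF \<xi>] by (simp add: mult_ac)
    then have "sinh (2 * cz * \<xi>) \<noteq> 0" unfolding sinh_double by auto
    then have p: "(\<xi>, \<xi>) \<in> G" using r by (simp add: G_def)
    have "bonnet_gauss c cz ch chq vh hh ((\<xi> + \<xi>) / 2)"
      by (rule gauss_equation_bonnet[OF \<Xi> hol(1) n(1) nz(2,3) G m(1) u ue p, THEN iffD1])
         (use gc p in \<open>auto simp: gauss_codazzi_def\<close>)
    then show ?thesis by simp
  qed
  have vF: "v holomorphic_on D"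
    by (rule holomorphic_on_exp_descent[OF \<Xi> _ _ DX, where F = "\<lambda>\<xi>. - chq / (ch^2 * cz^2) * exp (4 * cz * \<xi>) * vh \<xi>"])
       (use nz rel in \<open>auto intro!: holomorphic_intros hol\<close>)
  have hF: "h holomorphic_on D"
    by (rule holomorphic_on_exp_descent[OF \<Xi> _ _ DX, where F = "\<lambda>\<xi>. ch * hh \<xi>"])
       (use nz rel in \<open>auto intro!: holomorphic_intros hol\<close>)
  have rel': "\<forall>\<xi>\<in>\<Xi>. exp (4 * cz * \<xi>) \<in> D \<and> v (exp (4 * cz * \<xi>)) = - chq / (ch^2 * cz^2) * exp (4 * cz * \<xi>) * vh \<xi> \<and> h (exp (4 * cz * \<xi>)) = ch * hh \<xi>"
    using rel by (auto simp: DX)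
  have n': "\<forall>\<xi>\<in>\<Xi>. vh \<xi> \<noteq> 0" and q': "\<forall>\<eta>\<in>D. q \<eta> = cq * \<eta>^2 / (\<eta>^2 - 1)" using n(1) q by blast+
  have main: "deriv h \<eta> \<noteq> 0 \<and> v \<eta> = 4 * cq * \<eta>^2 / ((1 - \<eta>^2)^2 * deriv h \<eta>) \<and> reduced_gauss c v h q \<eta> \<and>
     first_integral c v h q \<eta> = Kh / (16 * cz^2) - 2 * cq * c" if \<eta>: "\<eta> \<in> D" for \<eta>
  proof -
    obtain \<xi> where \<xi>: "\<xi> \<in> \<Xi>" "\<eta> = exp (4 * cz * \<xi>)" using \<eta> by (auto simp: DX)
    note B = bonnet_transfer[where v = v and h = h and q = q and vh = vh and hh = hh, OF \<Xi> D vF hF hol n' nz cq rel' q' \<xi>]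
    have 1: "deriv h \<eta> \<noteq> 0 \<and> v \<eta> = 4 * cq * \<eta>^2 / ((1 - \<eta>^2)^2 * deriv h \<eta>)" using S[OF \<xi>(1)] by (subst B(2)) auto
    have 2: "reduced_gauss c v h q \<eta>" using BG[OF \<xi>(1)] by (subst B(4))
    \<comment> \<open>Here the hypothesis \<open>(chq c)^2 = c^2\<close> identifies Bonnet's
      \<open>C\<close> with the constant of the Gauss equation.\<close>
    have C: "(chq * c / ch)^2 = c^2 / ch^2" using cc by (simp add: power_divide)
    have l: "deriv (deriv hh) \<xi> / deriv hh \<xi> + 8 * cz * (cosh (4 * cz * \<xi>) / sinh (4 * cz * \<xi>)) = - (deriv vh \<xi> / vh \<xi>)"
      by (rule bonnet_log_deriv[OF \<Xi> hol nz(1) S \<xi>(1)])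
    have "Kh = 16 * cz^2 * (first_integral c v h q \<eta> + 2 * cq * c)"
      using K[OF \<xi>(1)] unfolding C first_integral_bonnet_form[where hh = hh, OF n(1)[OF \<xi>(1)] S[OF \<xi>(1), THEN conjunct2] n(2)[OF \<xi>(1)] l]
      by (subst B(3))
    then have "first_integral c v h q \<eta> = Kh / (16 * cz^2) - 2 * cq * c" using nz(1) by simp
    then show ?thesis using 1 2 by blast
  qed
  have cq0: "cq \<noteq> 0" using nz by (simp add: cq)
  have vq: "vq_form cq D v h q" using main q by (simp add: vq_form_def)
  show ?thesis using reduced_systemI[OF vF hF _ cq0 vq D] main cq0 vq by (simp add: reduced_solution_def)
qed

section \<open>The theorem\<close>

(* The conjuncts, in order: K is a first integral; the subcase h' not identically zero is equivalent to
   the formulas for q and v; cq and K are determined by the solution; h in terms of the Hamiltonian of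
   PVI; conversely K, cq and the solution of PVI are arbitrary; the solution of PVI is determined by h,
   unless h is affine in X; the solution of the Gauss-Codazzi system and the harmonicity; identity with
   Bonnet's solution, in both directions. *)

theorem mainTheorem4:
  fixes c :: complex and D :: "complex set"
  assumes "open D" and "connected D" and "D \<noteq> {}" and "0 \<notin> D" and "1 \<notin> D" and "-1 \<notin> D"
  shows
    "(\<forall>v h q. reduced_system c D v h q \<longrightarrow> (\<exists>K. \<forall>\<eta>\<in>D. first_integral c v h q \<eta> = K)) \<and>
     (\<forall>v h q. (reduced_system c D v h q \<and> (\<exists>\<eta>\<in>D. deriv h \<eta> \<noteq> 0)) \<longleftrightarrow>
        (v holomorphic_on D \<and> h holomorphic_on D \<and> (\<forall>\<eta>\<in>D. reduced_gauss c v h q \<eta>) \<and>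
         (\<exists>cq. cq \<noteq> 0 \<and> vq_form cq D v h q))) \<and>
     (\<forall>v h q. reduced_system c D v h q \<and> (\<exists>\<eta>\<in>D. deriv h \<eta> \<noteq> 0) \<longrightarrow>
        (\<exists>!(cq, K). reduced_solution c D cq K v h q)) \<and>
     (\<forall>v h q cq K. reduced_solution c D cq K v h q \<longrightarrow>
        (\<exists>ti t0 t1 tX. bonnet_params c cq K ti t0 t1 tX \<and>
          (\<forall>\<eta>0\<in>D. \<exists>N V Y. open N \<and> connected N \<and> \<eta>0 \<in> N \<and> N \<subseteq> D \<and> inj_on X_of N \<and>
             V meromorphic_on X_of ` N \<and>
             pvi_solution ti t0 t1 tX (X_of ` (N - {\<eta>0})) V \<and>
             (\<forall>\<eta>\<in>N - {\<eta>0}. h \<eta> = - 8 / cq * (X_of \<eta> * (X_of \<eta> - 1) * H_VI ti t0 t1 tX V (X_of \<eta>))) \<and>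
             Y holomorphic_on X_of ` N \<and>
             (\<forall>X\<in>X_of ` (N - {\<eta>0}). Y X = X * (X - 1) * H_VI ti t0 t1 tX V X) \<and>
             (\<forall>X\<in>X_of ` N.
                SD_Ia ((K + 2 * cq * c) / 4) 0 (- K * (K + 4 * cq * c) / 64) 0 Y X)))) \<and>
     (\<forall>K cq ti t0 t1 tX U V v h q.
        cq \<noteq> 0 \<and> bonnet_params c cq K ti t0 t1 tX \<and> open U \<and> pvi_solution ti t0 t1 tX U V \<and>
        (\<forall>\<eta>\<in>D. X_of \<eta> \<in> U \<and>
           h \<eta> = - 8 / cq * (X_of \<eta> * (X_of \<eta> - 1) * H_VI ti t0 t1 tX V (X_of \<eta>))) \<and>
        vq_form cq D v h q
        \<longrightarrow> reduced_solution c D cq K v h q) \<and>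
     (\<forall>ti t0 t1 tX U V1 V2. open U \<and> connected U \<and>
        pvi_solution ti t0 t1 tX U V1 \<and> pvi_solution ti t0 t1 tX U V2 \<and>
        (\<forall>X\<in>U. H_VI ti t0 t1 tX V1 X = H_VI ti t0 t1 tX V2 X) \<and>
        (\<exists>X\<in>U. deriv (deriv (\<lambda>s. s * (s - 1) * H_VI ti t0 t1 tX V1 s)) X \<noteq> 0)
        \<longrightarrow> (\<forall>X\<in>U. V1 X = V2 X)) \<and>
     (\<forall>v h q cq K g1 g2 G. reduced_solution c D cq K v h q \<and> reduction_domain g1 g2 D G \<longrightarrow>
        (\<forall>u. holomorphic2_on G u \<and> (\<forall>(z, zb)\<in>G. exp (u z zb) = red_E g1 g2 v z zb) \<longrightarrow>
           gauss_codazzi c G u (red_H g1 g2 h) (red_Q g1 g2 q) (red_R g1 g2 q)) \<and>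
        (\<forall>(z, zb)\<in>G. red_Q g1 g2 q z zb \<noteq> 0 \<and> red_R g1 g2 q z zb \<noteq> 0 \<and>
           (deriv g1 z)^2 / red_Q g1 g2 q z zb = 1 / cq * ((g1 z)^2 - (g2 zb)^2) \<and>
           (deriv g2 zb)^2 / red_R g1 g2 q z zb = 1 / cq * ((g1 z)^2 - (g2 zb)^2)) \<and>
        harmonic2_on G (\<lambda>z zb. (deriv g1 z)^2 / red_Q g1 g2 q z zb) \<and>
        harmonic2_on G (\<lambda>z zb. (deriv g2 zb)^2 / red_R g1 g2 q z zb)) \<and>
     (\<forall>v h q cq K cz. reduced_solution c D cq K v h q \<and> cz \<noteq> 0 \<longrightarrow>
        (\<exists>ch chq Kh. chq^2 = 1 \<and> ch \<noteq> 0 \<and> cq = - 4 * chq / (ch * cz) \<and>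
           Kh = 16 * cz^2 * (K + 2 * cq * c) \<and>
           (\<forall>\<Xi>. open \<Xi> \<and> connected \<Xi> \<and> (\<forall>\<xi>\<in>\<Xi>. exp (4 * cz * \<xi>) \<in> D) \<longrightarrow>
             (\<exists>vh hh. bonnet_solution c cz ch chq Kh \<Xi> vh hh \<and>
               (\<forall>g1 g2 G \<phi> \<psi>. reduction_domain g1 g2 D G \<and>
                  (\<forall>(z, zb)\<in>G. \<phi> analytic_on {z} \<and> \<psi> analytic_on {zb} \<and> (\<phi> z + \<psi> zb) / 2 \<in> \<Xi> \<and>
                     g1 z = exp (2 * cz * \<phi> z) \<and> g2 zb = exp (- 2 * cz * \<psi> zb)) \<longrightarrow>
                  (\<forall>(z, zb)\<in>G. identical_to_bonnet cz ch chq vh hh v h q g1 g2 \<phi> \<psi> z zb)))))) \<and>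
     (\<forall>cz ch chq Kh \<Xi> vh hh v h q.
        bonnet_solution c cz ch chq Kh \<Xi> vh hh \<and> (chq * c)^2 = c^2 \<and>
        D = (\<lambda>\<xi>. exp (4 * cz * \<xi>)) ` \<Xi> \<and>
        (\<forall>\<xi>\<in>\<Xi>. v (exp (4 * cz * \<xi>)) = - chq / (ch^2 * cz^2) * exp (4 * cz * \<xi>) * vh \<xi> \<and>
                 h (exp (4 * cz * \<xi>)) = ch * hh \<xi>) \<and>
        (\<forall>\<eta>\<in>D. q \<eta> = (- 4 * chq / (ch * cz)) * \<eta>^2 / (\<eta>^2 - 1))
        \<longrightarrow> (let cq = - 4 * chq / (ch * cz)
             in reduced_solution c D cq (Kh / (16 * cz^2) - 2 * cq * c) v h q))"
proof (intro conjI, goal_cases)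
  case 1
  show ?case using first_integral_constant[OF _ assms(1,2,4-6)] by blast
next
  note D = assms(1,2,4-6) and D' = assms(1,4-6)
  case 2
  show ?case
  proof (intro allI iffI, goal_cases)
    case (1 v h q)
    then have "\<exists>cq. cq \<noteq> 0 \<and> vq_form cq D v h q" using vq_form_if_reduced_system[OF _ D] by blast
    then show ?case using 1 by (simp add: reduced_system_def)
  next
    case (2 v h q)
    then obtain cq where cq: "cq \<noteq> 0" "vq_form cq D v h q" by blast
    have "reduced_system c D v h q" by (rule reduced_systemI[OF _ _ _ cq D']) (use 2 in auto)
    moreover have "\<exists>\<eta>\<in>D. deriv h \<eta> \<noteq> 0" using cq(2) assms(3) by (auto simp: vq_form_def)
    ultimately show ?case by blast
  qed
next
  case 3
  show ?case using reduced_solution_unique[OF _ assms(1,2,4-6)] by blast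
next
  case 4
  show ?case
    unfolding pvi_local_parametrization_def[symmetric]
    using exists_pvi_parametrization[OF _ assms] by blast
next
  case 5
  show ?case using reduced_solution_if_pvi[OF assms(1,4-6)] by blast
next
  case 6
  show ?case using pvi_determined_by_H_VI by blast
next
  note D' = assms(1,4-6)
  case 7
  show ?case
  proof (intro allI impI, elim conjE, goal_cases)
    case (1 v h q cq K g1 g2 G)
    note rs = 1(1) and rd = 1(2)
    have sys: "reduced_system c D v h q" and cq: "cq \<noteq> 0" and q: "\<And>s. s \<in> D \<Longrightarrow> q s = cq * s^2 / (s^2 - 1)"
      using rs by (auto simp: reduced_solution_def vq_form_def)
    note I = inverse_Q_harmonic[OF cq q assms(4-6) rd]
    have "gauss_codazzi c G u (red_H g1 g2 h) (red_Q g1 g2 q) (red_R g1 g2 q)"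
      if u: "holomorphic2_on G u \<and> (\<forall>(z, zb)\<in>G. exp (u z zb) = red_E g1 g2 v z zb)" for u
      by (rule gauss_codazzi_reduction[OF sys D' rd]) (use u in auto)
    then show ?case using I by (intro conjI allI impI ballI case_prodI2) blast+
  qed
next
  note D' = assms(1,4-6)
  case 8
  show ?case
  proof (intro allI impI, elim conjE, goal_cases)
    case (1 v h q cq K cz)
    note rs = 1(1) and cz = 1(2)
    have cq: "cq \<noteq> 0" and q: "\<And>s. s \<in> D \<Longrightarrow> q s = cq * s^2 / (s^2 - 1)"
      using rs by (auto simp: reduced_solution_def vq_form_def)
    define ch where "ch = - 4 / (cq * cz)"
    define hh where "hh = (\<lambda>\<xi>. h (exp (4 * cz * \<xi>)) / ch)"
    define vh where "vh = (\<lambda>\<xi>. - (ch^2 * cz^2) * v (exp (4 * cz * \<xi>)) / exp (4 * cz * \<xi>))"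
    have ch: "ch \<noteq> 0" "cq = - 4 * 1 / (ch * cz)" using cq cz by (simp_all add: ch_def)
    have bs: "bonnet_solution c cz ch 1 (16 * cz^2 * (K + 2 * cq * c)) \<Xi> vh hh"
      if "open \<Xi> \<and> connected \<Xi> \<and> (\<forall>\<xi>\<in>\<Xi>. exp (4 * cz * \<xi>) \<in> D)" for \<Xi>
      by (rule reduced_to_bonnet[OF rs D' cz ch_def _ _ _ hh_def vh_def]) (use that in auto)
    have id: "\<forall>(z, zb)\<in>G. identical_to_bonnet cz ch 1 vh hh v h q g1 g2 \<phi> \<psi> z zb"
      if rd: "reduction_domain g1 g2 D G" and \<phi>: "\<forall>(z, zb)\<in>G. \<phi> analytic_on {z} \<and> \<psi> analytic_on {zb} \<and> (\<phi> z + \<psi> zb) / 2 \<in> \<Xi> \<and>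
                     g1 z = exp (2 * cz * \<phi> z) \<and> g2 zb = exp (- 2 * cz * \<psi> zb)" for g1 g2 G \<phi> \<psi> \<Xi>
    proof (rule ballI, rule case_prodI2)
      fix p z zb assume p: "p \<in> G" "p = (z, zb)"
      have \<phi>': "\<phi> analytic_on {z} \<and> \<psi> analytic_on {zb} \<and> g1 z = exp (2 * cz * \<phi> z) \<and> g2 zb = exp (- 2 * cz * \<psi> zb)"
        if "(z, zb) \<in> G" for z zb using \<phi> that by blast
      show "identical_to_bonnet cz ch 1 vh hh v h q g1 g2 \<phi> \<psi> z zb"
        by (rule reduced_identical_to_bonnet[OF rd cz cq assms(4-6) q ch_def \<phi>' hh_def vh_def]) (use p in auto)
    qed
    show ?case
    proof (rule exI[of _ ch], rule exI[of _ 1], rule exI[of _ "16 * cz^2 * (K + 2 * cq * c)"], intro conjI, goal_cases)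
      case 5
      show ?case
        by (intro allI impI, rule exI[of _ vh], rule exI[of _ hh], rule conjI, erule bs, intro allI impI, rule id, erule conjunct1, erule conjunct2)
    qed (simp_all add: ch)
  qed
next
  case 9
  show ?case
    unfolding Let_def by (intro allI impI, elim conjE, rule bonnet_to_reduced[OF _ _ assms(1,4-6) _ _ refl]) auto
qed

end
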